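(* Let $A,B\in\mathbb{R}^{3\times 3}$ be symmetric matrices such that the pair $(A,B)$ satisfies the (CM) condition, let $K\subset\mathbb{R}^3$ be compact, and let $$S=\{\Sigma(\xi):=(\xi,Q_A(\xi),Q_B(\xi)) : \xi\in K\}\subset\mathbb{R}^5.$$ Then $R_S^*(p\rightarrow 4)$ holds for every $p>12/5$; that is, for every $p>12/5$ there is a constant $C_p>0$ such that $\|E_Sf\|_{L^4(\mathbb{R}^5)}\le C_p\|f\|_{L^p(K)}$ for all $f\in L^p(K)$.
   Context: For a symmetric matrix $A\in\mathbb{R}^{3\times 3}$ write $Q_A(\xi)=\xi^\top A\xi$, $\xi\in\mathbb{R}^3$. The extension operator associated to $S$ is, for $f\in L^1(K)$ and $x\in\mathbb{R}^5$, $$E_Sf(x)=\int_K e^{ix\cdot\Sigma(\xi)}f(\xi)\,d\xi .$$ $R_S^*(p\rightarrow q)$ is said to hold if there is a constant $C_{p,q}>0$ (which may depend on $S$) such that $\|E_Sf\|_{L^q(\mathbb{R}^5)}\le C_{p,q}\|f\|_{L^p(K)}$ for all $f\in L^p(K)$. The pair $(A,B)$ satisfies the (CM) condition if $$\int_{S^1}|\det(x_1A+x_2B)|^{-\gamma}\,d\sigma(x_1,x_2)<\infty\quad\text{for all }0<\gamma<\tfrac23,$$ where $\sigma$ is arc length measure on the unit circle $S^1\subset\mathbb{R}^2$. *)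

theory Defs
  imports "HOL-Analysis.Analysis" "HOL-Probability.Essential_Supremum"
begin

definition quad_form :: "real^3^3 \<Rightarrow> real^3 \<Rightarrow> real" where
  "quad_form A \<xi> = \<xi> \<bullet> (A *v \<xi>)"

text \<open>The ambient space of dimension five is the Euclidean space \<open>real^3 \<times> real \<times> real\<close>, with its
  library inner product and Lebesgue measure.\<close>

definition surface_param :: "real^3^3 \<Rightarrow> real^3^3 \<Rightarrow> real^3 \<Rightarrow> (real^3) \<times> real \<times> real" where
  "surface_param A B \<xi> = (\<xi>, quad_form A \<xi>, quad_form B \<xi>)"

text \<open>Meaningful for \<open>f\<close> integrable on \<open>K\<close>, as is every \<open>f\<close> in \<open>Lp_space (lebesgue_on K) p\<close> when
  \<open>1 \<le> p\<close> and \<open>K\<close> is compact; the Bochner integral of a non-integrable function is \<open>0\<close>.\<close>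

definition extension_op ::
    "real^3^3 \<Rightarrow> real^3^3 \<Rightarrow> (real^3) set \<Rightarrow> (real^3 \<Rightarrow> complex) \<Rightarrow> (real^3) \<times> real \<times> real \<Rightarrow> complex" where
  "extension_op A B K f x =
     (\<integral>\<xi>. exp (\<i> * complex_of_real (x \<bullet> surface_param A B \<xi>)) * f \<xi> \<partial>lebesgue_on K)"

text \<open>The exponent ranges over \<open>0 < p \<le> \<infinity>\<close>. Functions are not identified up to null sets, and the
  value of \<open>Lp_norm\<close> is the usual norm only on \<open>Lp_space\<close>.\<close>

definition Lp_space :: "'a measure \<Rightarrow> ennreal \<Rightarrow> ('a \<Rightarrow> complex) set" where
  "Lp_space M p = {f \<in> borel_measurable M.
     if p = \<infinity> then esssup M (\<lambda>x. ennreal (cmod (f x))) < \<infinity>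
     else integrable M (\<lambda>x. cmod (f x) powr enn2real p)}"

definition Lp_norm :: "'a measure \<Rightarrow> ennreal \<Rightarrow> ('a \<Rightarrow> complex) \<Rightarrow> real" where
  "Lp_norm M p f =
     (if p = \<infinity> then enn2real (esssup M (\<lambda>x. ennreal (cmod (f x))))
      else (\<integral>x. cmod (f x) powr enn2real p \<partial>M) powr (1 / enn2real p))"

text \<open>The estimate \<open>R_S^*(p \<rightarrow> q)\<close> for \<open>S = surface_param A B ` K\<close>. The clause
  \<open>extension_op A B K f \<in> Lp_space lebesgue q\<close> expresses that the left-hand norm is finite, which the
  real-valued \<open>Lp_norm\<close> alone does not.\<close>

definition extension_estimate ::
    "real^3^3 \<Rightarrow> real^3^3 \<Rightarrow> (real^3) set \<Rightarrow> ennreal \<Rightarrow> ennreal \<Rightarrow> bool" where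
  "extension_estimate A B K p q \<longleftrightarrow>
     (\<exists>C>0. \<forall>f\<in>Lp_space (lebesgue_on K) p.
        extension_op A B K f \<in> Lp_space lebesgue q \<and>
        Lp_norm lebesgue q (extension_op A B K f) \<le> C * Lp_norm (lebesgue_on K) p f)"

text \<open>Arc length on the unit circle, as a Borel measure on the plane concentrated on the circle.\<close>

definition circle_arc_length :: "(real \<times> real) measure" where
  "circle_arc_length = distr (restrict_space lborel {0..<2 * pi}) borel (\<lambda>t. (cos t, sin t))"

lemma nn_integral_circle_arc_length:
  assumes "f \<in> borel_measurable borel"
  shows "(\<integral>\<^sup>+x. f x \<partial>circle_arc_length) = (\<integral>\<^sup>+t\<in>{0..<2 * pi}. f (cos t, sin t) \<partial>lborel)"
proof -
  have "(\<lambda>t::real. (cos t, sin t)) \<in> borel_measurable (restrict_space lborel {0..<2 * pi})"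
    by (intro measurable_restrict_space1) simp
  then show ?thesis
    unfolding circle_arc_length_def using assms
    by (simp add: nn_integral_distr nn_integral_restrict_space)
qed

text \<open>The integrand is \<open>\<bar>det (x\<^sub>1 A + x\<^sub>2 B)\<bar>\<close> to the power \<open>- \<gamma>\<close>, with value \<open>\<infinity>\<close> where the
  determinant vanishes. It is written as an inverse in \<open>ennreal\<close> because \<open>0 powr (- \<gamma>) = 0\<close>.\<close>

definition CM_condition :: "real^3^3 \<Rightarrow> real^3^3 \<Rightarrow> bool" where
  "CM_condition A B \<longleftrightarrow>
     (\<forall>\<gamma>::real. 0 < \<gamma> \<and> \<gamma> < 2/3 \<longrightarrow>
        (\<integral>\<^sup>+(x1, x2). inverse (ennreal (\<bar>det (x1 *\<^sub>R A + x2 *\<^sub>R B)\<bar> powr \<gamma>)) \<partial>circle_arc_length) < \<infinity>)"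

end

theory Submission
  imports Defs "HOL-Probability.Probability"
begin

text \<open>The modulus \<open>|E f|\<^sup>2\<close> is the Fourier transform of the image of \<open>f(\<xi>) cnj f(\<eta>)\<close> under
  \<open>(\<xi>, \<eta>) \<mapsto> \<Sigma>(\<xi>) - \<Sigma>(\<eta>)\<close>. In the coordinates \<open>u = \<xi> - \<eta>\<close>, \<open>v = \<xi> + \<eta>\<close> this map is
  \<open>(u, A u \<bullet> v, B u \<bullet> v)\<close>, so its fibres over \<open>u\<close> are the lines in direction \<open>w(u) = A u \<times> B u\<close>, and
  Plancherel bounds the fourth power of the \<open>L\<^sup>4\<close> norm of \<open>E f\<close> by the integral of
  \<open>|f(a) f(a + u) f(a + m w(u)) f(a + u + m w(u))|\<close> over \<open>a\<close>, \<open>u\<close> and \<open>m\<close>.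

  The (CM) condition says that the binary cubic form \<open>det (x A + y B)\<close> has no repeated real factor,
  hence distinct complex roots. The pencil then has a normal form over \<open>\<real> \<times> \<real> \<times> \<real>\<close> or
  \<open>\<real> \<times> \<complex>\<close> in which \<open>w(u) = N(u) c / u\<close> for the product algebra with norm \<open>N\<close>. After the
  substitution \<open>l = m N(u)\<close> the integral over \<open>a\<close> and \<open>u\<close> for fixed \<open>l\<close> factors over the fields. On a field of
  real dimension \<open>n\<close>, Young's inequality for \<open>|u|\<^sup>2 \<ge> |l c|\<close> and the inversion \<open>u \<mapsto> l c / u\<close> for the other \<open>u\<close>
  bound it on \<open>L\<^sup>p\<close>, \<open>2 < p < 4\<close>, by \<open>|l|\<close> to the power \<open>-(n/2)(4/p - 1)\<close>. The three dimensions give the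
  exponent \<open>-(3/2)(4/p - 1)\<close>, which is integrable at \<open>l = 0\<close> exactly when \<open>p > 12/5\<close>.\<close>

section \<open>Invariant measures\<close>

text \<open>The exponent (3/2)(4/p - 1) is below 1, so the power of |l| that is integrable at zero
  diverges at infinity. Compactness of \<open>K\<close> removes large \<open>l\<close>: a component
  of \<open>u\<close> times the matching component of the side \<open>l c / u\<close> equals
  \<open>l c\<close>, and both sides of a parallelogram with vertices in \<open>K\<close> are
  bounded. Compactness also reduces p >= 4 to an exponent inside (12/5, 4), the range in which the
  interpolation with the weight |u|^(-n) works.

  On a field of dimension n this weight is Haar measure of the multiplicative group. The tail
  estimate is available only away from zero; inversion preserves the measure, maps the region near
  zero to the other one and exchanges the two sides of the parallelogram.

  Positive quantities are kept in \<open>ennreal\<close>, so that Tonelli and changes of variables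
  need no integrability. Only upper bounds matter: Plancherel enters as an inequality with some
  constant, and linear changes of variables carry a positive constant \<open>k\<close>.\<close>

lemma borel_measurable_fst_snd [measurable (raw)]:
  fixes f :: "'c \<Rightarrow> 'a::second_countable_topology \<times> 'b::second_countable_topology"
  assumes "f \<in> borel_measurable M"
  shows "(\<lambda>x. fst (f x)) \<in> borel_measurable M" and "(\<lambda>x. snd (f x)) \<in> borel_measurable M"
  using assms by (simp_all add: borel_prod[symmetric])

lemma nn_integral_lborel_pair:
  fixes f :: "'a::euclidean_space \<times> 'b::euclidean_space \<Rightarrow> ennreal"
  assumes [measurable]: "f \<in> borel_measurable borel"
  shows "(\<integral>\<^sup>+z. f z \<partial>lborel) = (\<integral>\<^sup>+x. \<integral>\<^sup>+y. f (x, y) \<partial>lborel \<partial>lborel)"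
proof -
  have "f \<in> borel_measurable (lborel \<Otimes>\<^sub>M lborel)"
    by (simp add: lborel_prod)
  from lborel.nn_integral_fst[OF this] show ?thesis
    by (simp add: lborel_prod)
qed

lemma nn_integral_lborel_swap:
  fixes f :: "'a::euclidean_space \<Rightarrow> 'b::euclidean_space \<Rightarrow> ennreal"
  assumes "case_prod f \<in> borel_measurable borel"
  shows "(\<integral>\<^sup>+x. \<integral>\<^sup>+y. f x y \<partial>lborel \<partial>lborel) = (\<integral>\<^sup>+y. \<integral>\<^sup>+x. f x y \<partial>lborel \<partial>lborel)"
  using lborel_pair.Fubini'[of f] assms by (simp add: lborel_prod)

lemma nn_integral_lborel_shift:
  fixes f :: "'a::euclidean_space \<Rightarrow> ennreal"
  assumes [measurable]: "f \<in> borel_measurable borel"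
  shows "(\<integral>\<^sup>+x. f (c + x) \<partial>lborel) = (\<integral>\<^sup>+x. f x \<partial>lborel)"
  using nn_integral_distr[of "(+) c" lborel borel f] by (simp add: lborel_distr_plus)

lemma nn_integral_lborel_shift':
  fixes f :: "'a::euclidean_space \<Rightarrow> ennreal"
  assumes "f \<in> borel_measurable borel"
  shows "(\<integral>\<^sup>+x. f (x + c) \<partial>lborel) = (\<integral>\<^sup>+x. f x \<partial>lborel)"
    and "(\<integral>\<^sup>+x. f (x - c) \<partial>lborel) = (\<integral>\<^sup>+x. f x \<partial>lborel)"
  using nn_integral_lborel_shift[OF assms, of c] nn_integral_lborel_shift[OF assms, of "-c"]
  by (simp_all add: add.commute)

text \<open>Both sides of the conclusion are the double integral of \<open>f (x + y) h y\<close>, with the integrals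
  taken in either order.\<close>

lemma translation_invariant_unique:
  fixes M :: "'a::euclidean_space measure" and f h :: "'a \<Rightarrow> ennreal"
  assumes M: "sigma_finite_measure M" "sets M = sets borel"
    and inv: "\<And>f c. f \<in> borel_measurable borel \<Longrightarrow> (\<integral>\<^sup>+x. f (x + c) \<partial>M) = (\<integral>\<^sup>+x. f x \<partial>M)"
    and [measurable]: "f \<in> borel_measurable borel" "h \<in> borel_measurable borel"
  shows "(\<integral>\<^sup>+x. f x \<partial>M) * (\<integral>\<^sup>+x. h x \<partial>lborel) = (\<integral>\<^sup>+x. f x \<partial>lborel) * (\<integral>\<^sup>+x. h (- x) \<partial>M)"
proof -
  interpret M: sigma_finite_measure M by fact
  interpret P: pair_sigma_finite M lborel
    by (simp add: pair_sigma_finite_def M lborel.sigma_finite_measure_axioms)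
  note [measurable_cong] = M(2)
  have [measurable_cong]: "sets (M \<Otimes>\<^sub>M lborel) = sets (borel \<Otimes>\<^sub>M borel)"
    by (intro sets_pair_measure_cong) (simp_all add: M)
  have "(\<integral>\<^sup>+x. f x \<partial>M) * (\<integral>\<^sup>+x. h x \<partial>lborel) = (\<integral>\<^sup>+y. (\<integral>\<^sup>+x. f x \<partial>M) * h y \<partial>lborel)"
    by (simp add: nn_integral_cmult)
  also have "\<dots> = (\<integral>\<^sup>+y. (\<integral>\<^sup>+x. f (x + y) * h y \<partial>M) \<partial>lborel)"
  proof (rule nn_integral_cong)
    fix y :: 'a
    have "(\<integral>\<^sup>+x. f (x + y) * h y \<partial>M) = (\<integral>\<^sup>+x. f (x + y) \<partial>M) * h y"
      by (rule nn_integral_multc) measurable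
    then show "(\<integral>\<^sup>+x. f x \<partial>M) * h y = (\<integral>\<^sup>+x. f (x + y) * h y \<partial>M)"
      using inv[of f y] by simp
  qed
  also have "\<dots> = (\<integral>\<^sup>+x. (\<integral>\<^sup>+y. f (x + y) * h y \<partial>lborel) \<partial>M)"
    by (rule P.Fubini') measurable
  also have "\<dots> = (\<integral>\<^sup>+x. (\<integral>\<^sup>+y. f y * h (y - x) \<partial>lborel) \<partial>M)"
  proof (rule nn_integral_cong)
    fix x :: 'a
    show "(\<integral>\<^sup>+y. f (x + y) * h y \<partial>lborel) = (\<integral>\<^sup>+y. f y * h (y - x) \<partial>lborel)"
      using nn_integral_lborel_shift[of "\<lambda>y. f y * h (y - x)" x] by simp
  qed
  also have "\<dots> = (\<integral>\<^sup>+y. (\<integral>\<^sup>+x. f y * h (y - x) \<partial>M) \<partial>lborel)"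
    by (rule P.Fubini'[symmetric]) measurable
  also have "\<dots> = (\<integral>\<^sup>+y. f y * (\<integral>\<^sup>+x. h (- x) \<partial>M) \<partial>lborel)"
  proof (rule nn_integral_cong)
    fix y :: 'a
    have "(\<integral>\<^sup>+x. f y * h (y - x) \<partial>M) = f y * (\<integral>\<^sup>+x. h (y - x) \<partial>M)"
      by (rule nn_integral_cmult) measurable
    then show "(\<integral>\<^sup>+x. f y * h (y - x) \<partial>M) = f y * (\<integral>\<^sup>+x. h (- x) \<partial>M)"
      using inv[of "\<lambda>x. h (- x)" "- y"] by simp
  qed
  also have "\<dots> = (\<integral>\<^sup>+x. f x \<partial>lborel) * (\<integral>\<^sup>+x. h (- x) \<partial>M)"
    by (rule nn_integral_multc) measurable
  finally show ?thesis .
qed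

text \<open>Additivity and surjectivity of \<open>T\<close> make the image of Lebesgue measure
  translation invariant, and uniqueness makes it a multiple of Lebesgue measure. The factor is the
  ratio of the masses of the unit ball; the last conclusion exports it, so that \<open>k\<close> can
  be computed when the preimage of the ball is known. Domain and range may be different types, where
  there is no determinant to use.\<close>

lemma linear_iso_nn_integral:
  fixes T :: "'a::euclidean_space \<Rightarrow> 'b::euclidean_space"
  assumes T: "linear T" "bij T"
  obtains k :: real where "k > 0"
    and "\<And>f::'b \<Rightarrow> ennreal. f \<in> borel_measurable borel \<Longrightarrow>
      (\<integral>\<^sup>+x. f (T x) \<partial>lborel) = ennreal k * (\<integral>\<^sup>+y. f y \<partial>lborel)"
    and "emeasure lborel (T -` ball 0 1) = ennreal k * emeasure lborel (ball (0::'b) 1)"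
proof -
  have contT: "continuous_on UNIV T"
    using T(1) by (simp add: linear_continuous_on linear_conv_bounded_linear)
  then have [measurable]: "T \<in> borel_measurable borel"
    by (rule borel_measurable_continuous_onI)
  \<comment> \<open>The lower bound confines preimages of balls to balls, so the image measure is
    finite on balls and hence sigma-finite.\<close>
  obtain b where b: "b > 0" "\<And>x. b * norm x \<le> norm (T x)"
    using linear_inj_bounded_below_pos[OF T(1)] T(2) by (metis bij_is_inj mult.commute)
  define M where "M = distr lborel borel T"
  have sub: "T -` cball 0 r \<subseteq> cball 0 (r / b)" for r
  proof
    fix x assume "x \<in> T -` cball 0 r"
    then have "b * norm x \<le> r" using b(2)[of x] by simp
    then show "x \<in> cball 0 (r / b)" using b(1) by (simp add: field_simps)
  qed
  have fin: "emeasure M (cball 0 r) < \<infinity>" for r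
  proof -
    have "emeasure M (cball 0 r) = emeasure lborel (T -` cball 0 r)"
      by (simp add: M_def emeasure_distr)
    also have "\<dots> \<le> emeasure lborel (cball (0::'a) (r / b))"
      by (intro emeasure_mono sub) auto
    also have "\<dots> < \<infinity>" by (rule emeasure_bounded_finite) simp
    finally show ?thesis .
  qed
  have sf: "sigma_finite_measure M"
  proof
    have "(\<Union>n::nat. cball 0 (real n)) = (UNIV::'b set)"
      by (auto simp: real_arch_simple)
    then show "\<exists>A. countable A \<and> A \<subseteq> sets M \<and> \<Union>A = space M \<and> (\<forall>a\<in>A. emeasure M a \<noteq> \<infinity>)"
      using fin by (intro exI[of _ "range (\<lambda>n::nat. cball 0 (real n))"])
        (auto simp: M_def less_top)
  qed
  have inv: "(\<integral>\<^sup>+x. f (x + c) \<partial>M) = (\<integral>\<^sup>+x. f x \<partial>M)"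
    if [measurable]: "f \<in> borel_measurable borel" for f :: "'b \<Rightarrow> ennreal" and c
  proof -
    obtain d where d: "T d = c" using T(2) by (metis bij_pointE)
    have "(\<integral>\<^sup>+x. f (x + c) \<partial>M) = (\<integral>\<^sup>+x. f (T (x + d)) \<partial>lborel)"
      using d T(1) by (simp add: M_def nn_integral_distr linear_add)
    also have "\<dots> = (\<integral>\<^sup>+x. f (T x) \<partial>lborel)"
      by (rule nn_integral_lborel_shift') measurable
    finally show ?thesis by (simp add: M_def nn_integral_distr)
  qed
  let ?B = "ball (0::'b) 1"
  \<comment> \<open>Symmetry of the ball removes the reflection from the uniqueness
    statement.\<close>
  have Mball: "(\<integral>\<^sup>+x. indicator ?B (- x) \<partial>M) = emeasure M ?B"
  proof -
    have "(\<integral>\<^sup>+x. indicator ?B (- x) \<partial>M) = (\<integral>\<^sup>+x. indicator ?B x \<partial>M)"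
      by (intro nn_integral_cong) (simp add: indicator_def)
    then show ?thesis by (simp add: M_def)
  qed
  have eq: "(\<integral>\<^sup>+x. f x \<partial>M) * emeasure lborel ?B = (\<integral>\<^sup>+x. f x \<partial>lborel) * emeasure M ?B"
    if "f \<in> borel_measurable borel" for f :: "'b \<Rightarrow> ennreal"
  proof -
    have "(indicator ?B :: 'b \<Rightarrow> ennreal) \<in> borel_measurable borel"
      by (rule borel_measurable_indicator) simp
    moreover have "sets M = sets borel"
      by (simp add: M_def)
    ultimately have "(\<integral>\<^sup>+x. f x \<partial>M) * (\<integral>\<^sup>+x. indicator ?B x \<partial>lborel)
        = (\<integral>\<^sup>+x. f x \<partial>lborel) * (\<integral>\<^sup>+x. indicator ?B (- x) \<partial>M)"
      using translation_invariant_unique[OF sf _ inv that] by blast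
    then show ?thesis by (simp add: Mball)
  qed
  have pos: "0 < measure lborel ?B" by (rule content_ball_pos) simp
  have eB: "emeasure lborel ?B = ennreal (measure lborel ?B)"
    using emeasure_bounded_finite[of ?B] by (simp add: emeasure_eq_ennreal_measure)
  have "emeasure M ?B \<le> emeasure M (cball 0 1)"
    by (intro emeasure_mono) (auto simp: M_def)
  with fin[of 1] have fB: "emeasure M ?B < \<infinity>" by (meson le_less_trans)
  have "M \<noteq> null_measure borel \<and> emeasure M ?B > 0"
  proof -
    have op: "open (T -` ?B)"
      using contT by (metis open_vimage open_ball)
    have "0 \<in> T -` ?B" using linear_0[OF T(1)] by simp
    with op have "emeasure lborel (T -` ?B) \<noteq> 0"
      by (metis emeasure_lborel_countable empty_iff open_contains_ball_eq
          content_ball_pos emeasure_mono measure_def enn2real_0 le_zero_eq less_irrefl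
          sets_lborel borel_open)
    then have "emeasure M ?B > 0" by (simp add: M_def emeasure_distr zero_less_iff_neq_zero)
    then show ?thesis by (metis emeasure_null_measure less_irrefl)
  qed
  then have pB: "emeasure M ?B > 0" ..
  define k where "k = measure M ?B / measure lborel ?B"
  have kM: "emeasure M ?B = ennreal (measure M ?B)"
    using fB by (simp add: emeasure_eq_ennreal_measure less_top)
  have kpos: "k > 0" using pos pB unfolding k_def kM by simp
  have k2: "measure M ?B = k * measure lborel ?B" using pos by (simp add: k_def)
  show ?thesis
  proof (rule that[OF kpos])
    fix f :: "'b \<Rightarrow> ennreal"
    assume [measurable]: "f \<in> borel_measurable borel"
    have "(\<integral>\<^sup>+x. f (T x) \<partial>lborel) * ennreal (measure lborel ?B)
        = (ennreal k * (\<integral>\<^sup>+y. f y \<partial>lborel)) * ennreal (measure lborel ?B)"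
      using eq[of f] kpos unfolding eB kM k2
      by (simp add: M_def nn_integral_distr ennreal_mult mult_ac)
    then show "(\<integral>\<^sup>+x. f (T x) \<partial>lborel) = ennreal k * (\<integral>\<^sup>+y. f y \<partial>lborel)"
      using pos unfolding mult_right_ennreal_cancel by simp
  next
    show "emeasure lborel (T -` ball 0 1) = ennreal k * emeasure lborel ?B"
      using kM kpos unfolding eB k2 by (simp add: M_def emeasure_distr ennreal_mult)
  qed
qed

section \<open>A Bessel inequality for the Fourier transform\<close>

lemma nn_integral_lborel_scaleR:
  fixes f :: "'a::euclidean_space \<Rightarrow> ennreal"
  assumes [measurable]: "f \<in> borel_measurable borel" and "c \<noteq> 0"
  shows "ennreal (\<bar>c\<bar> ^ DIM('a)) * (\<integral>\<^sup>+x. f (c *\<^sub>R x) \<partial>lborel) = (\<integral>\<^sup>+x. f x \<partial>lborel)"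
proof -
  have "(\<integral>\<^sup>+x. f x \<partial>lborel)
      = (\<integral>\<^sup>+x. f x \<partial>density (distr lborel borel (\<lambda>x. 0 + c *\<^sub>R x)) (\<lambda>_. \<bar>c\<bar> ^ DIM('a)))"
    using lborel_affine[OF assms(2), of "0::'a"] by simp
  then show ?thesis
    by (simp add: nn_integral_density nn_integral_distr nn_integral_cmult)
qed

lemma integrable_lborel_pairI:
  fixes F :: "'a::euclidean_space \<times> 'b::euclidean_space \<Rightarrow> complex"
  assumes [measurable]: "F \<in> borel_measurable borel"
    and "(\<integral>\<^sup>+x. \<integral>\<^sup>+y. ennreal (cmod (F (x, y))) \<partial>lborel \<partial>lborel) < \<infinity>"
  shows "integrable lborel F"
  using assms(2) by (intro integrableI_bounded) (simp_all add: nn_integral_lborel_pair)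

lemma integral_lborel_pair:
  fixes F :: "'a::euclidean_space \<times> 'b::euclidean_space \<Rightarrow> complex"
  assumes "integrable lborel F"
  shows "(\<integral>z. F z \<partial>lborel) = (\<integral>x. \<integral>y. F (x, y) \<partial>lborel \<partial>lborel)"
    and "(\<integral>z. F z \<partial>lborel) = (\<integral>y. \<integral>x. F (x, y) \<partial>lborel \<partial>lborel)"
    and "AE x in lborel. integrable lborel (\<lambda>y. F (x, y))"
    and "integrable lborel (\<lambda>x. \<integral>y. F (x, y) \<partial>lborel)"
proof -
  have i: "integrable (lborel \<Otimes>\<^sub>M lborel) (case_prod (\<lambda>x y. F (x, y)))"
    using assms by (simp add: lborel_prod)
  show "(\<integral>z. F z \<partial>lborel) = (\<integral>x. \<integral>y. F (x, y) \<partial>lborel \<partial>lborel)"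
    using lborel_pair.integral_fst[OF i] by (simp add: lborel_prod)
  then show "(\<integral>z. F z \<partial>lborel) = (\<integral>y. \<integral>x. F (x, y) \<partial>lborel \<partial>lborel)"
    using lborel_pair.Fubini_integral[OF i] by simp
  show "AE x in lborel. integrable lborel (\<lambda>y. F (x, y))"
    using lborel_pair.AE_integrable_fst[OF i] by simp
  show "integrable lborel (\<lambda>x. \<integral>y. F (x, y) \<partial>lborel)"
    using lborel_pair.integrable_fst[OF i] by simp
qed

lemma borel_measurable_cnj [measurable (raw)]:
  "f \<in> borel_measurable M \<Longrightarrow> (\<lambda>x. cnj (f x)) \<in> borel_measurable M"
  by (rule borel_measurable_continuous_on[OF continuous_on_cnj]) (auto intro: continuous_intros)

lemma
  fixes \<phi> :: "'a::euclidean_space \<Rightarrow> complex"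
  assumes i: "integrable lborel \<phi>"
  shows integrable_tensor_cnj: "integrable lborel (\<lambda>z. \<phi> (fst z) * cnj (\<phi> (snd z)))"
    and norm_integral_square:
      "complex_of_real ((cmod (\<integral>x. \<phi> x \<partial>lborel))\<^sup>2) = (\<integral>z. \<phi> (fst z) * cnj (\<phi> (snd z)) \<partial>lborel)"
proof -
  have m: "\<phi> \<in> borel_measurable borel"
    using borel_measurable_integrable[OF i] by simp
  note m[measurable]
  have [measurable]: "(\<lambda>z. \<phi> (fst z) * cnj (\<phi> (snd z))) \<in> borel_measurable borel"
    by measurable
  have "(\<integral>\<^sup>+x. \<integral>\<^sup>+y. ennreal (cmod (\<phi> x * cnj (\<phi> y))) \<partial>lborel \<partial>lborel)
      = (\<integral>\<^sup>+x. ennreal (cmod (\<phi> x)) \<partial>lborel) * (\<integral>\<^sup>+x. ennreal (cmod (\<phi> x)) \<partial>lborel)"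
    by (simp add: norm_mult ennreal_mult nn_integral_cmult nn_integral_multc)
  also have "\<dots> < \<infinity>"
    using i by (simp add: integrable_iff_bounded ennreal_mult_less_top)
  finally show I: "integrable lborel (\<lambda>z. \<phi> (fst z) * cnj (\<phi> (snd z)))"
    by (intro integrable_lborel_pairI) simp_all
  show "complex_of_real ((cmod (\<integral>x. \<phi> x \<partial>lborel))\<^sup>2) = (\<integral>z. \<phi> (fst z) * cnj (\<phi> (snd z)) \<partial>lborel)"
    unfolding integral_lborel_pair(1)[OF I] by (simp add: complex_norm_square del: of_real_power)
qed

section \<open>Gaussians and their Fourier transforms\<close>

definition std_gauss :: "'a::euclidean_space \<Rightarrow> real" where
  "std_gauss x = (\<Prod>b\<in>Basis. std_normal_density (x \<bullet> b))"

lemma std_gauss_nonneg: "0 \<le> std_gauss x"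
  unfolding std_gauss_def by (intro prod_nonneg) (simp add: normal_density_nonneg)

lemma std_gauss_pos: "0 < std_gauss x"
  unfolding std_gauss_def by (intro prod_pos) (simp add: normal_density_pos)

lemma std_gauss_measurable [measurable]: "std_gauss \<in> borel_measurable borel"
  unfolding std_gauss_def by measurable

lemma prod_exp_inner_Basis:
  "(\<Prod>b\<in>Basis. exp (- (z \<bullet> b)\<^sup>2 / 2)) = exp (- (norm (z::'a::euclidean_space))\<^sup>2 / 2)"
  by (simp add: exp_sum[symmetric] norm_eq_sqrt_inner euclidean_inner[of z z] sum_negf
      sum_divide_distrib power2_eq_square sum_nonneg)

lemma exp_norm_eq_std_gauss:
  "exp (- (norm z)\<^sup>2 / 2) = sqrt (2 * pi) ^ DIM('a) * std_gauss (z::'a::euclidean_space)"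
  unfolding prod_exp_inner_Basis[symmetric]
  by (simp add: std_gauss_def std_normal_density_def prod_dividef power_divide)

lemma nn_integral_std_gauss: "(\<integral>\<^sup>+x. ennreal (std_gauss (x::'a::euclidean_space)) \<partial>lborel) = 1"
proof -
  have "(\<integral>\<^sup>+x. ennreal (std_gauss (x::'a)) \<partial>lborel)
      = (\<integral>\<^sup>+x. (\<Prod>b\<in>(Basis::'a set). ennreal (std_normal_density (x \<bullet> b))) \<partial>lborel)"
    by (simp add: std_gauss_def prod_ennreal normal_density_nonneg)
  also have "\<dots> = (\<Prod>b\<in>(Basis::'a set). (\<integral>\<^sup>+x. ennreal (std_normal_density x) \<partial>lborel))"
    by (rule nn_integral_lborel_prod) auto
  also have "(\<integral>\<^sup>+x. ennreal (std_normal_density x) \<partial>lborel) = 1"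
    using integral_normal_density[of 1 0] by (subst nn_integral_eq_integral) (auto simp: normal_density_nonneg)
  finally show ?thesis by simp
qed

lemma integrable_std_gauss: "integrable lborel (std_gauss :: 'a::euclidean_space \<Rightarrow> real)"
  by (intro integrableI_nonneg) (auto simp: std_gauss_nonneg nn_integral_std_gauss)

text \<open>Both factors are products over the coordinates, so the integral splits into
  one-dimensional ones, each the characteristic function of the standard normal distribution at
  \<open>z \<bullet> b\<close>.\<close>

lemma fourier_std_gauss:
  fixes z :: "'a::euclidean_space"
  shows "(\<integral>y. complex_of_real (std_gauss y) * exp (\<i> * complex_of_real (y \<bullet> z)) \<partial>lborel)
    = complex_of_real (exp (- (norm z)\<^sup>2 / 2))"
proof -
  let ?f = "\<lambda>b t. complex_of_real (std_normal_density t) * exp (\<i> * complex_of_real (t * (z \<bullet> b)))"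
  have f1: "integrable lborel (?f b)" for b
    by (rule Bochner_Integration.integrable_bound[OF integrable_normal_density[of 1 0]])
       (auto simp: norm_mult normal_density_nonneg)
  have f2: "(\<integral>t. ?f b t \<partial>lborel) = complex_of_real (exp (- (z \<bullet> b)\<^sup>2 / 2))" for b
  proof -
    have "(\<integral>t. ?f b t \<partial>lborel) = char std_normal_distribution (z \<bullet> b)"
      unfolding char_def
      by (subst integral_density)
         (auto simp: normal_density_nonneg scaleR_conv_of_real mult_ac)
    then show ?thesis by (simp add: char_std_normal_distribution)
  qed
  interpret product_sigma_finite "\<lambda>_::'a. lborel :: real measure" ..
  have [simp]: "(\<Sum>b\<in>Basis. f b *\<^sub>R b) \<bullet> b' = f b'" if "b' \<in> Basis" for f and b' :: 'a
    using that by simp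
  have "(\<integral>y. complex_of_real (std_gauss y) * exp (\<i> * complex_of_real (y \<bullet> z)) \<partial>lborel)
      = (\<integral>y. (\<Prod>b\<in>Basis. ?f b (y \<bullet> b)) \<partial>lborel)"
  proof (rule arg_cong[where f="integral\<^sup>L lborel"], rule ext)
    fix y :: 'a
    have "exp (\<i> * complex_of_real (y \<bullet> z)) = (\<Prod>b\<in>Basis. exp (\<i> * complex_of_real ((y \<bullet> b) * (z \<bullet> b))))"
      by (subst euclidean_inner) (simp add: exp_sum[symmetric] sum_distrib_left)
    then show "complex_of_real (std_gauss y) * exp (\<i> * complex_of_real (y \<bullet> z))
        = (\<Prod>b\<in>Basis. ?f b (y \<bullet> b))"
      by (simp only: std_gauss_def of_real_prod prod.distrib)
  qed
  also have "\<dots> = (\<integral>f. (\<Prod>b\<in>Basis. ?f b (f b)) \<partial>(\<Pi>\<^sub>M b\<in>(Basis::'a set). lborel))"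
    by (subst lborel_eq, subst integral_distr) (auto intro!: prod.cong simp del: inner_sum_left_Basis)
  also have "\<dots> = (\<Prod>b\<in>(Basis::'a set). (\<integral>t. ?f b t \<partial>lborel))"
    by (rule product_integral_prod) (simp, rule f1)
  also have "\<dots> = complex_of_real (\<Prod>b\<in>(Basis::'a set). exp (- (z \<bullet> b)\<^sup>2 / 2))"
    by (simp only: f2 of_real_prod)
  also have "(\<Prod>b\<in>(Basis::'a set). exp (- (z \<bullet> b)\<^sup>2 / 2)) = exp (- (norm z)\<^sup>2 / 2)"
    by (rule prod_exp_inner_Basis)
  finally show ?thesis .
qed

text \<open>The square is a double integral over z and z'; integrating the Gaussian in y before
  these turns the oscillation into a positive kernel that decays in c (z - z'), and only then are
  absolute values taken. The Gaussian weight makes the triple integral absolutely convergent, as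
  Fubini demands.\<close>

lemma bessel_gauss:
  fixes h :: "'a::euclidean_space \<Rightarrow> complex"
  assumes h: "integrable lborel h"
  defines "H \<equiv> \<lambda>x. \<integral>z. exp (\<i> * complex_of_real (x \<bullet> z)) * h z \<partial>lborel"
  shows "(\<integral>\<^sup>+y. ennreal (std_gauss y * (cmod (H (c *\<^sub>R y)))\<^sup>2) \<partial>lborel)
    \<le> (\<integral>\<^sup>+z. \<integral>\<^sup>+z'. ennreal (cmod (h z) * cmod (h z') * exp (- (norm (c *\<^sub>R (z - z')))\<^sup>2 / 2)) \<partial>lborel \<partial>lborel)"
proof -
  have m: "h \<in> borel_measurable borel"
    using borel_measurable_integrable[OF h] by simp
  note m[measurable]
  have H_meas [measurable]: "H \<in> borel_measurable borel"
    unfolding H_def by measurable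
  let ?I = "\<lambda>y. std_gauss y * (cmod (H (c *\<^sub>R y)))\<^sup>2"
  let ?\<Psi> = "\<lambda>(y, z). complex_of_real (std_gauss y) * exp (\<i> * complex_of_real (y \<bullet> (c *\<^sub>R (fst z - snd z))))
    * (h (fst z) * cnj (h (snd z)))"
  have E: "integrable lborel (\<lambda>z. exp (\<i> * complex_of_real (x \<bullet> z)) * h z)" for x
    by (rule Bochner_Integration.integrable_bound[OF h]) (auto simp: norm_mult)
  have Hb: "cmod (H x) \<le> (\<integral>z. cmod (h z) \<partial>lborel)" for x
    unfolding H_def using integral_norm_bound[of lborel "\<lambda>z. exp (\<i> * complex_of_real (x \<bullet> z)) * h z"]
    by (simp add: norm_mult)
  have I: "integrable lborel ?I"
  proof (rule Bochner_Integration.integrable_bound)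
    show "integrable lborel (\<lambda>y::'a. std_gauss y * (\<integral>z. cmod (h z) \<partial>lborel)\<^sup>2)"
      by (intro integrable_mult_left integrable_std_gauss)
    show "AE y in lborel. norm (?I y) \<le> norm (std_gauss y * (\<integral>z. cmod (h z) \<partial>lborel)\<^sup>2)"
      using Hb by (auto simp: abs_mult intro!: mult_left_mono power_mono)
  qed measurable
  have \<Psi>_meas: "?\<Psi> \<in> borel_measurable borel"
    by measurable
  have T: "integrable lborel (\<lambda>z. h (fst z) * cnj (h (snd z)))"
    by (rule integrable_tensor_cnj[OF h])
  have [measurable]: "(\<lambda>z. h (fst z) * cnj (h (snd z))) \<in> borel_measurable borel"
    using borel_measurable_integrable[OF T] by simp
  have \<Psi>: "integrable lborel ?\<Psi>"
  proof (rule integrable_lborel_pairI[OF \<Psi>_meas])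
    have "(\<integral>\<^sup>+y. \<integral>\<^sup>+z. ennreal (cmod (?\<Psi> (y, z))) \<partial>lborel \<partial>lborel)
        = (\<integral>\<^sup>+y. \<integral>\<^sup>+z. ennreal (std_gauss y) * ennreal (cmod (h (fst z) * cnj (h (snd z)))) \<partial>lborel \<partial>(lborel::'a measure))"
      by (simp add: norm_mult ennreal_mult std_gauss_nonneg)
    also have "\<dots> = (\<integral>\<^sup>+z. ennreal (cmod (h (fst z) * cnj (h (snd z)))) \<partial>lborel)"
      by (simp add: nn_integral_cmult nn_integral_multc nn_integral_std_gauss)
    also have "\<dots> < \<infinity>"
      using T by (simp add: integrable_iff_bounded)
    finally show "(\<integral>\<^sup>+y. \<integral>\<^sup>+z. ennreal (cmod (?\<Psi> (y, z))) \<partial>lborel \<partial>lborel) < \<infinity>" .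
  qed
  have "complex_of_real (\<integral>y. ?I y \<partial>lborel) = (\<integral>y. \<integral>z. ?\<Psi> (y, z) \<partial>lborel \<partial>lborel)"
    unfolding integral_complex_of_real[symmetric]
  proof (rule Bochner_Integration.integral_cong[OF refl])
    fix y :: 'a
    have "complex_of_real ((cmod (H (c *\<^sub>R y)))\<^sup>2)
      = (\<integral>z. exp (\<i> * complex_of_real (y \<bullet> (c *\<^sub>R (fst z - snd z)))) * (h (fst z) * cnj (h (snd z))) \<partial>lborel)"
      unfolding H_def norm_integral_square[OF E]
      by (intro Bochner_Integration.integral_cong[OF refl])
        (simp add: exp_cnj exp_diff exp_minus field_simps inner_diff_right)
    then show "complex_of_real (?I y) = (\<integral>z. ?\<Psi> (y, z) \<partial>lborel)"
      by (simp add: mult.assoc)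
  qed
  also have "\<dots> = (\<integral>z. \<integral>y. ?\<Psi> (y, z) \<partial>lborel \<partial>lborel)"
    using integral_lborel_pair(1,2)[OF \<Psi>] by simp
  also have "\<dots> = (\<integral>z. complex_of_real (exp (- (norm (c *\<^sub>R (fst z - snd z)))\<^sup>2 / 2)) * (h (fst z) * cnj (h (snd z))) \<partial>lborel)"
  proof (rule Bochner_Integration.integral_cong[OF refl])
    fix z :: "'a \<times> 'a"
    show "(\<integral>y. ?\<Psi> (y, z) \<partial>lborel) = complex_of_real (exp (- (norm (c *\<^sub>R (fst z - snd z)))\<^sup>2 / 2)) * (h (fst z) * cnj (h (snd z)))"
      unfolding fourier_std_gauss[symmetric] by simp
  qed
  finally have *: "complex_of_real (\<integral>y. ?I y \<partial>lborel) = \<dots>" .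
  have "(\<integral>\<^sup>+y. ennreal (?I y) \<partial>lborel) = ennreal (\<integral>y. ?I y \<partial>lborel)"
    by (rule nn_integral_eq_integral[OF I]) (simp add: std_gauss_nonneg)
  also have "(\<integral>y. ?I y \<partial>lborel) = cmod (complex_of_real (\<integral>y. ?I y \<partial>lborel))"
    unfolding norm_of_real by (rule abs_of_nonneg[symmetric]) (simp add: std_gauss_nonneg integral_nonneg_AE)
  also have "ennreal \<dots> \<le> (\<integral>\<^sup>+z. ennreal (cmod (complex_of_real (exp (- (norm (c *\<^sub>R (fst z - snd z)))\<^sup>2 / 2)) * (h (fst z) * cnj (h (snd z))))) \<partial>lborel)"
    unfolding * by (rule integral_norm_bound_ennreal)
      (rule Bochner_Integration.integrable_bound[OF T], measurable, auto simp: norm_mult mult_left_le_one_le)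
  also have "\<dots> = (\<integral>\<^sup>+z. \<integral>\<^sup>+z'. ennreal (cmod (h z) * cmod (h z') * exp (- (norm (c *\<^sub>R (z - z')))\<^sup>2 / 2)) \<partial>lborel \<partial>lborel)"
    by (subst nn_integral_lborel_pair)
       (simp_all add: norm_mult mult_ac borel_prod[symmetric] del: norm_scaleR)
  finally show ?thesis .
qed

text \<open>The Gaussian weight \<open>std_gauss (y / c)\<close> tends to a positive constant as \<open>c\<close> grows, and the
  corresponding Gaussian kernels \<open>c\<^sup>n exp (- c\<^sup>2 |z|\<^sup>2 / 2)\<close> have bounded mass, so Schur's test applies
  uniformly in \<open>c\<close>.\<close>

lemma bessel_inequality:
  obtains C :: real where "C > 0"
    and "\<And>h::'a::euclidean_space \<Rightarrow> complex. integrable lborel h \<Longrightarrow>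
      (\<integral>\<^sup>+x. ennreal ((cmod (\<integral>z. exp (\<i> * complex_of_real (x \<bullet> z)) * h z \<partial>lborel))\<^sup>2) \<partial>lborel)
        \<le> ennreal C * (\<integral>\<^sup>+z. ennreal ((cmod (h z))\<^sup>2) \<partial>lborel)"
proof -
  define n where "n = DIM('a)"
  define s where "s = sqrt (2 * pi) ^ n"
  have s: "s > 0" by (simp add: s_def)
  have main: "(\<integral>\<^sup>+x. ennreal ((cmod (H x))\<^sup>2) \<partial>lborel) \<le> ennreal (2 * s * s) * (\<integral>\<^sup>+z. ennreal ((cmod (h z))\<^sup>2) \<partial>lborel)"
    if h: "integrable lborel h" and H: "H = (\<lambda>x. \<integral>z. exp (\<i> * complex_of_real (x \<bullet> z)) * h z \<partial>lborel)"
    for h H :: "'a \<Rightarrow> complex"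
  proof -
    have m: "h \<in> borel_measurable borel"
      using borel_measurable_integrable[OF h] by simp
    note m[measurable]
    have [measurable]: "H \<in> borel_measurable borel"
      unfolding H by measurable
    let ?N = "\<integral>\<^sup>+z. ennreal ((cmod (h z))\<^sup>2) \<partial>lborel"
    let ?\<Gamma> = "\<lambda>c (z::'a). ennreal (exp (- (norm (c *\<^sub>R z))\<^sup>2 / 2))"
    have fixed: "(\<integral>\<^sup>+x. ennreal (std_gauss ((1 / c) *\<^sub>R x) * (cmod (H x))\<^sup>2) \<partial>lborel) \<le> ennreal (2 * s) * ?N"
      if c: "c > 0" for c :: real
    proof -
      \<comment> \<open>The normalised kernel has mass \<open>s\<close> around every centre and for
        every \<open>c\<close>; this uniformity is what survives the limit.\<close>
      have K: "ennreal (c ^ n) * (\<integral>\<^sup>+z. ?\<Gamma> c (z - w) \<partial>lborel) = ennreal s" for w :: 'a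
      proof -
        have "(\<integral>\<^sup>+z. ?\<Gamma> c (z - w) \<partial>lborel) = (\<integral>\<^sup>+z. ?\<Gamma> c z \<partial>lborel)"
          using nn_integral_lborel_shift'(2)[of "\<lambda>z::'a. ennreal (exp (- (norm (c *\<^sub>R z))\<^sup>2 / 2))" w]
          by (simp del: norm_scaleR)
        also have "ennreal (c ^ n) * \<dots> = (\<integral>\<^sup>+z. ennreal (exp (- (norm (z::'a))\<^sup>2 / 2)) \<partial>lborel)"
          using nn_integral_lborel_scaleR[of "\<lambda>z::'a. ennreal (exp (- (norm z)\<^sup>2 / 2))" c] c
          by (simp add: n_def)
        also have "\<dots> = ennreal s"
          unfolding exp_norm_eq_std_gauss
          by (simp add: ennreal_mult std_gauss_nonneg nn_integral_cmult nn_integral_std_gauss s_def n_def)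
        finally show ?thesis .
      qed
      have K': "ennreal (c ^ n) * (\<integral>\<^sup>+z. ?\<Gamma> c (w - z) \<partial>lborel) = ennreal s" for w :: 'a
        using K[of w] by (simp add: norm_minus_commute)
      have "(\<integral>\<^sup>+x. ennreal (std_gauss ((1 / c) *\<^sub>R x) * (cmod (H x))\<^sup>2) \<partial>lborel)
        = ennreal (c ^ n) * (\<integral>\<^sup>+y. ennreal (std_gauss y * (cmod (H (c *\<^sub>R y)))\<^sup>2) \<partial>lborel)"
        using nn_integral_lborel_scaleR[of "\<lambda>x. ennreal (std_gauss ((1 / c) *\<^sub>R x) * (cmod (H x))\<^sup>2)" c] c
        by (simp add: n_def)
      also have "\<dots> \<le> ennreal (c ^ n) * (\<integral>\<^sup>+z. \<integral>\<^sup>+z'. ennreal (cmod (h z) * cmod (h z') * exp (- (norm (c *\<^sub>R (z - z')))\<^sup>2 / 2)) \<partial>lborel \<partial>lborel)"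
        unfolding H by (intro mult_left_mono bessel_gauss h) simp
      also have "\<dots> \<le> ennreal (c ^ n) * (\<integral>\<^sup>+z. \<integral>\<^sup>+z'. (ennreal ((cmod (h z))\<^sup>2) * ?\<Gamma> c (z - z')
          + ennreal ((cmod (h z'))\<^sup>2) * ?\<Gamma> c (z - z')) \<partial>lborel \<partial>lborel)"
      proof (intro mult_left_mono nn_integral_mono)
        fix z z'
        \<comment> \<open>Symmetric form of Schur's test: once the product is replaced by the sum of
          squares, each square meets only the mass of the kernel.\<close>
        have "cmod (h z) * cmod (h z') \<le> (cmod (h z))\<^sup>2 + (cmod (h z'))\<^sup>2"
          using sum_squares_bound[of "cmod (h z)" "cmod (h z')"]
            mult_nonneg_nonneg[OF norm_ge_zero[of "h z"] norm_ge_zero[of "h z'"]]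
          unfolding power2_eq_square by linarith
        then have "cmod (h z) * cmod (h z') * exp (- (norm (c *\<^sub>R (z - z')))\<^sup>2 / 2)
          \<le> ((cmod (h z))\<^sup>2 + (cmod (h z'))\<^sup>2) * exp (- (norm (c *\<^sub>R (z - z')))\<^sup>2 / 2)"
          by (rule mult_right_mono) simp
        then show "ennreal (cmod (h z) * cmod (h z') * exp (- (norm (c *\<^sub>R (z - z')))\<^sup>2 / 2))
          \<le> ennreal ((cmod (h z))\<^sup>2) * ?\<Gamma> c (z - z') + ennreal ((cmod (h z'))\<^sup>2) * ?\<Gamma> c (z - z')"
          by (simp add: ennreal_mult[symmetric] ennreal_plus[symmetric] ring_distribs ennreal_leI del: ennreal_plus norm_scaleR)
      qed simp
      also have "\<dots> = ennreal (c ^ n) * (\<integral>\<^sup>+z. \<integral>\<^sup>+z'. ennreal ((cmod (h z))\<^sup>2) * ?\<Gamma> c (z - z') \<partial>lborel \<partial>lborel)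
          + ennreal (c ^ n) * (\<integral>\<^sup>+z'. \<integral>\<^sup>+z. ennreal ((cmod (h z'))\<^sup>2) * ?\<Gamma> c (z - z') \<partial>lborel \<partial>lborel)"
      proof -
        have "(\<integral>\<^sup>+z. \<integral>\<^sup>+z'. ennreal ((cmod (h z'))\<^sup>2) * ?\<Gamma> c (z - z') \<partial>lborel \<partial>lborel)
          = (\<integral>\<^sup>+z'. \<integral>\<^sup>+z. ennreal ((cmod (h z'))\<^sup>2) * ?\<Gamma> c (z - z') \<partial>lborel \<partial>lborel)"
          by (rule nn_integral_lborel_swap) measurable
        note sw = this[symmetric]
        show ?thesis
          unfolding sw distrib_left[symmetric] by (simp add: nn_integral_add del: norm_scaleR)
      qed
      also have "\<dots> = (\<integral>\<^sup>+z. ennreal ((cmod (h z))\<^sup>2) * ennreal s \<partial>lborel) + (\<integral>\<^sup>+z. ennreal ((cmod (h z))\<^sup>2) * ennreal s \<partial>lborel)"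
      proof -
        have A: "ennreal (c ^ n) * (\<integral>\<^sup>+z. \<integral>\<^sup>+w. ennreal ((cmod (h z))\<^sup>2) * G z w \<partial>lborel \<partial>lborel)
            = (\<integral>\<^sup>+z. ennreal ((cmod (h z))\<^sup>2) * ennreal s \<partial>lborel)"
          if [measurable]: "case_prod G \<in> borel_measurable (borel \<Otimes>\<^sub>M borel)"
            and G: "\<And>z. ennreal (c ^ n) * (\<integral>\<^sup>+w. G z w \<partial>lborel) = ennreal s" for G :: "'a \<Rightarrow> 'a \<Rightarrow> ennreal"
        proof -
          have "ennreal (c ^ n) * (\<integral>\<^sup>+z. \<integral>\<^sup>+w. ennreal ((cmod (h z))\<^sup>2) * G z w \<partial>lborel \<partial>lborel)
            = (\<integral>\<^sup>+z. ennreal (c ^ n) * (ennreal ((cmod (h z))\<^sup>2) * (\<integral>\<^sup>+w. G z w \<partial>lborel)) \<partial>lborel)"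
            by (subst nn_integral_cmult[symmetric]) (simp_all add: nn_integral_cmult)
          also have "\<dots> = (\<integral>\<^sup>+z. ennreal ((cmod (h z))\<^sup>2) * ennreal s \<partial>lborel)"
            by (intro nn_integral_cong) (simp only: mult.left_commute[of "ennreal (c ^ n)"] G)
          finally show ?thesis .
        qed
        have "(\<lambda>(z, w). ?\<Gamma> c (z - w)) \<in> borel_measurable (borel \<Otimes>\<^sub>M borel)"
          "(\<lambda>(w, z). ?\<Gamma> c (z - w)) \<in> borel_measurable (borel \<Otimes>\<^sub>M borel)"
          by measurable
        then show ?thesis
          using A[of "\<lambda>z w. ?\<Gamma> c (z - w)", OF _ K'] A[of "\<lambda>w z. ?\<Gamma> c (z - w)", OF _ K]
          by (simp only:)
      qed
      also have "\<dots> = ennreal (2 * s) * ?N"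
      proof -
        have "(\<integral>\<^sup>+z. ennreal ((cmod (h z))\<^sup>2) * ennreal s \<partial>lborel) = ?N * ennreal s"
          by (rule nn_integral_multc) measurable
        moreover have "ennreal (2 * s) = ennreal s + ennreal s"
          using s by (simp add: ennreal_plus[symmetric] del: ennreal_plus)
        ultimately show ?thesis by (simp add: distrib_left distrib_right mult.commute)
      qed
      finally show ?thesis .
    qed
    have "(\<integral>\<^sup>+x. ennreal ((1 / s) * (cmod (H x))\<^sup>2) \<partial>lborel)
        = (\<integral>\<^sup>+x. liminf (\<lambda>k. ennreal (std_gauss ((1 / real (Suc k)) *\<^sub>R x) * (cmod (H x))\<^sup>2)) \<partial>lborel)"
    proof (rule nn_integral_cong)
      \<comment> \<open>The constant \<open>1 / s\<close> is \<open>std_gauss 0\<close>, the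
        pointwise limit of the weights; Fatou then carries the uniform bound over.\<close>
      fix x :: 'a
      have "(\<lambda>k. norm ((1 / real (Suc k)) *\<^sub>R x)) \<longlonglongrightarrow> norm (0 *\<^sub>R x)"
        by (intro tendsto_norm tendsto_scaleR tendsto_const LIMSEQ_Suc[OF lim_1_over_n, where 'a1=real])
      moreover have "(\<lambda>k. (1 / s) * exp (- (f k)\<^sup>2 / 2)) \<longlonglongrightarrow> (1 / s) * exp (- l\<^sup>2 / 2)"
        if "f \<longlonglongrightarrow> l" for f :: "nat \<Rightarrow> real" and l
        by (intro tendsto_intros that) simp
      ultimately have "(\<lambda>k. (1 / s) * exp (- (norm ((1 / real (Suc k)) *\<^sub>R x))\<^sup>2 / 2)) \<longlonglongrightarrow> (1 / s) * exp (- (norm (0 *\<^sub>R x))\<^sup>2 / 2)"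
        by blast
      moreover have sg: "(1 / s) * exp (- (norm y)\<^sup>2 / 2) = std_gauss y" for y :: 'a
        using s unfolding exp_norm_eq_std_gauss by (simp add: s_def n_def)
      ultimately have "(\<lambda>k. std_gauss ((1 / real (Suc k)) *\<^sub>R x)) \<longlonglongrightarrow> std_gauss (0 *\<^sub>R x)"
        by (simp only: sg)
      then have "(\<lambda>k. std_gauss ((1 / real (Suc k)) *\<^sub>R x)) \<longlonglongrightarrow> 1 / s"
        using sg[of 0] by simp
      then have "(\<lambda>k. ennreal (std_gauss ((1 / real (Suc k)) *\<^sub>R x) * (cmod (H x))\<^sup>2)) \<longlonglongrightarrow> ennreal ((1 / s) * (cmod (H x))\<^sup>2)"
        by (intro tendsto_intros tendsto_ennrealI)
      then show "ennreal ((1 / s) * (cmod (H x))\<^sup>2) = liminf (\<lambda>k. ennreal (std_gauss ((1 / real (Suc k)) *\<^sub>R x) * (cmod (H x))\<^sup>2))"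
        by (simp add: lim_imp_Liminf)
    qed
    also have "\<dots> \<le> liminf (\<lambda>k. \<integral>\<^sup>+x. ennreal (std_gauss ((1 / real (Suc k)) *\<^sub>R x) * (cmod (H x))\<^sup>2) \<partial>lborel)"
      by (rule nn_integral_liminf) measurable
    also have "\<dots> \<le> limsup (\<lambda>k. \<integral>\<^sup>+x. ennreal (std_gauss ((1 / real (Suc k)) *\<^sub>R x) * (cmod (H x))\<^sup>2) \<partial>lborel)"
      by (rule Liminf_le_Limsup) simp
    also have "\<dots> \<le> ennreal (2 * s) * ?N"
      by (intro Limsup_bounded always_eventually allI fixed) simp
    finally have "ennreal s * (\<integral>\<^sup>+x. ennreal ((1 / s) * (cmod (H x))\<^sup>2) \<partial>lborel) \<le> ennreal s * (ennreal (2 * s) * ?N)"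
      by (rule mult_left_mono) simp
    moreover have "ennreal s * (\<integral>\<^sup>+x. ennreal ((1 / s) * (cmod (H x))\<^sup>2) \<partial>lborel) = (\<integral>\<^sup>+x. ennreal ((cmod (H x))\<^sup>2) \<partial>lborel)"
      using s by (simp add: nn_integral_cmult[symmetric] ennreal_mult[symmetric])
    moreover have "ennreal s * (ennreal (2 * s) * ?N) = ennreal (2 * s * s) * ?N"
      using s by (simp add: ennreal_mult mult_ac)
    ultimately show ?thesis by simp
  qed
  show ?thesis
    using s by (intro that[of "2 * s * s"]) (auto intro!: main)
qed

section \<open>Norms of extended nonnegative functions\<close>

text \<open>The value at \<open>\<top>\<close> is \<open>\<top>\<close> for every exponent. The
  value at \<open>0\<close> is \<open>0\<close> for every exponent, inherited from
  \<open>powr\<close>, so powers of functions that vanish off \<open>K\<close> vanish there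
  too.\<close>

definition epow :: "ennreal \<Rightarrow> real \<Rightarrow> ennreal" where
  "epow x a = (if x = \<top> then \<top> else ennreal (enn2real x powr a))"

lemma epow_ennreal: "x \<ge> 0 \<Longrightarrow> epow (ennreal x) a = ennreal (x powr a)"
  by (simp add: epow_def)

lemma epow_top [simp]: "epow \<top> a = \<top>"
  by (simp add: epow_def)

lemma epow_0 [simp]: "epow 0 a = 0"
  by (simp add: epow_def)

lemma epow_measurable [measurable (raw)]:
  assumes [measurable]: "f \<in> borel_measurable M"
  shows "(\<lambda>x. epow (f x) a) \<in> borel_measurable M"
proof -
  have "(\<lambda>x. enn2real (f x) powr a) \<in> borel_measurable M"
    by (intro powr_real_measurable) measurable
  then show ?thesis
    unfolding epow_def by measurable
qed

lemma epow_mult: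
  assumes "a > 0"
  shows "epow (x * y) a = epow x a * epow y a"
proof (cases "x = 0 \<or> y = 0")
  case False
  then have pos: "epow x a \<noteq> 0" "epow y a \<noteq> 0"
    by (auto simp: epow_def enn2real_eq_0_iff)
  show ?thesis
  proof (cases "x = \<top> \<or> y = \<top>")
    case True
    with False pos show ?thesis
      by (auto simp: ennreal_mult_top ennreal_top_mult)
  next
    case False
    then obtain b c where "x = ennreal b" "y = ennreal c" "b \<ge> 0" "c \<ge> 0"
      by (cases x; cases y) auto
    then show ?thesis
      by (simp add: epow_ennreal powr_mult flip: ennreal_mult)
  qed
qed auto

lemma epow_epow: "a > 0 \<Longrightarrow> epow (epow x a) b = epow x (a * b)"
  by (cases x) (auto simp: epow_ennreal powr_powr)

lemma epow_1 [simp]: "epow x 1 = x"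
  by (cases x) (auto simp: epow_ennreal)

lemma epow_pos: "x > 0 \<Longrightarrow> epow x a > 0"
  by (cases x) (auto simp: epow_ennreal ennreal_less_zero_iff)

lemma epow_mono: "x \<le> y \<Longrightarrow> 0 \<le> a \<Longrightarrow> epow x a \<le> epow y a"
  by (cases x; cases y) (auto simp: epow_ennreal top_unique intro!: ennreal_leI powr_mono2)

definition enorm :: "real \<Rightarrow> ('a::euclidean_space \<Rightarrow> ennreal) \<Rightarrow> ennreal" where
  "enorm p f = epow (\<integral>\<^sup>+x. epow (f x) p \<partial>lborel) (1 / p)"

text \<open>The left side is the geometric mean A^\<alpha> B^(1 - \<alpha>) of A = x^p y^p and B =
  (x y)^(p/2) t^(-1/(1 - \<alpha>)); matching the powers of \<open>x\<close> forces \<alpha> = 4/p -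
  1. For x = g a, y = h (a + u) and t = |u|^n, integration yields Young's inequality: A comes
  without a kernel, and B carries one that decays faster than |u|^(-n). The free parameter
  \<open>\<kappa>\<close> serves to balance the two terms.\<close>

lemma real_split_inequality:
  fixes x y t p \<kappa> :: real
  assumes "2 < p" "p < 4" "x \<ge> 0" "y \<ge> 0" "t > 0" "\<kappa> > 0"
  defines "\<alpha> \<equiv> 4 / p - 1"
  shows "x\<^sup>2 * y\<^sup>2 / t \<le> \<kappa> powr (\<alpha> - 1) * (x powr p * y powr p)
    + \<kappa> powr \<alpha> * (x powr p + y powr p) * t powr (- (1 / (1 - \<alpha>)))"
proof (cases "x = 0 \<or> y = 0")
  case True
  then show ?thesis using assms by auto
next
  case False
  with assms have xy: "x > 0" "y > 0" by auto
  have \<alpha>: "0 < \<alpha>" "\<alpha> < 1" using assms by (auto simp: field_simps)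
  define A where "A = x powr p * y powr p"
  define B where "B = x powr (p / 2) * y powr (p / 2) * t powr (- (1 / (1 - \<alpha>)))"
  have AB: "A > 0" "B > 0" using xy assms by (auto simp: A_def B_def)
  have e: "p * \<alpha> + p / 2 * (1 - \<alpha>) = 2"
    using assms by (simp add: \<alpha>_def field_simps)
  have "x\<^sup>2 * y\<^sup>2 / t = x powr 2 * y powr 2 * t powr (- 1)"
    using xy assms by (simp add: powr_minus field_simps)
  also have "\<dots> = A powr \<alpha> * B powr (1 - \<alpha>)"
  proof -
    have e2: "z powr 2 = z powr (p * \<alpha>) * z powr (p / 2 * (1 - \<alpha>))" for z :: real
      by (simp only: powr_add[symmetric] e)
    have "t powr (- 1) = (t powr (- (1 / (1 - \<alpha>)))) powr (1 - \<alpha>)"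
      using \<alpha> by (simp add: powr_powr)
    then show ?thesis
      using xy assms(5) unfolding A_def B_def e2
      by (simp only: powr_mult powr_powr mult_ac)
  qed
  also have "\<dots> \<le> \<kappa> powr (\<alpha> - 1) * A + \<kappa> powr \<alpha> * B"
  \<comment> \<open>One of A and \<kappa> B dominates the other; replacing the smaller by the larger
    inside the mean produces one of the two terms.\<close>
  proof (cases "B \<le> A / \<kappa>")
    case True
    have "A powr \<alpha> * B powr (1 - \<alpha>) \<le> A powr \<alpha> * (A / \<kappa>) powr (1 - \<alpha>)"
      using True AB \<alpha> by (intro mult_left_mono powr_mono2) auto
    also have "\<dots> = \<kappa> powr (\<alpha> - 1) * A"
    proof -
      have "(A / \<kappa>) powr (1 - \<alpha>) = A powr (1 - \<alpha>) * \<kappa> powr (\<alpha> - 1)"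
        using AB assms(6) powr_minus_divide[of \<kappa> "1 - \<alpha>"] by (simp add: powr_divide)
      moreover have "A powr \<alpha> * A powr (1 - \<alpha>) = A"
        using AB by (simp add: powr_add[symmetric])
      ultimately show ?thesis by (simp only: mult.assoc[symmetric] mult.commute[of A])
    qed
    also have "\<dots> \<le> \<kappa> powr (\<alpha> - 1) * A + \<kappa> powr \<alpha> * B"
      using AB by simp
    finally show ?thesis .
  next
    case False
    then have "A \<le> \<kappa> * B" using assms by (simp add: field_simps)
    then have "A powr \<alpha> * B powr (1 - \<alpha>) \<le> (\<kappa> * B) powr \<alpha> * B powr (1 - \<alpha>)"
      using AB \<alpha> by (intro mult_right_mono powr_mono2) auto
    also have "\<dots> = \<kappa> powr \<alpha> * B"
      using AB assms by (simp add: powr_mult mult.assoc powr_add[symmetric])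
    also have "\<dots> \<le> \<kappa> powr (\<alpha> - 1) * A + \<kappa> powr \<alpha> * B"
      using AB by simp
    finally show ?thesis .
  qed
  also have "\<dots> \<le> \<kappa> powr (\<alpha> - 1) * A + \<kappa> powr \<alpha> * ((x powr p + y powr p) * t powr (- (1 / (1 - \<alpha>))))"
  proof -
    have "x powr (p / 2) * y powr (p / 2) \<le> x powr p + y powr p"
    proof -
      define a b where "a = x powr (p / 2)" and "b = y powr (p / 2)"
      have "0 \<le> a" "0 \<le> b" "x powr p = a * a" "y powr p = b * b"
        by (simp_all add: a_def b_def powr_add[symmetric])
      moreover from this have "0 \<le> a * b" by simp
      moreover have "2 * (a * b) \<le> a * a + b * b"
        using sum_squares_bound[of a b] by (simp add: power2_eq_square)
      ultimately show ?thesis unfolding a_def[symmetric] b_def[symmetric] by linarith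
    qed
    then show ?thesis
      unfolding B_def by (intro add_left_mono mult_left_mono mult_right_mono) auto
  qed
  finally show ?thesis by (simp add: A_def mult.assoc)
qed

lemma split_inequality:
  fixes x y :: ennreal and t p \<kappa> :: real
  assumes "2 < p" "p < 4" "t > 0" "\<kappa> > 0"
  defines "\<alpha> \<equiv> 4 / p - 1"
  shows "x\<^sup>2 * y\<^sup>2 * ennreal (1 / t) \<le> ennreal (\<kappa> powr (\<alpha> - 1)) * (epow x p * epow y p)
    + ennreal (\<kappa> powr \<alpha>) * (epow x p + epow y p) * ennreal (t powr (- (1 / (1 - \<alpha>))))"
proof (cases "x = \<top> \<or> y = \<top>")
  case True
  have pos: "t powr (- (1 / (1 - \<alpha>))) > 0" "\<kappa> powr \<alpha> > 0" using assms by auto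
  from True have "epow x p + epow y p = \<top>" by auto
  then have "ennreal (\<kappa> powr \<alpha>) * (epow x p + epow y p) * ennreal (t powr (- (1 / (1 - \<alpha>)))) = \<top>"
    using pos by (simp only: ennreal_mult_top ennreal_top_mult) simp
  then show ?thesis by simp
next
  case False
  then obtain a b where ab: "x = ennreal a" "y = ennreal b" "a \<ge> 0" "b \<ge> 0"
    by (cases x; cases y) auto
  have "ennreal (a\<^sup>2 * b\<^sup>2 / t) \<le> ennreal (\<kappa> powr (\<alpha> - 1) * (a powr p * b powr p)
    + \<kappa> powr \<alpha> * (a powr p + b powr p) * t powr (- (1 / (1 - \<alpha>))))"
    unfolding \<alpha>_def using assms ab by (intro ennreal_leI real_split_inequality) auto
  moreover have "x\<^sup>2 * y\<^sup>2 * ennreal (1 / t) = ennreal (a\<^sup>2 * b\<^sup>2 / t)"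
    using assms ab by (simp add: ennreal_power ennreal_mult[symmetric])
  ultimately show ?thesis
    using assms ab by (simp add: epow_ennreal ennreal_mult[symmetric] ennreal_plus[symmetric] del: ennreal_plus)
qed

text \<open>On the annulus 2^j <= |u| < 2^(j+1) the integrand is at most 2^(-j s), and the annulus
  lies in a ball of volume V 2^((j+1) n). The resulting geometric series has ratio 2^(n - s) <
  1.\<close>

lemma tail_integral_1_finite:
  fixes s :: real
  assumes s: "s > DIM('a)"
  shows "(\<integral>\<^sup>+u. ennreal (norm (u::'a::euclidean_space) powr (- s)) * indicator {u. norm u \<ge> 1} u \<partial>lborel) < \<infinity>"
proof -
  define n where "n = DIM('a)"
  define V where "V = unit_ball_vol (real n)"
  have V: "V \<ge> 0" by (simp add: V_def)
  let ?g = "\<lambda>j u. ennreal ((2 ^ j) powr (- s)) * indicator (cball (0::'a) (2 ^ Suc j)) u"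
  have "(\<integral>\<^sup>+u. ennreal (norm (u::'a) powr (- s)) * indicator {u. norm u \<ge> 1} u \<partial>lborel)
     \<le> (\<integral>\<^sup>+u. (\<Sum>j. ?g j u) \<partial>lborel)"
  proof (rule nn_integral_mono)
    fix u :: 'a
    show "ennreal (norm u powr (- s)) * indicator {u. norm u \<ge> 1} u \<le> (\<Sum>j. ?g j u)"
    proof (cases "norm u \<ge> 1")
      case True
      obtain j :: nat where j: "2 ^ j \<le> norm u" "norm u < 2 ^ Suc j"
      proof -
        have "\<exists>k. norm u < 2 ^ k" using real_arch_pow[of 2] by auto
        then obtain k where k: "norm u < 2 ^ k" "\<And>i. i < k \<Longrightarrow> \<not> norm u < 2 ^ i"
          using exists_least_iff[of "\<lambda>k. norm u < 2 ^ k"] by blast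
        have "k \<noteq> 0" using True k(1) by (metis power_0 not_le)
        then obtain i where "k = Suc i" using not0_implies_Suc by blast
        then show ?thesis using k(1) k(2)[of i] by (intro that[of i]) auto
      qed
      have "norm u powr (- s) \<le> (2 ^ j) powr (- s)"
        using j s by (intro powr_mono2') auto
      then have "ennreal (norm u powr (- s)) * indicator {u. norm u \<ge> 1} u \<le> ?g j u"
        using j True by (auto simp: indicator_def ennreal_leI)
      also have "\<dots> \<le> (\<Sum>j. ?g j u)"
      proof -
        have "f j \<le> suminf f" for f :: "nat \<Rightarrow> ennreal"
          using sum_le_suminf[of f "{j}"] by simp
        from this[of "\<lambda>j. ?g j u"] show ?thesis by (simp only:)
      qed
      finally show ?thesis .
    qed simp
  qed
  also have "\<dots> = (\<Sum>j. \<integral>\<^sup>+u. ?g j u \<partial>lborel)"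
  proof (rule nn_integral_suminf)
    show "?g j \<in> borel_measurable lborel" for j
      by (intro borel_measurable_times_ennreal borel_measurable_const borel_measurable_indicator) simp
  qed
  also have "\<dots> = (\<Sum>j. ennreal ((V * 2 ^ n) * (2 powr (real n - s)) ^ j))"
  proof (rule suminf_cong)
    fix j
    have "(\<integral>\<^sup>+u. ?g j u \<partial>lborel) = ennreal ((2 ^ j) powr (- s)) * ennreal (V * (2 ^ Suc j) ^ n)"
      by (subst nn_integral_cmult_indicator) (simp_all add: emeasure_cball V_def n_def)
    also have "\<dots> = ennreal ((2 ^ j) powr (- s) * (V * (2 ^ Suc j) ^ n))"
      using V by (simp add: ennreal_mult)
    also have "(2 ^ j) powr (- s) * (V * (2 ^ Suc j) ^ n) = (V * 2 ^ n) * (2 powr (real n - s)) ^ j"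
    proof -
      have "(2 ^ j) powr (- s) = (2::real) powr (- s * j)"
        by (simp add: powr_realpow[symmetric] powr_powr mult.commute)
      moreover have "((2::real) ^ j) ^ n = 2 powr (real n * j)"
        by (simp add: powr_realpow[symmetric] powr_powr mult.commute)
      moreover have "(2 powr (real n - s)) ^ j = 2 powr (- s * j) * 2 powr (real n * j)"
        by (simp add: powr_realpow[symmetric] powr_powr powr_add[symmetric] algebra_simps)
      ultimately show ?thesis by (simp add: power_mult_distrib mult_ac)
    qed
    finally show "(\<integral>\<^sup>+u. ?g j u \<partial>lborel) = ennreal ((V * 2 ^ n) * (2 powr (real n - s)) ^ j)" .
  qed
  also have "\<dots> < \<infinity>"
  proof -
    have "(2::real) powr (real n - s) < 2 powr 0"
      using s by (intro powr_less_mono) (auto simp: n_def)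
    then have "summable (\<lambda>j. (V * 2 ^ n) * (2 powr (real n - s)) ^ j)"
      by (intro summable_mult summable_geometric) simp
    then show ?thesis
      using V by (subst suminf_ennreal2) auto
  qed
  finally show ?thesis .
qed

lemma tail_integral:
  fixes s :: real
  assumes s: "s > DIM('a)"
  obtains Y :: real where "Y > 0"
    and "\<And>\<rho>. \<rho> > 0 \<Longrightarrow> (\<integral>\<^sup>+u. ennreal (norm (u::'a::euclidean_space) powr (- s)) * indicator {u. norm u \<ge> \<rho>} u \<partial>lborel)
      \<le> ennreal (Y * \<rho> powr (DIM('a) - s))"
proof -
  let ?f = "\<lambda>\<rho> u. ennreal (norm (u::'a) powr (- s)) * indicator {u. norm u \<ge> \<rho>} u"
  obtain Y0 where Y0: "Y0 \<ge> 0" "(\<integral>\<^sup>+u. ?f 1 u \<partial>lborel) = ennreal Y0"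
    using tail_integral_1_finite[OF s] by (cases "\<integral>\<^sup>+u. ?f 1 u \<partial>lborel") auto
  show ?thesis
  \<comment> \<open>Dilation by \<open>\<rho>\<close> reduces to radius 1; the added 1 keeps the
    constant positive.\<close>
  proof (rule that[of "Y0 + 1"])
    show "Y0 + 1 > 0" using Y0 by simp
    fix \<rho> :: real assume \<rho>: "\<rho> > 0"
    have "(\<integral>\<^sup>+u. ?f \<rho> u \<partial>lborel) = ennreal (\<rho> ^ DIM('a)) * (\<integral>\<^sup>+u. ?f \<rho> (\<rho> *\<^sub>R u) \<partial>lborel)"
      using nn_integral_lborel_scaleR[of "?f \<rho>" \<rho>] \<rho> by simp
    also have "(\<integral>\<^sup>+u. ?f \<rho> (\<rho> *\<^sub>R u) \<partial>lborel) = (\<integral>\<^sup>+u. ennreal (\<rho> powr (- s)) * ?f 1 u \<partial>lborel)"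
      using \<rho> by (intro nn_integral_cong) (auto simp: powr_mult ennreal_mult indicator_def)
    also have "\<dots> = ennreal (\<rho> powr (- s)) * ennreal Y0"
      unfolding Y0(2)[symmetric] by (rule nn_integral_cmult) measurable
    also have "ennreal (\<rho> ^ DIM('a)) * \<dots> = ennreal (Y0 * \<rho> powr (DIM('a) - s))"
    proof -
      have "\<rho> powr (DIM('a) - s) = \<rho> ^ DIM('a) * \<rho> powr (- s)"
        using powr_add[of \<rho> "DIM('a)" "- s"] \<rho> by (simp add: powr_realpow)
      then show ?thesis
        using \<rho> Y0(1) by (simp only: ennreal_mult[symmetric] powr_ge_zero mult_nonneg_nonneg zero_le_power less_imp_le mult_ac)
    qed
    also have "\<dots> \<le> ennreal ((Y0 + 1) * \<rho> powr (DIM('a) - s))"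
      by (intro ennreal_leI mult_right_mono) auto
    finally show "(\<integral>\<^sup>+u. ?f \<rho> u \<partial>lborel) \<le> ennreal ((Y0 + 1) * \<rho> powr (DIM('a) - s))" .
  qed
qed

section \<open>Haar measure of the multiplicative group\<close>

text \<open>Multiplicativity of the norm makes the preimage of the unit ball the ball of radius 1 /
  |c|, which fixes the Jacobian. The class constraint treats the real and the complex numbers
  together.\<close>

lemma nn_integral_lborel_mult:
  fixes c :: "'k::{real_normed_field, euclidean_space}" and f :: "'k \<Rightarrow> ennreal"
  assumes c: "c \<noteq> 0" and [measurable]: "f \<in> borel_measurable borel"
  shows "ennreal (norm c ^ DIM('k)) * (\<integral>\<^sup>+u. f (c * u) \<partial>lborel) = (\<integral>\<^sup>+u. f u \<partial>lborel)"
proof -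
  have lin: "linear ((*) c)"
    by (rule linearI) (simp_all add: distrib_left)
  have bij: "bij ((*) c)"
    using c by (intro bij_betw_byWitness[where f'="\<lambda>u. u / c"]) auto
  obtain k where k: "k > 0"
    "\<And>f::'k \<Rightarrow> ennreal. f \<in> borel_measurable borel \<Longrightarrow>
      (\<integral>\<^sup>+x. f (c * x) \<partial>lborel) = ennreal k * (\<integral>\<^sup>+y. f y \<partial>lborel)"
    "emeasure lborel ((*) c -` ball 0 1) = ennreal k * emeasure lborel (ball (0::'k) 1)"
    using linear_iso_nn_integral[OF lin bij] by metis
  have V: "unit_ball_vol (real DIM('k)) > 0" by simp
  have "(*) c -` ball 0 1 = ball (0::'k) (1 / norm c)"
    using c by (auto simp: norm_mult field_simps)
  then have "ennreal (unit_ball_vol (real DIM('k)) * (1 / norm c) ^ DIM('k)) = ennreal (k * unit_ball_vol (real DIM('k)))"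
    using k(1,3) by (simp add: emeasure_ball ennreal_mult[symmetric])
  then have "unit_ball_vol (real DIM('k)) * (1 / norm c) ^ DIM('k) = k * unit_ball_vol (real DIM('k))"
    using k(1) by (subst (asm) ennreal_inj) auto
  then have "k = (1 / norm c) ^ DIM('k)" using V by simp
  then have "norm c ^ DIM('k) * k = 1"
    using c by (simp add: power_mult_distrib[symmetric])
  then have "ennreal (norm c ^ DIM('k)) * ennreal k = 1"
    using k(1) by (simp add: ennreal_mult[symmetric])
  then show ?thesis
    by (simp add: k(2) mult.assoc[symmetric])
qed

lemma AE_lborel_nonzero: "AE u::'a::euclidean_space in lborel. u \<noteq> 0"
  by (rule AE_I[of _ _ "{0}"]) auto

text \<open>The weight is the density of Haar measure on the nonzero elements of \<open>'k\<close>.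
  At \<open>u = 0\<close> the division yields weight \<open>0\<close>; that point is null, so
  identities need to hold only for nonzero \<open>u\<close>.\<close>

definition haar :: "('k::{real_normed_field, euclidean_space} \<Rightarrow> ennreal) \<Rightarrow> ennreal" where
  "haar f = (\<integral>\<^sup>+u. f u * ennreal (1 / norm u ^ DIM('k)) \<partial>lborel)"

lemma haar_mult:
  fixes c :: "'k::{real_normed_field, euclidean_space}" and f :: "'k \<Rightarrow> ennreal"
  assumes c: "c \<noteq> 0" and [measurable]: "f \<in> borel_measurable borel"
  shows "haar (\<lambda>u. f (c * u)) = haar f"
proof -
  have "haar f = ennreal (norm c ^ DIM('k)) * (\<integral>\<^sup>+u. f (c * u) * ennreal (1 / norm (c * u) ^ DIM('k)) \<partial>lborel)"
    unfolding haar_def using c by (intro nn_integral_lborel_mult[symmetric]) measurable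
  also have "\<dots> = (\<integral>\<^sup>+u. ennreal (norm c ^ DIM('k)) * (f (c * u) * ennreal (1 / norm (c * u) ^ DIM('k))) \<partial>lborel)"
    by (rule nn_integral_cmult[symmetric]) measurable
  also have "\<dots> = haar (\<lambda>u. f (c * u))"
    unfolding haar_def
  proof (rule nn_integral_cong)
    fix u :: 'k
    have "norm c ^ DIM('k) * (1 / norm (c * u) ^ DIM('k)) = 1 / norm u ^ DIM('k)"
      using c by (simp add: norm_mult power_mult_distrib)
    then have "ennreal (norm c ^ DIM('k)) * ennreal (1 / norm (c * u) ^ DIM('k)) = ennreal (1 / norm u ^ DIM('k))"
      by (simp add: ennreal_mult[symmetric])
    then show "ennreal (norm c ^ DIM('k)) * (f (c * u) * ennreal (1 / norm (c * u) ^ DIM('k)))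
      = f (c * u) * ennreal (1 / norm u ^ DIM('k))"
      by (metis mult.left_commute)
  qed
  finally show ?thesis ..
qed

lemma haar_cong: "(\<And>u. u \<noteq> 0 \<Longrightarrow> f u = g u) \<Longrightarrow> haar f = haar g"
  unfolding haar_def using AE_lborel_nonzero
  by (intro nn_integral_cong_AE) auto

lemma haar_cmult:
  assumes [measurable]: "g \<in> borel_measurable borel"
  shows "haar (\<lambda>u. c * g u) = c * haar g"
  unfolding haar_def by (simp add: nn_integral_cmult mult.assoc)

lemma haar_multc: "g \<in> borel_measurable borel \<Longrightarrow> haar (\<lambda>u. g u * c) = haar g * c"
  using haar_cmult[of g c] by (simp only: mult.commute)

lemma haar_swap:
  fixes F :: "'k::{real_normed_field, euclidean_space} \<Rightarrow> 'k \<Rightarrow> ennreal"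
  assumes F: "case_prod F \<in> borel_measurable borel"
  shows "haar (\<lambda>x. haar (F x)) = haar (\<lambda>y. haar (\<lambda>x. F x y))"
proof -
  have [measurable]: "case_prod F \<in> borel_measurable (borel \<Otimes>\<^sub>M borel)"
    using F by (simp add: borel_prod)
  have "haar (\<lambda>x. haar (F x)) = (\<integral>\<^sup>+x. \<integral>\<^sup>+y. F x y * ennreal (1 / norm y ^ DIM('k)) * ennreal (1 / norm x ^ DIM('k)) \<partial>lborel \<partial>lborel)"
    unfolding haar_def by (subst nn_integral_multc) simp_all
  also have "\<dots> = (\<integral>\<^sup>+y. \<integral>\<^sup>+x. F x y * ennreal (1 / norm y ^ DIM('k)) * ennreal (1 / norm x ^ DIM('k)) \<partial>lborel \<partial>lborel)"
    by (rule nn_integral_lborel_swap) (simp add: borel_prod[symmetric])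
  also have "\<dots> = (\<integral>\<^sup>+y. \<integral>\<^sup>+x. F x y * ennreal (1 / norm x ^ DIM('k)) * ennreal (1 / norm y ^ DIM('k)) \<partial>lborel \<partial>lborel)"
    by (simp only: mult_ac)
  also have "\<dots> = haar (\<lambda>y. haar (\<lambda>x. F x y))"
    unfolding haar_def by (subst nn_integral_multc) simp_all
  finally show ?thesis .
qed

text \<open>Uniqueness of Haar measure on the multiplicative group: for a function \<open>f\<close> with
  \<open>0 < haar f < \<infinity>\<close>, both sides times \<open>haar f\<close> equal the double integral of \<open>f (x y) h (1 / y)\<close>.\<close>

lemma haar_inverse:
  fixes h :: "'k::{real_normed_field, euclidean_space} \<Rightarrow> ennreal"
  assumes [measurable]: "h \<in> borel_measurable borel"
  shows "haar (\<lambda>u. h (1 / u)) = haar h"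
proof -
  let ?n = "DIM('k)"
  \<comment> \<open>The factor |u|^n cancels the Haar density, so \<open>haar f\<close> is the
    volume of the unit ball: positive and finite, hence cancellable.\<close>
  define f :: "'k \<Rightarrow> ennreal" where "f u = ennreal (norm u ^ ?n) * indicator (ball 0 1) u" for u
  have f [measurable]: "f \<in> borel_measurable borel"
    unfolding f_def by (intro borel_measurable_times_ennreal borel_measurable_indicator) simp_all
  have "haar f = (\<integral>\<^sup>+u. indicator (ball 0 1) u \<partial>(lborel::'k measure))"
    unfolding haar_def f_def
    by (rule nn_integral_cong_AE, use AE_lborel_nonzero in eventually_elim)
       (auto simp: indicator_def ennreal_mult[symmetric])
  also have "\<dots> = ennreal (unit_ball_vol (real ?n))"
    by (simp add: emeasure_ball)
  finally have hf: "haar f = ennreal (unit_ball_vol (real ?n))" .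
  have "haar (\<lambda>y. h (1 / y)) * haar f = haar (\<lambda>y. haar (\<lambda>x. f x * h (1 / y)))"
    by (simp add: haar_multc haar_cmult mult.commute)
  also have "\<dots> = haar (\<lambda>y. haar (\<lambda>x. f (y * x) * h (1 / y)))"
  proof (rule haar_cong)
    fix y :: 'k assume "y \<noteq> 0"
    then show "haar (\<lambda>x. f x * h (1 / y)) = haar (\<lambda>x. f (y * x) * h (1 / y))"
      by (intro haar_mult[symmetric, where f="\<lambda>x. f x * h (1 / y)"]) measurable
  qed
  also have "\<dots> = haar (\<lambda>x. haar (\<lambda>y. f (y * x) * h (1 / y)))"
    by (rule haar_swap) (simp add: borel_prod[symmetric])
  also have "\<dots> = haar (\<lambda>x. haar (\<lambda>y. f y * h (x / y)))"
  proof (rule haar_cong)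
    fix x :: 'k assume x: "x \<noteq> 0"
    have "haar (\<lambda>y. f (x * y) * h (x / (x * y))) = haar (\<lambda>y. f y * h (x / y))"
      using x by (intro haar_mult[where f="\<lambda>y. f y * h (x / y)"]) measurable
    then show "haar (\<lambda>y. f (y * x) * h (1 / y)) = haar (\<lambda>y. f y * h (x / y))"
      using x by (simp add: mult.commute)
  qed
  also have "\<dots> = haar (\<lambda>y. haar (\<lambda>x. f y * h (x / y)))"
    by (rule haar_swap) (simp add: borel_prod[symmetric])
  also have "\<dots> = haar (\<lambda>y. haar (\<lambda>x. f y * h x))"
  proof (rule haar_cong)
    fix y :: 'k assume y: "y \<noteq> 0"
    then have "haar (\<lambda>x. f y * h ((1 / y) * x)) = haar (\<lambda>x. f y * h x)"
      by (intro haar_mult[where f="\<lambda>x. f y * h x"]) auto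
    then show "haar (\<lambda>x. f y * h (x / y)) = haar (\<lambda>x. f y * h x)" by simp
  qed
  also have "\<dots> = haar h * haar f"
    by (simp add: haar_multc haar_cmult mult.commute)
  finally have "haar (\<lambda>y. h (1 / y)) = haar h \<or> unit_ball_vol (real ?n) \<le> 0"
    unfolding hf mult_right_ennreal_cancel .
  moreover have "unit_ball_vol (real ?n) > 0" by simp
  ultimately show ?thesis by linarith
qed

section \<open>Bounds away from the origin\<close>

lemma ennreal_mult_le_squares: "x * y \<le> x\<^sup>2 + (y::ennreal)\<^sup>2"
proof (cases "x \<le> y")
  case True
  then have "x * y \<le> y\<^sup>2" unfolding power2_eq_square by (rule mult_right_mono) simp
  also have "\<dots> \<le> x\<^sup>2 + y\<^sup>2" by simp
  finally show ?thesis .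
next
  case False
  then have "x * y \<le> x\<^sup>2" unfolding power2_eq_square by (intro mult_left_mono) auto
  also have "\<dots> \<le> x\<^sup>2 + y\<^sup>2" by simp
  finally show ?thesis .
qed

text \<open>Young's inequality with g^2 and h^2 in L^(p/2): the matching exponent of the kernel is
  \<open>r = 1 / (1 - \<alpha>)\<close>, larger than 1, so |u|^(-n r) is integrable over |u| >=
  \<rho>. Integrating \<open>split_inequality\<close> with t = |u|^n gives the product of the two
  integrals plus their sum times this tail.\<close>

lemma pair_bound:
  assumes p: "2 < p" "p < 4"
  obtains C :: real where "C > 0"
    and "\<And>\<rho> g h. \<rho> > 0 \<Longrightarrow> g \<in> borel_measurable borel \<Longrightarrow> h \<in> borel_measurable borel \<Longrightarrow>
      (\<integral>\<^sup>+x. epow (g x) p \<partial>lborel) \<le> 1 \<Longrightarrow> (\<integral>\<^sup>+x. epow (h x) p \<partial>lborel) \<le> 1 \<Longrightarrow>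
      (\<integral>\<^sup>+u. \<integral>\<^sup>+a. (g a)\<^sup>2 * (h (a + u))\<^sup>2 * (ennreal (1 / norm (u::'a::euclidean_space) ^ DIM('a)) * indicator {u. norm u \<ge> \<rho>} u) \<partial>lborel \<partial>lborel)
        \<le> ennreal (C * \<rho> powr (- (DIM('a) * (4 / p - 1))))"
proof -
  define n where "n = DIM('a)"
  have n: "n > 0" by (simp add: n_def)
  define \<alpha> where "\<alpha> = 4 / p - 1"
  have \<alpha>: "0 < \<alpha>" "\<alpha> < 1" using p by (auto simp: \<alpha>_def field_simps)
  define r where "r = 1 / (1 - \<alpha>)"
  have r: "r > 1" using \<alpha> by (simp add: r_def field_simps)
  have "real DIM('a) < n * r" using r n by (simp add: n_def)
  from tail_integral[OF this] obtain Y where Y: "Y > 0"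
    "\<And>\<rho>. \<rho> > 0 \<Longrightarrow> (\<integral>\<^sup>+u. ennreal (norm (u::'a) powr (- (n * r))) * indicator {u. norm u \<ge> \<rho>} u \<partial>lborel)
      \<le> ennreal (Y * \<rho> powr (DIM('a) - n * r))" by metis
  show ?thesis
  proof (rule that[of "1 + 2 * Y"])
    show "1 + 2 * Y > 0" using Y by simp
    fix \<rho> :: real and g h :: "'a \<Rightarrow> ennreal"
    assume \<rho>: "\<rho> > 0" and m[measurable]: "g \<in> borel_measurable borel" "h \<in> borel_measurable borel"
      and G1: "(\<integral>\<^sup>+x. epow (g x) p \<partial>lborel) \<le> 1" and H1: "(\<integral>\<^sup>+x. epow (h x) p \<partial>lborel) \<le> 1"
    \<comment> \<open>The balancing choice: both terms become \<rho>^(-n \<alpha>) up to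
      constants.\<close>
    define \<kappa> where "\<kappa> = \<rho> powr (n * (r - 1))"
    have \<kappa>: "\<kappa> > 0" using \<rho> by (simp add: \<kappa>_def)
    define c where "c = \<rho> powr (- (n * \<alpha>))"
    have ra: "r * (1 - \<alpha>) = 1" using \<alpha> by (simp add: r_def)
    have exps: "n * (r - 1) * (\<alpha> - 1) = - (n * \<alpha>)" "n * (r - 1) * \<alpha> + (n - n * r) = - (n * \<alpha>)"
    proof -
      have "n * (r - 1) * (\<alpha> - 1) = n * (- (r * (1 - \<alpha>)) - (\<alpha> - 1))" by (simp add: algebra_simps)
      then show 1: "n * (r - 1) * (\<alpha> - 1) = - (n * \<alpha>)" unfolding ra by (simp add: algebra_simps)
      have "n * (r - 1) * \<alpha> + (n - n * r) = n * (r - 1) * (\<alpha> - 1)" by (simp add: algebra_simps)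
      then show "n * (r - 1) * \<alpha> + (n - n * r) = - (n * \<alpha>)" using 1 by simp
    qed
    have c1: "\<kappa> powr (\<alpha> - 1) = c" by (simp add: \<kappa>_def c_def powr_powr exps)
    have c2: "\<kappa> powr \<alpha> * \<rho> powr (n - n * r) = c" by (simp add: \<kappa>_def c_def powr_powr powr_add[symmetric] exps)
    let ?G = "\<lambda>a. epow (g a) p" and ?H = "\<lambda>a. epow (h a) p"
    let ?K = "\<lambda>u. ennreal (norm (u::'a) powr (- (n * r))) * indicator {u. norm u \<ge> \<rho>} u"
    have "(\<integral>\<^sup>+u. \<integral>\<^sup>+a. (g a)\<^sup>2 * (h (a + u))\<^sup>2 * (ennreal (1 / norm (u::'a) ^ DIM('a)) * indicator {u. norm u \<ge> \<rho>} u) \<partial>lborel \<partial>lborel)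
      \<le> (\<integral>\<^sup>+u. \<integral>\<^sup>+a. (ennreal c * (?G a * ?H (a + u)) + ennreal (\<kappa> powr \<alpha>) * ((?G a + ?H (a + u)) * ?K u)) \<partial>lborel \<partial>lborel)"
    proof (intro nn_integral_mono)
      fix u a :: 'a
      show "(g a)\<^sup>2 * (h (a + u))\<^sup>2 * (ennreal (1 / norm (u::'a) ^ DIM('a)) * indicator {u. norm u \<ge> \<rho>} u)
        \<le> ennreal c * (?G a * ?H (a + u)) + ennreal (\<kappa> powr \<alpha>) * ((?G a + ?H (a + u)) * ?K u)"
      proof (cases "norm u \<ge> \<rho>")
        case True
        then have u: "norm u > 0" using \<rho> by linarith
        have "(norm u ^ n) powr (- r) = norm u powr (- (n * r))"
          using u by (simp add: powr_realpow[symmetric] powr_powr)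
        then show ?thesis
          using split_inequality[OF p, of "norm u ^ n" \<kappa> "g a" "h (a + u)"] u \<kappa> True
          by (simp add: \<alpha>_def[symmetric] c1 r_def[symmetric] n_def[symmetric] mult.assoc)
      qed simp
    qed
    also have "\<dots> = (\<integral>\<^sup>+u. (ennreal c * (\<integral>\<^sup>+a. ?G a * ?H (a + u) \<partial>lborel) + ennreal (\<kappa> powr \<alpha>) * (((\<integral>\<^sup>+a. ?G a \<partial>lborel) + (\<integral>\<^sup>+a. ?H a \<partial>lborel)) * ?K u)) \<partial>lborel)"
    proof (rule nn_integral_cong)
      fix u :: 'a
      have "(\<integral>\<^sup>+a. ?H (a + u) \<partial>lborel) = (\<integral>\<^sup>+a. ?H a \<partial>lborel)"
        by (rule nn_integral_lborel_shift') measurable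
      then show "(\<integral>\<^sup>+a. (ennreal c * (?G a * ?H (a + u)) + ennreal (\<kappa> powr \<alpha>) * ((?G a + ?H (a + u)) * ?K u)) \<partial>lborel)
        = ennreal c * (\<integral>\<^sup>+a. ?G a * ?H (a + u) \<partial>lborel) + ennreal (\<kappa> powr \<alpha>) * (((\<integral>\<^sup>+a. ?G a \<partial>lborel) + (\<integral>\<^sup>+a. ?H a \<partial>lborel)) * ?K u)"
        by (simp add: nn_integral_add nn_integral_cmult nn_integral_multc)
    qed
    also have "\<dots> = ennreal c * (\<integral>\<^sup>+u. \<integral>\<^sup>+a. ?G a * ?H (a + u) \<partial>lborel \<partial>lborel) + ennreal (\<kappa> powr \<alpha>) * (((\<integral>\<^sup>+a. ?G a \<partial>lborel) + (\<integral>\<^sup>+a. ?H a \<partial>lborel)) * (\<integral>\<^sup>+u. ?K u \<partial>lborel))"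
      by (subst nn_integral_add) (simp_all add: nn_integral_cmult)
    also have "(\<integral>\<^sup>+u. \<integral>\<^sup>+a. ?G a * ?H (a + u) \<partial>lborel \<partial>lborel) = (\<integral>\<^sup>+a. \<integral>\<^sup>+u. ?G a * ?H (a + u) \<partial>lborel \<partial>lborel)"
      by (rule nn_integral_lborel_swap) measurable
    also have "\<dots> = (\<integral>\<^sup>+a. ?G a * (\<integral>\<^sup>+u. ?H u \<partial>lborel) \<partial>lborel)"
    proof (rule nn_integral_cong)
      fix a :: 'a
      have "(\<integral>\<^sup>+u. ?H (a + u) \<partial>lborel) = (\<integral>\<^sup>+u. ?H u \<partial>lborel)"
        by (rule nn_integral_lborel_shift) measurable
      then show "(\<integral>\<^sup>+u. ?G a * ?H (a + u) \<partial>lborel) = ?G a * (\<integral>\<^sup>+u. ?H u \<partial>lborel)"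
        by (simp add: nn_integral_cmult)
    qed
    also have "\<dots> = (\<integral>\<^sup>+a. ?G a \<partial>lborel) * (\<integral>\<^sup>+u. ?H u \<partial>lborel)"
      by (rule nn_integral_multc) measurable
    also have "ennreal c * ((\<integral>\<^sup>+a. ?G a \<partial>lborel) * (\<integral>\<^sup>+u. ?H u \<partial>lborel))
        + ennreal (\<kappa> powr \<alpha>) * (((\<integral>\<^sup>+a. ?G a \<partial>lborel) + (\<integral>\<^sup>+a. ?H a \<partial>lborel)) * (\<integral>\<^sup>+u. ?K u \<partial>lborel))
      \<le> ennreal c * (1 * 1) + ennreal (\<kappa> powr \<alpha>) * ((1 + 1) * ennreal (Y * \<rho> powr (n - n * r)))"
      using Y(2)[OF \<rho>] G1 H1
      by (intro add_mono mult_mono) (auto simp: n_def)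
    also have "\<dots> = ennreal (c + \<kappa> powr \<alpha> * (2 * (Y * \<rho> powr (n - n * r))))"
    proof -
      have 2: "(1 + 1::ennreal) = ennreal 2" by simp
      show ?thesis
        unfolding 2 using Y by (simp add: c_def ennreal_mult ennreal_plus)
    qed
    also have "c + \<kappa> powr \<alpha> * (2 * (Y * \<rho> powr (n - n * r))) = c + 2 * Y * (\<kappa> powr \<alpha> * \<rho> powr (n - n * r))"
      by simp
    also have "\<dots> = (1 + 2 * Y) * \<rho> powr (- (DIM('a) * (4 / p - 1)))"
      unfolding c2 by (simp add: c_def \<alpha>_def n_def algebra_simps)
    finally show "(\<integral>\<^sup>+u. \<integral>\<^sup>+a. (g a)\<^sup>2 * (h (a + u))\<^sup>2 * (ennreal (1 / norm (u::'a) ^ DIM('a)) * indicator {u. norm u \<ge> \<rho>} u) \<partial>lborel \<partial>lborel)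
        \<le> ennreal ((1 + 2 * Y) * \<rho> powr (- (DIM('a) * (4 / p - 1))))" .
  qed
qed

text \<open>The inequality x y <= x^2 + y^2 separates the pair (g1, g2) from (g3, g4). In the second
  pair a translation of \<open>a\<close> by \<open>y u\<close>, at fixed \<open>u\<close>, removes
  the shift; this is why \<open>y\<close> can be any measurable function.\<close>

lemma half_bound:
  assumes p: "2 < p" "p < 4"
  shows "\<exists>C>0. \<forall>\<rho> y g1 g2 g3 g4. \<rho> > 0 \<longrightarrow> y \<in> borel_measurable borel \<longrightarrow>
      (\<forall>g\<in>{g1, g2, g3, g4}. g \<in> borel_measurable borel \<and> (\<integral>\<^sup>+x. epow (g x) p \<partial>lborel) \<le> 1) \<longrightarrow>
      (\<integral>\<^sup>+u. \<integral>\<^sup>+a. g1 a * g2 (a + u) * g3 (a + y u) * g4 (a + u + y u) *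
        (ennreal (1 / norm (u::'a::euclidean_space) ^ DIM('a)) * indicator {u. norm u \<ge> \<rho>} u) \<partial>lborel \<partial>lborel)
        \<le> ennreal (C * \<rho> powr (- (DIM('a) * (4 / p - 1))))"
proof -
  obtain C where C: "C > 0"
    "\<And>\<rho> g h. \<rho> > 0 \<Longrightarrow> g \<in> borel_measurable borel \<Longrightarrow> h \<in> borel_measurable borel \<Longrightarrow>
      (\<integral>\<^sup>+x. epow (g x) p \<partial>lborel) \<le> 1 \<Longrightarrow> (\<integral>\<^sup>+x. epow (h x) p \<partial>lborel) \<le> 1 \<Longrightarrow>
      (\<integral>\<^sup>+u. \<integral>\<^sup>+a. (g a)\<^sup>2 * (h (a + u))\<^sup>2 * (ennreal (1 / norm (u::'a) ^ DIM('a)) * indicator {u. norm u \<ge> \<rho>} u) \<partial>lborel \<partial>lborel)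
        \<le> ennreal (C * \<rho> powr (- (DIM('a) * (4 / p - 1))))"
    by (rule pair_bound[OF p that])
  show ?thesis
  proof (intro exI[of _ "2 * C"] conjI allI impI)
    show "2 * C > 0" using C by simp
    fix \<rho> :: real and y :: "'a \<Rightarrow> 'a" and g1 g2 g3 g4 :: "'a \<Rightarrow> ennreal"
    assume \<rho>: "\<rho> > 0" and [measurable]: "y \<in> borel_measurable borel"
      and g: "\<forall>g\<in>{g1, g2, g3, g4}. g \<in> borel_measurable borel \<and> (\<integral>\<^sup>+x. epow (g x) p \<partial>lborel) \<le> 1"
    have [measurable]: "g1 \<in> borel_measurable borel" "g2 \<in> borel_measurable borel"
      "g3 \<in> borel_measurable borel" "g4 \<in> borel_measurable borel" using g by auto
    let ?k = "\<lambda>u. ennreal (1 / norm (u::'a) ^ DIM('a)) * indicator {u. norm u \<ge> \<rho>} u"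
    have km: "?k \<in> borel_measurable borel" by measurable
    define k where "k = ?k"
    have [measurable]: "k \<in> borel_measurable borel" unfolding k_def by (rule km)
    let ?B = "ennreal (C * \<rho> powr (- (DIM('a) * (4 / p - 1))))"
    have B: "(\<integral>\<^sup>+u. \<integral>\<^sup>+a. (g1 a)\<^sup>2 * (g2 (a + u))\<^sup>2 * k u \<partial>lborel \<partial>lborel) \<le> ?B"
      "(\<integral>\<^sup>+u. \<integral>\<^sup>+a. (g3 a)\<^sup>2 * (g4 (a + u))\<^sup>2 * k u \<partial>lborel \<partial>lborel) \<le> ?B"
      unfolding k_def using g by (auto intro!: C(2) \<rho>)
    have "(\<integral>\<^sup>+u. \<integral>\<^sup>+a. g1 a * g2 (a + u) * g3 (a + y u) * g4 (a + u + y u) * k u \<partial>lborel \<partial>lborel)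
      \<le> (\<integral>\<^sup>+u. \<integral>\<^sup>+a. ((g1 a)\<^sup>2 * (g2 (a + u))\<^sup>2 * k u + (g3 (a + y u))\<^sup>2 * (g4 ((a + y u) + u))\<^sup>2 * k u) \<partial>lborel \<partial>lborel)"
    proof (intro nn_integral_mono)
      fix u a :: 'a
      have "(g1 a * g2 (a + u)) * (g3 (a + y u) * g4 (a + u + y u)) * k u
        \<le> ((g1 a * g2 (a + u))\<^sup>2 + (g3 (a + y u) * g4 (a + u + y u))\<^sup>2) * k u"
        by (intro mult_right_mono ennreal_mult_le_squares) simp
      then show "g1 a * g2 (a + u) * g3 (a + y u) * g4 (a + u + y u) * k u
        \<le> (g1 a)\<^sup>2 * (g2 (a + u))\<^sup>2 * k u + (g3 (a + y u))\<^sup>2 * (g4 ((a + y u) + u))\<^sup>2 * k u"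
        by (simp add: power_mult_distrib distrib_right mult.assoc add.assoc add.commute[of u])
    qed
    also have "\<dots> = (\<integral>\<^sup>+u. ((\<integral>\<^sup>+a. (g1 a)\<^sup>2 * (g2 (a + u))\<^sup>2 * k u \<partial>lborel)
       + (\<integral>\<^sup>+a. (g3 a)\<^sup>2 * (g4 (a + u))\<^sup>2 * k u \<partial>lborel)) \<partial>lborel)"
    proof (rule nn_integral_cong)
      fix u :: 'a
      have "(\<integral>\<^sup>+a. (g3 (a + y u))\<^sup>2 * (g4 ((a + y u) + u))\<^sup>2 * k u \<partial>lborel) = (\<integral>\<^sup>+a. (g3 a)\<^sup>2 * (g4 (a + u))\<^sup>2 * k u \<partial>lborel)"
        by (rule nn_integral_lborel_shift'(1)[where f="\<lambda>a. (g3 a)\<^sup>2 * (g4 (a + u))\<^sup>2 * k u"]) measurable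
      then show "(\<integral>\<^sup>+a. ((g1 a)\<^sup>2 * (g2 (a + u))\<^sup>2 * k u + (g3 (a + y u))\<^sup>2 * (g4 ((a + y u) + u))\<^sup>2 * k u) \<partial>lborel)
        = (\<integral>\<^sup>+a. (g1 a)\<^sup>2 * (g2 (a + u))\<^sup>2 * k u \<partial>lborel) + (\<integral>\<^sup>+a. (g3 a)\<^sup>2 * (g4 (a + u))\<^sup>2 * k u \<partial>lborel)"
        by (simp add: nn_integral_add)
    qed
    also have "\<dots> = (\<integral>\<^sup>+u. \<integral>\<^sup>+a. (g1 a)\<^sup>2 * (g2 (a + u))\<^sup>2 * k u \<partial>lborel \<partial>lborel)
      + (\<integral>\<^sup>+u. \<integral>\<^sup>+a. (g3 a)\<^sup>2 * (g4 (a + u))\<^sup>2 * k u \<partial>lborel \<partial>lborel)"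
      by (rule nn_integral_add) measurable
    also have "\<dots> \<le> ?B + ?B" by (intro add_mono B)
    also have "\<dots> = ennreal (2 * C * \<rho> powr (- (DIM('a) * (4 / p - 1))))"
      using C(1) by (simp add: ennreal_plus[symmetric] del: ennreal_plus)
    finally show "(\<integral>\<^sup>+u. \<integral>\<^sup>+a. g1 a * g2 (a + u) * g3 (a + y u) * g4 (a + u + y u) * ?k u \<partial>lborel \<partial>lborel)
      \<le> ennreal (2 * C * \<rho> powr (- (DIM('a) * (4 / p - 1))))" unfolding k_def .
  qed
qed

section \<open>Parallelogram forms\<close>

text \<open>The arguments are the vertices of the parallelogram with sides \<open>u\<close> and
  \<open>l *\<^sub>R R u\<close>. Four functions are kept apart because inversion exchanges the two
  middle ones and because slices at four different points occur for products.\<close>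

definition parallelogram_form :: "('a::euclidean_space \<Rightarrow> 'a) \<Rightarrow> ('a \<Rightarrow> ennreal) \<Rightarrow> real \<Rightarrow>
    ('a \<Rightarrow> ennreal) \<Rightarrow> ('a \<Rightarrow> ennreal) \<Rightarrow> ('a \<Rightarrow> ennreal) \<Rightarrow> ('a \<Rightarrow> ennreal) \<Rightarrow> ennreal" where
  "parallelogram_form R W l f1 f2 f3 f4 =
    (\<integral>\<^sup>+u. \<integral>\<^sup>+a. f1 a * f2 (a + u) * f3 (a + l *\<^sub>R R u) * f4 (a + u + l *\<^sub>R R u) * W u \<partial>lborel \<partial>lborel)"

text \<open>Functions vanishing somewhere are excluded because their partial norms could give a product
  \<open>0 * \<infinity>\<close>.\<close>

definition parallelogram_bounded :: "real \<Rightarrow> real \<Rightarrow> ('a::euclidean_space \<Rightarrow> 'a) \<Rightarrow> ('a \<Rightarrow> ennreal) \<Rightarrow> bool" where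
  "parallelogram_bounded p \<theta> R W \<longleftrightarrow> R \<in> borel_measurable borel \<and> W \<in> borel_measurable borel \<and>
    (\<exists>C>0. \<forall>l f1 f2 f3 f4. l \<noteq> 0 \<longrightarrow>
      (\<forall>f\<in>{f1, f2, f3, f4}. f \<in> borel_measurable borel \<and> (\<forall>x. f x > 0)) \<longrightarrow>
      parallelogram_form R W l f1 f2 f3 f4 \<le> ennreal (C * \<bar>l\<bar> powr (- \<theta>)) * (enorm p f1 * enorm p f2 * enorm p f3 * enorm p f4))"

lemma parallelogram_form_cmult:
  assumes [measurable]: "R \<in> borel_measurable borel" "W \<in> borel_measurable borel"
    "f1 \<in> borel_measurable borel" "f2 \<in> borel_measurable borel"
    "f3 \<in> borel_measurable borel" "f4 \<in> borel_measurable borel"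
  shows "parallelogram_form R W l (\<lambda>x. c1 * f1 x) (\<lambda>x. c2 * f2 x) (\<lambda>x. c3 * f3 x) (\<lambda>x. c4 * f4 x)
    = (c1 * c2 * c3 * c4) * parallelogram_form R W l f1 f2 f3 f4"
proof -
  have "(c1 * c2 * c3 * c4) * parallelogram_form R W l f1 f2 f3 f4 =
    (\<integral>\<^sup>+u. \<integral>\<^sup>+a. (c1 * c2 * c3 * c4) * (f1 a * f2 (a + u) * f3 (a + l *\<^sub>R R u) * f4 (a + u + l *\<^sub>R R u) * W u) \<partial>lborel \<partial>lborel)"
    unfolding parallelogram_form_def by (simp add: nn_integral_cmult)
  also have "\<dots> = parallelogram_form R W l (\<lambda>x. c1 * f1 x) (\<lambda>x. c2 * f2 x) (\<lambda>x. c3 * f3 x) (\<lambda>x. c4 * f4 x)"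
    unfolding parallelogram_form_def by (simp only: mult_ac)
  finally show ?thesis ..
qed

lemma enorm_pos:
  fixes f :: "'a::euclidean_space \<Rightarrow> ennreal"
  assumes "f \<in> borel_measurable borel" "\<And>x. f x > 0"
  shows "enorm p f > 0"
proof -
  have "(\<integral>\<^sup>+x. epow (f x) p \<partial>lborel) \<noteq> 0"
  proof
    assume "(\<integral>\<^sup>+x. epow (f x) p \<partial>lborel) = 0"
    then have "AE x in lborel. epow (f x) p = 0"
      using assms(1) by (subst (asm) nn_integral_0_iff_AE) auto
    moreover have "epow (f x) p \<noteq> 0" for x
      using epow_pos[OF assms(2), of x p] by auto
    ultimately have "AE x::'a in lborel. False" by simp
    then show False
      using AE_iff_measurable[of "UNIV::'a set" lborel "\<lambda>_. False"] by (simp add: emeasure_lborel_UNIV)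
  qed
  then show ?thesis
    unfolding enorm_def by (intro epow_pos) (simp add: zero_less_iff_neq_zero)
qed

text \<open>Both sides are homogeneous of degree one in each function, so functions of norm at most
  one suffice. Positivity makes every norm nonzero, hence the right side infinite as soon as one
  norm is.\<close>

lemma parallelogram_boundedI:
  fixes R :: "'a::euclidean_space \<Rightarrow> 'a"
  assumes p: "p > 0" and m: "R \<in> borel_measurable borel" "W \<in> borel_measurable borel" and C: "C > 0"
    and bd: "\<And>l f1 f2 f3 f4. l \<noteq> 0 \<Longrightarrow>
      (\<And>f. f \<in> {f1, f2, f3, f4} \<Longrightarrow> f \<in> borel_measurable borel \<and> (\<integral>\<^sup>+x. epow (f x) p \<partial>lborel) \<le> 1) \<Longrightarrow>
      parallelogram_form R W l f1 f2 f3 f4 \<le> ennreal (C * \<bar>l\<bar> powr (- \<theta>))"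
  shows "parallelogram_bounded p \<theta> R W"
proof -
  have "parallelogram_form R W l f1 f2 f3 f4 \<le> ennreal (C * \<bar>l\<bar> powr (- \<theta>)) * (enorm p f1 * enorm p f2 * enorm p f3 * enorm p f4)"
    if l: "l \<noteq> 0" and f: "\<forall>f\<in>{f1, f2, f3, f4}. f \<in> borel_measurable borel \<and> (\<forall>x. f x > 0)"
    for l and f1 f2 f3 f4 :: "'a \<Rightarrow> ennreal"
  proof -
    let ?N = "enorm p"
    have fm [measurable]: "f1 \<in> borel_measurable borel" "f2 \<in> borel_measurable borel"
      "f3 \<in> borel_measurable borel" "f4 \<in> borel_measurable borel" using f by auto
    have pos: "?N f1 > 0" "?N f2 > 0" "?N f3 > 0" "?N f4 > 0"
      using f by (auto intro!: enorm_pos)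
    have Cl: "ennreal (C * \<bar>l\<bar> powr (- \<theta>)) > 0" using C l by (simp add: ennreal_less_zero_iff)
    show ?thesis
    proof (cases "?N f1 = \<top> \<or> ?N f2 = \<top> \<or> ?N f3 = \<top> \<or> ?N f4 = \<top>")
      case True
      have mt: "x * y = \<top>" if "x = \<top> \<and> y > 0 \<or> y = \<top> \<and> x > 0" for x y :: ennreal
        using that by (auto simp: ennreal_mult_top ennreal_top_mult)
      have mp: "x * y > 0" if "x > 0" "y > 0" for x y :: ennreal
        using that by (simp add: ennreal_zero_less_mult_iff)
      have "ennreal (C * \<bar>l\<bar> powr (- \<theta>)) * (?N f1 * ?N f2 * ?N f3 * ?N f4) = \<top>"
        using True
      proof (elim disjE)
        assume "?N f1 = \<top>"
        then show ?thesis using pos Cl by (intro mt disjI2 conjI disjI1 mp) auto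
      next
        assume t: "?N f2 = \<top>"
        have "?N f1 * ?N f2 = \<top>" using t pos by (intro mt) auto
        then have "?N f1 * ?N f2 * ?N f3 = \<top>" using pos by (intro mt) auto
        then have "?N f1 * ?N f2 * ?N f3 * ?N f4 = \<top>" using pos by (intro mt) auto
        then show ?thesis using Cl by (intro mt) auto
      next
        assume t: "?N f3 = \<top>"
        have "?N f1 * ?N f2 * ?N f3 = \<top>" using t pos by (intro mt disjI2 conjI mp) auto
        then have "?N f1 * ?N f2 * ?N f3 * ?N f4 = \<top>" using pos by (intro mt) auto
        then show ?thesis using Cl by (intro mt) auto
      next
        assume t: "?N f4 = \<top>"
        have "?N f1 * ?N f2 * ?N f3 * ?N f4 = \<top>" using t pos by (intro mt disjI2 conjI mp) auto
        then show ?thesis using Cl by (intro mt) auto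
      qed
      then show ?thesis by simp
    next
      case False
      have inv: "\<exists>c h. h \<in> borel_measurable borel \<and> (\<integral>\<^sup>+x. epow (h x) p \<partial>lborel) \<le> 1 \<and> c = ?N f \<and> f = (\<lambda>x. c * h x)"
        if [measurable]: "f \<in> borel_measurable borel" and N: "?N f > 0" "?N f \<noteq> \<top>" for f :: "'a \<Rightarrow> ennreal"
      proof -
        obtain N where eN: "?N f = ennreal N" and N0: "N > 0" using N by (cases "?N f") auto
        have one: "ennreal N * ennreal (1 / N) = 1" using N0 by (simp add: ennreal_mult[symmetric])
        have X: "(\<integral>\<^sup>+x. epow (f x) p \<partial>lborel) = ennreal (N powr p)"
        proof -
          have "(\<integral>\<^sup>+x. epow (f x) p \<partial>lborel) = epow (?N f) p"
            unfolding enorm_def using p by (simp add: epow_epow)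
          then show ?thesis using N0 by (simp add: eN epow_ennreal)
        qed
        have "(\<integral>\<^sup>+x. epow (ennreal (1 / N) * f x) p \<partial>lborel) = ennreal ((1 / N) powr p) * ennreal (N powr p)"
          unfolding X[symmetric] using p N0 by (simp add: epow_mult epow_ennreal nn_integral_cmult)
        also have "\<dots> = 1" using N0 by (simp add: ennreal_mult[symmetric] powr_mult[symmetric])
        finally have "(\<integral>\<^sup>+x. epow (ennreal (1 / N) * f x) p \<partial>lborel) \<le> 1" by simp
        moreover have "f = (\<lambda>x. ?N f * (ennreal (1 / N) * f x))"
          using one by (simp add: eN mult.assoc[symmetric])
        moreover have "(\<lambda>x. ennreal (1 / N) * f x) \<in> borel_measurable borel" by measurable
        ultimately show ?thesis by blast
      qed
      from inv[OF fm(1) pos(1)] inv[OF fm(2) pos(2)] inv[OF fm(3) pos(3)] inv[OF fm(4) pos(4)] False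
      obtain h1 h2 h3 h4 where h:
        "h1 \<in> borel_measurable borel" "(\<integral>\<^sup>+x. epow (h1 x) p \<partial>lborel) \<le> 1" "f1 = (\<lambda>x. ?N f1 * h1 x)"
        "h2 \<in> borel_measurable borel" "(\<integral>\<^sup>+x. epow (h2 x) p \<partial>lborel) \<le> 1" "f2 = (\<lambda>x. ?N f2 * h2 x)"
        "h3 \<in> borel_measurable borel" "(\<integral>\<^sup>+x. epow (h3 x) p \<partial>lborel) \<le> 1" "f3 = (\<lambda>x. ?N f3 * h3 x)"
        "h4 \<in> borel_measurable borel" "(\<integral>\<^sup>+x. epow (h4 x) p \<partial>lborel) \<le> 1" "f4 = (\<lambda>x. ?N f4 * h4 x)"
        by blast
      have "parallelogram_form R W l f1 f2 f3 f4 = (?N f1 * ?N f2 * ?N f3 * ?N f4) * parallelogram_form R W l h1 h2 h3 h4"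
        using parallelogram_form_cmult[OF m h(1,4,7,10), of l "?N f1" "?N f2" "?N f3" "?N f4"]
        unfolding h(3,6,9,12)[symmetric] .
      also have "\<dots> \<le> (?N f1 * ?N f2 * ?N f3 * ?N f4) * ennreal (C * \<bar>l\<bar> powr (- \<theta>))"
        using h by (intro mult_left_mono bd l) auto
      finally show ?thesis by (simp only: mult.commute)
    qed
  qed
  with m C show ?thesis unfolding parallelogram_bounded_def by blast
qed

lemma parallelogram_bounded_field:
  fixes c :: "'k::{real_normed_field, euclidean_space}"
  assumes p: "2 < p" "p < 4" and c: "c \<noteq> 0"
  shows "parallelogram_bounded p (DIM('k) / 2 * (4 / p - 1)) (\<lambda>u. c / u) (\<lambda>u. ennreal (1 / norm u ^ DIM('k)))"
proof -
  define \<beta> where "\<beta> = DIM('k) * (4 / p - 1)"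
  obtain C where C: "C > 0"
    "\<forall>\<rho> y g1 g2 g3 g4. \<rho> > 0 \<longrightarrow> y \<in> borel_measurable borel \<longrightarrow>
      (\<forall>g\<in>{g1, g2, g3, g4}. g \<in> borel_measurable borel \<and> (\<integral>\<^sup>+x. epow (g x) p \<partial>lborel) \<le> 1) \<longrightarrow>
      (\<integral>\<^sup>+u. \<integral>\<^sup>+a. g1 a * g2 (a + u) * g3 (a + y u) * g4 (a + u + y u) *
        (ennreal (1 / norm (u::'k) ^ DIM('k)) * indicator {u. norm u \<ge> \<rho>} u) \<partial>lborel \<partial>lborel)
        \<le> ennreal (C * \<rho> powr (- (DIM('k) * (4 / p - 1))))"
    using half_bound[OF p, where 'a='k] by blast
  define D where "D = 2 * C * norm c powr (- (\<beta> / 2))"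
  show ?thesis
  proof (rule parallelogram_boundedI)
    show "p > 0" using p by simp
    show "D > 0" using C c by (simp add: D_def)
    fix l :: real and f1 f2 f3 f4 :: "'k \<Rightarrow> ennreal"
    assume l: "l \<noteq> 0" and f: "\<And>f. f \<in> {f1, f2, f3, f4} \<Longrightarrow> f \<in> borel_measurable borel \<and> (\<integral>\<^sup>+x. epow (f x) p \<partial>lborel) \<le> 1"
    have [measurable]: "f1 \<in> borel_measurable borel" "f2 \<in> borel_measurable borel"
      "f3 \<in> borel_measurable borel" "f4 \<in> borel_measurable borel" using f by auto
    define q where "q = l *\<^sub>R c"
    have q: "q \<noteq> 0" using l c by (simp add: q_def)
    \<comment> \<open>The sphere of radius \<rho> is preserved by u -> q / u, so inversion exchanges
      its inside and its outside. The square root of |l c| is the source of the factor 1/2 in the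
      exponent of |l|.\<close>
    define \<rho> where "\<rho> = sqrt (norm q)"
    have \<rho>: "\<rho> > 0" "\<rho> * \<rho> = norm q" using q by (simp_all add: \<rho>_def)
    define \<Phi> where "\<Phi> f2 f3 u = (\<integral>\<^sup>+a. f1 a * f2 (a + u) * f3 (a + q / u) * f4 (a + u + q / u) \<partial>lborel)"
      for f2 f3 :: "'k \<Rightarrow> ennreal" and u :: 'k
    have \<Phi>m [measurable]: "\<Phi> f2 f3 \<in> borel_measurable borel"
      if [measurable]: "f2 \<in> borel_measurable borel" "f3 \<in> borel_measurable borel" for f2 f3 :: "'k \<Rightarrow> ennreal"
      unfolding \<Phi>_def by measurable
    let ?B = "ennreal (C * \<rho> powr (- \<beta>))"
    have bound: "haar (\<lambda>u. \<Phi> f2' f3' u * indicator {u. norm u \<ge> \<rho>} u) \<le> ?B"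
      if "f2' \<in> {f2, f3}" "f3' \<in> {f2, f3}" for f2' f3'
    proof -
      have [measurable]: "f2' \<in> borel_measurable borel" "f3' \<in> borel_measurable borel" using that by auto
      have "haar (\<lambda>u. \<Phi> f2' f3' u * indicator {u. norm u \<ge> \<rho>} u) =
        (\<integral>\<^sup>+u. \<integral>\<^sup>+a. f1 a * f2' (a + u) * f3' (a + q / u) * f4 (a + u + q / u) *
        (ennreal (1 / norm (u::'k) ^ DIM('k)) * indicator {u. norm u \<ge> \<rho>} u) \<partial>lborel \<partial>lborel)"
        unfolding haar_def
      proof (rule nn_integral_cong)
        fix u :: 'k
        have "\<Phi> f2' f3' u * (ennreal (1 / norm u ^ DIM('k)) * indicator {u. norm u \<ge> \<rho>} u)
          = (\<integral>\<^sup>+a. f1 a * f2' (a + u) * f3' (a + q / u) * f4 (a + u + q / u) *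
        (ennreal (1 / norm (u::'k) ^ DIM('k)) * indicator {u. norm u \<ge> \<rho>} u) \<partial>lborel)"
          unfolding \<Phi>_def by (rule nn_integral_multc[symmetric]) measurable
        then show "\<Phi> f2' f3' u * indicator {u. norm u \<ge> \<rho>} u * ennreal (1 / norm u ^ DIM('k))
          = (\<integral>\<^sup>+a. f1 a * f2' (a + u) * f3' (a + q / u) * f4 (a + u + q / u) *
        (ennreal (1 / norm (u::'k) ^ DIM('k)) * indicator {u. norm u \<ge> \<rho>} u) \<partial>lborel)"
          by (simp only: mult_ac)
      qed
      also have "\<dots> \<le> ?B"
        unfolding \<beta>_def using that f by (intro C(2)[rule_format, of \<rho> "\<lambda>u. q / u"] \<rho>) auto
      finally show ?thesis .
    qed
    define F where "F u = \<Phi> f2 f3 u * indicator {u. norm u < \<rho>} u" for u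
    have [measurable]: "F \<in> borel_measurable borel" unfolding F_def by measurable
    \<comment> \<open>Dilation by \<open>q\<close> and inversion, both preserving Haar measure,
      compose to u -> q / u.\<close>
    have "haar F = haar (\<lambda>u. F (q * u))" using q by (intro haar_mult[symmetric]) auto
    also have "\<dots> = haar (\<lambda>u. F (q * (1 / u)))"
      by (rule haar_inverse[symmetric, where h="\<lambda>u. F (q * u)"]) measurable
    also have "\<dots> = haar (\<lambda>u. \<Phi> f3 f2 u * indicator {u. norm u > \<rho>} u)"
    proof (rule haar_cong)
      fix u :: 'k assume u: "u \<noteq> 0"
      \<comment> \<open>Since q / (q / u) = u, the two sides trade places, and with them
        \<open>f2\<close> and \<open>f3\<close>.\<close>
      have "\<Phi> f2 f3 (q / u) = \<Phi> f3 f2 u"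
        unfolding \<Phi>_def using u q by (intro nn_integral_cong) (simp add: add_ac mult_ac)
      moreover have "norm (q / u) < \<rho> \<longleftrightarrow> norm u > \<rho>"
        using u \<rho> by (simp add: norm_divide \<rho>(2)[symmetric] pos_divide_less_eq)
      ultimately show "F (q * (1 / u)) = \<Phi> f3 f2 u * indicator {u. norm u > \<rho>} u"
        by (simp add: F_def indicator_def)
    qed
    also have "\<dots> \<le> haar (\<lambda>u. \<Phi> f3 f2 u * indicator {u. norm u \<ge> \<rho>} u)"
      unfolding haar_def by (intro nn_integral_mono mult_right_mono mult_left_mono) (auto simp: indicator_def)
    also have "\<dots> \<le> ?B" by (rule bound) auto
    finally have Fb: "haar F \<le> ?B" .
    have "parallelogram_form (\<lambda>u. c / u) (\<lambda>u. ennreal (1 / norm u ^ DIM('k))) l f1 f2 f3 f4 = haar (\<Phi> f2 f3)"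
    proof -
      have "l *\<^sub>R (c / u) = q / u" for u
        by (simp add: q_def scaleR_conv_of_real)
      then show ?thesis
        unfolding parallelogram_form_def haar_def \<Phi>_def
        by (intro nn_integral_cong) (subst nn_integral_multc[symmetric], auto)
    qed
    also have "\<dots> = haar (\<lambda>u. \<Phi> f2 f3 u * indicator {u. norm u \<ge> \<rho>} u) + haar F"
      unfolding haar_def F_def
      by (subst nn_integral_add[symmetric]) (auto intro!: nn_integral_cong simp: indicator_def)
    also have "\<dots> \<le> ?B + ?B" by (intro add_mono Fb bound) auto
    also have "\<dots> = ennreal (2 * C * \<rho> powr (- \<beta>))"
      using C by (simp add: ennreal_plus[symmetric] del: ennreal_plus)
    also have "\<rho> powr (- \<beta>) = \<bar>l\<bar> powr (- (\<beta> / 2)) * norm c powr (- (\<beta> / 2))"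
    proof -
      have "\<rho> = (\<bar>l\<bar> * norm c) powr (1 / 2)"
        by (simp add: \<rho>_def q_def powr_half_sqrt)
      then show ?thesis by (simp add: powr_powr powr_mult)
    qed
    also have "2 * C * (\<bar>l\<bar> powr (- (\<beta> / 2)) * norm c powr (- (\<beta> / 2)))
      = D * \<bar>l\<bar> powr (- (DIM('k) / 2 * (4 / p - 1)))"
      by (simp add: D_def \<beta>_def)
    finally show "parallelogram_form (\<lambda>u. c / u) (\<lambda>u. ennreal (1 / norm u ^ DIM('k))) l f1 f2 f3 f4
      \<le> ennreal (D * \<bar>l\<bar> powr (- (DIM('k) / 2 * (4 / p - 1))))" .
  qed measurable
qed

text \<open>Tonelli moves both variables of the second factor outside; the inner pair of integrals
  is then a form on the first factor alone.\<close>

lemma nn_integral_pair_pair: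
  fixes G :: "'a::euclidean_space \<Rightarrow> 'b::euclidean_space \<Rightarrow> 'a \<Rightarrow> 'b \<Rightarrow> ennreal"
  assumes G: "(\<lambda>(u1, u2, a1, a2). G u1 u2 a1 a2) \<in> borel_measurable borel"
  shows "(\<integral>\<^sup>+u. \<integral>\<^sup>+a. G (fst u) (snd u) (fst a) (snd a) \<partial>lborel \<partial>lborel)
    = (\<integral>\<^sup>+u2. \<integral>\<^sup>+a2. \<integral>\<^sup>+u1. \<integral>\<^sup>+a1. G u1 u2 a1 a2 \<partial>lborel \<partial>lborel \<partial>lborel \<partial>lborel)"
proof -
  have Gm [measurable (raw)]: "(\<lambda>x. G (f1 x) (f2 x) (f3 x) (f4 x)) \<in> borel_measurable M"
    if [measurable]: "f1 \<in> borel_measurable M" "f2 \<in> borel_measurable M" "f3 \<in> borel_measurable M" "f4 \<in> borel_measurable M"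
    for f1 f3 :: "'c \<Rightarrow> 'a" and f2 f4 :: "'c \<Rightarrow> 'b" and M
  proof -
    have "(\<lambda>x. (f1 x, f2 x, f3 x, f4 x)) \<in> borel_measurable M" by measurable
    from measurable_compose[OF this G] show ?thesis by simp
  qed
  have "(\<integral>\<^sup>+u. \<integral>\<^sup>+a. G (fst u) (snd u) (fst a) (snd a) \<partial>lborel \<partial>lborel)
    = (\<integral>\<^sup>+u1. \<integral>\<^sup>+u2. \<integral>\<^sup>+a. G u1 u2 (fst a) (snd a) \<partial>lborel \<partial>lborel \<partial>lborel)"
    by (subst nn_integral_lborel_pair) simp_all
  also have "\<dots> = (\<integral>\<^sup>+u1. \<integral>\<^sup>+u2. \<integral>\<^sup>+a1. \<integral>\<^sup>+a2. G u1 u2 a1 a2 \<partial>lborel \<partial>lborel \<partial>lborel \<partial>lborel)"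
    by (intro nn_integral_cong, subst nn_integral_lborel_pair) simp_all
  also have "\<dots> = (\<integral>\<^sup>+u2. \<integral>\<^sup>+u1. \<integral>\<^sup>+a1. \<integral>\<^sup>+a2. G u1 u2 a1 a2 \<partial>lborel \<partial>lborel \<partial>lborel \<partial>lborel)"
    by (rule nn_integral_lborel_swap) measurable
  also have "\<dots> = (\<integral>\<^sup>+u2. \<integral>\<^sup>+u1. \<integral>\<^sup>+a2. \<integral>\<^sup>+a1. G u1 u2 a1 a2 \<partial>lborel \<partial>lborel \<partial>lborel \<partial>lborel)"
    by (intro nn_integral_cong nn_integral_lborel_swap) measurable
  also have "\<dots> = (\<integral>\<^sup>+u2. \<integral>\<^sup>+a2. \<integral>\<^sup>+u1. \<integral>\<^sup>+a1. G u1 u2 a1 a2 \<partial>lborel \<partial>lborel \<partial>lborel \<partial>lborel)"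
    by (intro nn_integral_cong nn_integral_lborel_swap) measurable
  finally show ?thesis .
qed

lemma enorm_pair:
  fixes f :: "'a::euclidean_space \<times> 'b::euclidean_space \<Rightarrow> ennreal"
  assumes p: "p > 0" and [measurable]: "f \<in> borel_measurable borel"
  shows "enorm p (\<lambda>y. enorm p (\<lambda>x. f (x, y))) = enorm p f"
proof -
  have "(\<integral>\<^sup>+y. epow (enorm p (\<lambda>x. f (x, y))) p \<partial>lborel) = (\<integral>\<^sup>+y. \<integral>\<^sup>+x. epow (f (x, y)) p \<partial>lborel \<partial>lborel)"
    using p by (simp add: enorm_def epow_epow)
  also have "\<dots> = (\<integral>\<^sup>+x. \<integral>\<^sup>+y. epow (f (x, y)) p \<partial>lborel \<partial>lborel)"
    by (rule nn_integral_lborel_swap) measurable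
  also have "\<dots> = (\<integral>\<^sup>+z. epow (f z) p \<partial>lborel)"
    by (rule nn_integral_lborel_pair[symmetric]) measurable
  finally show ?thesis by (simp add: enorm_def)
qed

text \<open>For fixed second coordinates the form is a form on the first factor; its bound leaves the same
  form on the second factor, applied to the partial norms \<open>\<lambda>y. enorm p (\<lambda>x. f (x, y))\<close>.\<close>

lemma parallelogram_bounded_prod:
  fixes R1 :: "'a::euclidean_space \<Rightarrow> 'a" and R2 :: "'b::euclidean_space \<Rightarrow> 'b"
  assumes p: "p > 0" and T1: "parallelogram_bounded p \<theta>1 R1 W1" and T2: "parallelogram_bounded p \<theta>2 R2 W2"
  shows "parallelogram_bounded p (\<theta>1 + \<theta>2) (\<lambda>u. (R1 (fst u), R2 (snd u))) (\<lambda>u. W1 (fst u) * W2 (snd u))"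
proof -
  have m [measurable]: "R1 \<in> borel_measurable borel" "W1 \<in> borel_measurable borel"
    "R2 \<in> borel_measurable borel" "W2 \<in> borel_measurable borel"
    using T1 T2 by (auto simp: parallelogram_bounded_def)
  obtain C1 where C1: "C1 > 0" "\<And>l f1 f2 f3 f4. l \<noteq> 0 \<Longrightarrow>
      (\<forall>f\<in>{f1, f2, f3, f4}. f \<in> borel_measurable borel \<and> (\<forall>x. f x > 0)) \<Longrightarrow>
      parallelogram_form R1 W1 l f1 f2 f3 f4 \<le> ennreal (C1 * \<bar>l\<bar> powr (- \<theta>1)) * (enorm p f1 * enorm p f2 * enorm p f3 * enorm p f4)"
    using T1 unfolding parallelogram_bounded_def by blast
  obtain C2 where C2: "C2 > 0" "\<And>l f1 f2 f3 f4. l \<noteq> 0 \<Longrightarrow>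
      (\<forall>f\<in>{f1, f2, f3, f4}. f \<in> borel_measurable borel \<and> (\<forall>x. f x > 0)) \<Longrightarrow>
      parallelogram_form R2 W2 l f1 f2 f3 f4 \<le> ennreal (C2 * \<bar>l\<bar> powr (- \<theta>2)) * (enorm p f1 * enorm p f2 * enorm p f3 * enorm p f4)"
    using T2 unfolding parallelogram_bounded_def by blast
  let ?R = "\<lambda>u. (R1 (fst u), R2 (snd u))" and ?W = "\<lambda>u. W1 (fst u) * W2 (snd u)"
  have main: "parallelogram_form ?R ?W l f1 f2 f3 f4 \<le> ennreal ((C1 * C2) * \<bar>l\<bar> powr (- (\<theta>1 + \<theta>2))) * (enorm p f1 * enorm p f2 * enorm p f3 * enorm p f4)"
    if l: "l \<noteq> 0" and f: "\<forall>f\<in>{f1, f2, f3, f4}. f \<in> borel_measurable borel \<and> (\<forall>x. f x > 0)"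
    for l and f1 f2 f3 f4 :: "'a \<times> 'b \<Rightarrow> ennreal"
  proof -
    have fm [measurable]: "f1 \<in> borel_measurable borel" "f2 \<in> borel_measurable borel"
      "f3 \<in> borel_measurable borel" "f4 \<in> borel_measurable borel" using f by auto
    define F where "F f y = enorm p (\<lambda>x. f (x, y))" for f :: "'a \<times> 'b \<Rightarrow> ennreal" and y
    have Fm [measurable]: "F f \<in> borel_measurable borel" if [measurable]: "f \<in> borel_measurable borel" for f
      unfolding F_def enorm_def by measurable
    have Fpos: "F f y > 0" if "f \<in> {f1, f2, f3, f4}" for f y
      unfolding F_def using that f by (intro enorm_pos) auto
    let ?K1 = "ennreal (C1 * \<bar>l\<bar> powr (- \<theta>1))" and ?K2 = "ennreal (C2 * \<bar>l\<bar> powr (- \<theta>2))"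
    let ?I1 = "\<lambda>u2 a2 u1 a1. f1 (a1, a2) * f2 (a1 + u1, a2 + u2) * f3 (a1 + l *\<^sub>R R1 u1, a2 + l *\<^sub>R R2 u2)
        * f4 (a1 + u1 + l *\<^sub>R R1 u1, a2 + u2 + l *\<^sub>R R2 u2) * W1 u1"
    have "parallelogram_form ?R ?W l f1 f2 f3 f4 = (\<integral>\<^sup>+u. \<integral>\<^sup>+a. ?I1 (snd u) (snd a) (fst u) (fst a) * W2 (snd u) \<partial>lborel \<partial>lborel)"
      unfolding parallelogram_form_def
      by (intro nn_integral_cong) (simp add: mult.assoc split_beta plus_prod_def scaleR_prod_def)
    also have "\<dots> = (\<integral>\<^sup>+u2. \<integral>\<^sup>+a2. \<integral>\<^sup>+u1. \<integral>\<^sup>+a1. ?I1 u2 a2 u1 a1 * W2 u2 \<partial>lborel \<partial>lborel \<partial>lborel \<partial>lborel)"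
      by (rule nn_integral_pair_pair[where G="\<lambda>u1 u2 a1 a2. ?I1 u2 a2 u1 a1 * W2 u2"])
         (simp only: case_prod_beta', measurable)
    also have "\<dots> = (\<integral>\<^sup>+u2. \<integral>\<^sup>+a2. parallelogram_form R1 W1 l (\<lambda>x. f1 (x, a2)) (\<lambda>x. f2 (x, a2 + u2))
        (\<lambda>x. f3 (x, a2 + l *\<^sub>R R2 u2)) (\<lambda>x. f4 (x, a2 + u2 + l *\<^sub>R R2 u2)) * W2 u2 \<partial>lborel \<partial>lborel)"
      unfolding parallelogram_form_def by (simp add: nn_integral_multc)
    also have "\<dots> \<le> (\<integral>\<^sup>+u2. \<integral>\<^sup>+a2. ?K1 * (F f1 a2 * F f2 (a2 + u2) * F f3 (a2 + l *\<^sub>R R2 u2) * F f4 (a2 + u2 + l *\<^sub>R R2 u2)) * W2 u2 \<partial>lborel \<partial>lborel)"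
      unfolding F_def using f by (intro nn_integral_mono mult_right_mono C1(2) l) auto
    also have "\<dots> = ?K1 * parallelogram_form R2 W2 l (F f1) (F f2) (F f3) (F f4)"
      unfolding parallelogram_form_def by (simp add: mult.assoc nn_integral_cmult)
    also have "\<dots> \<le> ?K1 * (?K2 * (enorm p (F f1) * enorm p (F f2) * enorm p (F f3) * enorm p (F f4)))"
      using Fpos by (intro mult_left_mono C2(2) l) auto
    also have "\<dots> = (?K1 * ?K2) * (enorm p f1 * enorm p f2 * enorm p f3 * enorm p f4)"
      unfolding F_def using p by (simp add: enorm_pair mult.assoc)
    also have "?K1 * ?K2 = ennreal ((C1 * C2) * \<bar>l\<bar> powr (- (\<theta>1 + \<theta>2)))"
    proof -
      have "\<bar>l\<bar> powr (- (\<theta>1 + \<theta>2)) = \<bar>l\<bar> powr (- \<theta>1) * \<bar>l\<bar> powr (- \<theta>2)"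
        by (simp add: powr_add[symmetric])
      then show ?thesis using C1(1) C2(1) by (simp add: ennreal_mult[symmetric] mult_ac)
    qed
    finally show ?thesis .
  qed
  have "?R \<in> borel_measurable borel" "?W \<in> borel_measurable borel" by measurable
  moreover have "C1 * C2 > 0" using C1 C2 by simp
  ultimately show ?thesis using main unfolding parallelogram_bounded_def by blast
qed

section \<open>The fourth power of the extension operator\<close>

lemma borel_measurable_cross3 [measurable (raw)]:
  assumes "f \<in> borel_measurable M" "g \<in> borel_measurable M"
  shows "(\<lambda>x. cross3 (f x) (g x)) \<in> borel_measurable M"
  using assms by (rule borel_measurable_continuous_Pair) (intro continuous_on_cross continuous_intros)

lemma borel_measurable_matrix_vector_mult [measurable (raw)]:
  fixes A :: "real^'n^'m"
  assumes "f \<in> borel_measurable M"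
  shows "(\<lambda>x. A *v f x) \<in> borel_measurable M"
  using assms by (rule borel_measurable_continuous_on[OF matrix_vector_mult_linear_continuous_on])

text \<open>The constant of \<open>linear_iso_nn_integral\<close> is read off from the preimage of
  the unit ball, whose volume follows from the determinant formula for linear images.\<close>

lemma nn_integral_det_one:
  fixes M :: "real^3 \<Rightarrow> real^3"
  assumes lin: "linear M" and det: "\<bar>det (matrix M)\<bar> = 1" and [measurable]: "f \<in> borel_measurable borel"
  shows "(\<integral>\<^sup>+x. f (M x) \<partial>lborel) = (\<integral>\<^sup>+x. f x \<partial>lborel)"
proof -
  have "invertible (matrix M)" using det by (auto simp: invertible_det_nz)
  then have bij: "bij M"
    using lin by (metis invertible_eq_bij matrix_vector_mul(2))
  obtain k where k: "k > 0"
    "\<And>f::real^3 \<Rightarrow> ennreal. f \<in> borel_measurable borel \<Longrightarrow> (\<integral>\<^sup>+x. f (M x) \<partial>lborel) = ennreal k * (\<integral>\<^sup>+y. f y \<partial>lborel)"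
    "emeasure lborel (M -` ball 0 1) = ennreal k * emeasure lborel (ball (0::real^3) 1)"
    using linear_iso_nn_integral[OF lin bij] by metis
  let ?B = "ball (0::real^3) 1"
  have cont: "continuous_on UNIV M"
    using lin by (simp add: linear_continuous_on linear_conv_bounded_linear)
  then have [measurable]: "M -` ?B \<in> sets borel"
    by (metis borel_open open_vimage open_ball)
  have eB: "emeasure lborel ?B = ennreal (measure lborel ?B)"
    using emeasure_bounded_finite[of ?B] by (simp add: emeasure_eq_ennreal_measure)
  have mM: "emeasure lborel (M -` ?B) = ennreal (k * measure lborel ?B)"
    using k(1,3) by (simp add: eB ennreal_mult)
  then have lm: "M -` ?B \<in> lmeasurable"
    by (intro fmeasurableI) (auto simp: less_top)
  have "measure lborel (M -` ?B) = k * measure lborel ?B"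
    using mM k(1) by (simp add: measure_def)
  moreover have "measure lebesgue (M ` (M -` ?B)) = \<bar>det (matrix M)\<bar> * measure lebesgue (M -` ?B)"
    by (rule measure_linear_image[OF lin lm])
  moreover have "M ` (M -` ?B) = ?B"
    using bij by (simp add: bij_is_surj surj_image_vimage_eq)
  ultimately have "measure lborel ?B = k * measure lborel ?B"
    using det by (simp add: measure_completion)
  moreover have "measure lborel ?B > 0" by (rule content_ball_pos) simp
  ultimately have "k = 1" by simp
  then show ?thesis using k(2)[of f] by simp
qed

text \<open>With w the cross product of \<open>p\<close> and \<open>q\<close>, the three vectors
  form the basis dual to \<open>p\<close>, \<open>q\<close>, w / |w|^2. For nonzero w,
  \<open>fiber p q (s, t, m)\<close> therefore runs over the line of points whose inner products
  with \<open>p\<close> and \<open>q\<close> are \<open>s\<close> and \<open>t\<close>, and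
  \<open>m\<close> is the position along it in units of w.\<close>

definition fiber :: "real^3 \<Rightarrow> real^3 \<Rightarrow> real \<times> real \<times> real \<Rightarrow> real^3" where
  "fiber p q z = (fst z / (norm (cross3 p q))\<^sup>2) *\<^sub>R cross3 q (cross3 p q)
    + (fst (snd z) / (norm (cross3 p q))\<^sup>2) *\<^sub>R cross3 (cross3 p q) p + snd (snd z) *\<^sub>R cross3 p q"

lemma fiber_measurable [measurable (raw)]:
  assumes [measurable]: "f \<in> borel_measurable M" "g \<in> borel_measurable M" "h \<in> borel_measurable M"
  shows "(\<lambda>x. fiber (f x) (g x) (h x)) \<in> borel_measurable M"
  unfolding fiber_def by measurable

lemma fiber_add: "fiber p q (s, t, m + n) = fiber p q (s, t, m) + n *\<^sub>R cross3 p q"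
  by (simp add: fiber_def scaleR_add_left)

lemma
  assumes "cross3 p q \<noteq> 0"
  shows inner_fiber_1: "p \<bullet> fiber p q z = fst z"
    and inner_fiber_2: "q \<bullet> fiber p q z = fst (snd z)"
    and inner_fiber_3: "cross3 p q \<bullet> fiber p q z = snd (snd z) * (norm (cross3 p q))\<^sup>2"
proof -
  let ?w = "cross3 p q"
  have w: "(norm ?w)\<^sup>2 \<noteq> 0" using assms by simp
  have 1: "p \<bullet> cross3 q ?w = (norm ?w)\<^sup>2" "q \<bullet> cross3 ?w p = (norm ?w)\<^sup>2"
    unfolding power2_norm_eq_inner by (simp_all add: cross3_simps)
  have 2: "p \<bullet> cross3 ?w p = 0" "q \<bullet> cross3 q ?w = 0" "p \<bullet> ?w = 0" "q \<bullet> ?w = 0"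
    "?w \<bullet> cross3 q ?w = 0" "?w \<bullet> cross3 ?w p = 0"
    by (simp_all add: cross3_simps)
  show "p \<bullet> fiber p q z = fst z" "q \<bullet> fiber p q z = fst (snd z)"
    "cross3 p q \<bullet> fiber p q z = snd (snd z) * (norm (cross3 p q))\<^sup>2"
    using w by (simp_all add: fiber_def inner_add_right 1 2 power2_norm_eq_inner[symmetric])
qed

text \<open>The Jacobian of \<open>fiber p q\<close> does not depend on \<open>p\<close> and \<open>q\<close>: the matrix with rows \<open>w / |w|\<^sup>2\<close>,
  \<open>p\<close>, \<open>q\<close>, where \<open>w\<close> is the cross product of \<open>p\<close> and \<open>q\<close>, inverts it and has determinant one.\<close>

lemma nn_integral_fiber:
  obtains k :: real where "k > 0"
    and "\<And>p q f. cross3 p q \<noteq> 0 \<Longrightarrow> f \<in> borel_measurable borel \<Longrightarrow>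
      (\<integral>\<^sup>+z. f (fiber p q z) \<partial>lborel) = ennreal k * (\<integral>\<^sup>+x. f x \<partial>lborel)"
proof -
  \<comment> \<open>Only this reordering of coordinates contributes to \<open>k\<close>; the map
    \<open>M\<close> below has determinant of modulus one, so \<open>k\<close> is the same for all
    \<open>p\<close> and \<open>q\<close>. The order (m, s, t) matches the rows of
    \<open>N\<close>.\<close>
  define J :: "real \<times> real \<times> real \<Rightarrow> real^3" where "J z = vector [snd (snd z), fst z, fst (snd z)]" for z
  have linJ: "linear J"
    by (rule linearI) (simp_all add: J_def vec_eq_iff forall_3)
  have bijJ: "bij J"
    by (rule bij_betw_byWitness[where f'="\<lambda>x. (x $ 2, x $ 3, x $ 1)"])
       (auto simp: J_def vec_eq_iff forall_3)
  obtain k where k: "k > 0"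
    "\<And>f::real^3 \<Rightarrow> ennreal. f \<in> borel_measurable borel \<Longrightarrow>
      (\<integral>\<^sup>+x. f (J x) \<partial>lborel) = ennreal k * (\<integral>\<^sup>+y. f y \<partial>lborel)"
    using linear_iso_nn_integral[OF linJ bijJ] by metis
  show ?thesis
  proof (rule that[OF k(1)])
    fix p q :: "real^3" and f :: "real^3 \<Rightarrow> ennreal"
    assume w: "cross3 p q \<noteq> 0" and [measurable]: "f \<in> borel_measurable borel"
    define M where "M x = fiber p q (x $ 2, x $ 3, x $ 1)" for x :: "real^3"
    have lin: "linear M"
      by (rule linearI) (simp_all add: M_def fiber_def algebra_simps add_divide_distrib)
    then have [measurable]: "M \<in> borel_measurable borel"
      by (intro borel_measurable_continuous_onI) (simp add: linear_continuous_on linear_conv_bounded_linear)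
    define w' where "w' = (1 / (norm (cross3 p q))\<^sup>2) *\<^sub>R cross3 p q"
    define N :: "real^3^3" where "N = vector [w', p, q]"
    have "det N = w' \<bullet> cross3 p q"
      unfolding N_def by (rule dot_cross_det[symmetric])
    then have detN: "det N = 1"
      using w by (simp add: w'_def power2_norm_eq_inner)
    have "N *v M x = x" for x
      using w inner_fiber_1[OF w] inner_fiber_2[OF w] inner_fiber_3[OF w]
      by (simp add: N_def M_def matrix_vector_mul_component vec_eq_iff forall_3 w'_def)
    then have "N ** matrix M = mat 1"
      using lin by (simp add: matrix_eq matrix_vector_mul_assoc[symmetric] matrix_works)
    then have "det N * det (matrix M) = 1" by (metis det_mul det_I)
    then have "\<bar>det (matrix M)\<bar> = 1" using detN by simp
    then have "(\<integral>\<^sup>+x. f (M x) \<partial>lborel) = (\<integral>\<^sup>+x. f x \<partial>lborel)"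
      by (intro nn_integral_det_one[OF lin]) auto
    moreover have "fiber p q z = M (J z)" for z
      by (simp add: M_def J_def)
    moreover have "(\<integral>\<^sup>+z. f (M (J z)) \<partial>lborel) = ennreal k * (\<integral>\<^sup>+x. f (M x) \<partial>lborel)"
      by (rule k(2)) measurable
    ultimately show "(\<integral>\<^sup>+z. f (fiber p q z) \<partial>lborel) = ennreal k * (\<integral>\<^sup>+x. f x \<partial>lborel)"
      by simp
  qed
qed

definition cross_map :: "real^3^3 \<Rightarrow> real^3^3 \<Rightarrow> real^3 \<Rightarrow> real^3" where
  "cross_map A B u = cross3 (A *v u) (B *v u)"

lemma cross_map_measurable [measurable (raw)]:
  assumes [measurable]: "f \<in> borel_measurable M"
  shows "(\<lambda>x. cross_map A B (f x)) \<in> borel_measurable M"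
  unfolding cross_map_def by measurable

definition Lambda :: "(real^3 \<Rightarrow> real^3) \<Rightarrow> (real^3 \<Rightarrow> ennreal) \<Rightarrow> ennreal" where
  "Lambda w f = (\<integral>\<^sup>+m. \<integral>\<^sup>+u. \<integral>\<^sup>+a. f a * f (a + u) * f (a + m *\<^sub>R w u) * f (a + u + m *\<^sub>R w u) \<partial>lborel \<partial>lborel \<partial>lborel)"

text \<open>Coordinates \<open>((u, s, t), m)\<close> on pairs \<open>(\<xi>, \<eta>)\<close>: \<open>\<xi> - \<eta> = u\<close>, and the two quadratic forms of \<open>\<xi>\<close>
  exceed those of \<open>\<eta>\<close> by \<open>s\<close> and \<open>t\<close>.\<close>

definition pair_coords :: "real^3^3 \<Rightarrow> real^3^3 \<Rightarrow> ((real^3) \<times> real \<times> real) \<times> real \<Rightarrow> (real^3) \<times> (real^3)" where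
  "pair_coords A B z = (let u = fst (fst z); v = fiber (A *v u) (B *v u) (fst (snd (fst z)), snd (snd (fst z)), snd z)
     in ((1 / 2) *\<^sub>R (v + u), (1 / 2) *\<^sub>R (v - u)))"

lemma pair_coords_measurable [measurable (raw)]:
  assumes [measurable]: "f \<in> borel_measurable M"
  shows "(\<lambda>x. pair_coords A B (f x)) \<in> borel_measurable M"
  unfolding pair_coords_def Let_def by measurable

lemma pair_coords_diff: "fst (pair_coords A B z) - snd (pair_coords A B z) = fst (fst z)"
  by (simp add: pair_coords_def Let_def algebra_simps scaleR_add_left[symmetric] del: scaleR_add_left)

lemma quad_form_diff:
  assumes "transpose A = A"
  shows "quad_form A \<xi> - quad_form A \<eta> = (A *v (\<xi> - \<eta>)) \<bullet> (\<xi> + \<eta>)"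
proof -
  have "\<eta> \<bullet> (A *v \<xi>) = \<xi> \<bullet> (A *v \<eta>)"
    by (metis assms dot_lmul_matrix inner_commute transpose_matrix_vector)
  then show ?thesis
    by (simp add: quad_form_def matrix_vector_mult_diff_distrib inner_diff_left inner_diff_right inner_add_left inner_add_right inner_commute)
qed

lemma surface_param_pair_coords:
  assumes "transpose A = A" "transpose B = B" and w: "cross_map A B (fst (fst z)) \<noteq> 0"
  shows "surface_param A B (fst (pair_coords A B z)) - surface_param A B (snd (pair_coords A B z)) = fst z"
proof -
  define u where "u = fst (fst z)"
  define v where "v = fiber (A *v u) (B *v u) (fst (snd (fst z)), snd (snd (fst z)), snd z)"
  have sum: "fst (pair_coords A B z) + snd (pair_coords A B z) = v"
    by (simp add: pair_coords_def Let_def u_def v_def algebra_simps scaleR_add_left[symmetric] del: scaleR_add_left)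
  have w: "cross3 (A *v u) (B *v u) \<noteq> 0" using w by (simp add: cross_map_def u_def)
  show ?thesis
    by (simp add: surface_param_def quad_form_diff assms pair_coords_diff sum prod_eq_iff u_def[symmetric])
       (simp add: v_def inner_fiber_1[OF w] inner_fiber_2[OF w])
qed

text \<open>The Jacobian is constant although the map is nonlinear in \<open>u\<close>: at fixed
  \<open>u\<close> the fibre coordinates contribute \<open>k1\<close>, the same for all admissible
  \<open>u\<close>, and the passage from difference and sum back to the pair is the linear map
  \<open>S\<close>. The hypothesis makes almost every \<open>u\<close> admissible.\<close>

lemma nn_integral_pair_coords:
  assumes w: "AE u in lborel. cross_map A B u \<noteq> 0"
  obtains k :: real where "k > 0"
    and "\<And>f. f \<in> borel_measurable borel \<Longrightarrow>
      (\<integral>\<^sup>+z. f (pair_coords A B z) \<partial>lborel) = ennreal k * (\<integral>\<^sup>+x. f x \<partial>lborel)"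
proof -
  obtain k1 where k1: "k1 > 0" "\<And>p q f. cross3 p q \<noteq> 0 \<Longrightarrow> f \<in> borel_measurable borel \<Longrightarrow>
      (\<integral>\<^sup>+z. f (fiber p q z) \<partial>lborel) = ennreal k1 * (\<integral>\<^sup>+x. f x \<partial>lborel)"
    by (rule nn_integral_fiber[OF that])
  define S :: "(real^3) \<times> (real^3) \<Rightarrow> (real^3) \<times> (real^3)" where
    "S x = ((1 / 2) *\<^sub>R (snd x + fst x), (1 / 2) *\<^sub>R (snd x - fst x))" for x
  have linS: "linear S"
    by (rule linearI) (simp_all add: S_def algebra_simps)
  have bijS: "bij S"
  proof (rule bij_betw_byWitness[where f'="\<lambda>x. (fst x - snd x, fst x + snd x)"])
    have half: "(1 / 2) *\<^sub>R y + (1 / 2) *\<^sub>R y = y" for y :: "real^3"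
      by (simp add: scaleR_add_left[symmetric])
    show "\<forall>a\<in>UNIV. (fst (S a) - snd (S a), fst (S a) + snd (S a)) = a"
      using half by (auto simp: S_def algebra_simps)
    show "\<forall>a'\<in>UNIV. S (fst a' - snd a', fst a' + snd a') = a'"
      using half by (auto simp: S_def algebra_simps)
  qed auto
  obtain k2 where k2: "k2 > 0"
    "\<And>f::(real^3) \<times> (real^3) \<Rightarrow> ennreal. f \<in> borel_measurable borel \<Longrightarrow>
      (\<integral>\<^sup>+x. f (S x) \<partial>lborel) = ennreal k2 * (\<integral>\<^sup>+y. f y \<partial>lborel)"
    using linear_iso_nn_integral[OF linS bijS] by metis
  have [measurable]: "S \<in> borel_measurable borel"
    unfolding S_def by measurable
  show ?thesis
  proof (rule that[of "k1 * k2"])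
    show "k1 * k2 > 0" using k1 k2 by simp
    fix f :: "(real^3) \<times> (real^3) \<Rightarrow> ennreal"
    assume [measurable]: "f \<in> borel_measurable borel"
    let ?v = "\<lambda>u s t m. fiber (A *v u) (B *v u) (s, t, m)"
    have "(\<integral>\<^sup>+z. f (pair_coords A B z) \<partial>lborel)
      = (\<integral>\<^sup>+u. \<integral>\<^sup>+s. \<integral>\<^sup>+t. \<integral>\<^sup>+m. f (S (u, ?v u s t m)) \<partial>lborel \<partial>lborel \<partial>lborel \<partial>lborel)"
    proof -
      have "(\<integral>\<^sup>+z. f (pair_coords A B z) \<partial>lborel) = (\<integral>\<^sup>+y. \<integral>\<^sup>+m. f (pair_coords A B (y, m)) \<partial>lborel \<partial>lborel)"
        by (rule nn_integral_lborel_pair) measurable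
      also have "\<dots> = (\<integral>\<^sup>+u. \<integral>\<^sup>+r. \<integral>\<^sup>+m. f (pair_coords A B ((u, r), m)) \<partial>lborel \<partial>lborel \<partial>lborel)"
        by (rule nn_integral_lborel_pair) measurable
      also have "\<dots> = (\<integral>\<^sup>+u. \<integral>\<^sup>+s. \<integral>\<^sup>+t. \<integral>\<^sup>+m. f (pair_coords A B ((u, (s, t)), m)) \<partial>lborel \<partial>lborel \<partial>lborel \<partial>lborel)"
        by (intro nn_integral_cong nn_integral_lborel_pair) measurable
      finally show ?thesis by (simp add: pair_coords_def S_def Let_def)
    qed
    also have "\<dots> = (\<integral>\<^sup>+u. \<integral>\<^sup>+z. f (S (u, fiber (A *v u) (B *v u) z)) \<partial>lborel \<partial>lborel)"
    proof (intro nn_integral_cong)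
      fix u :: "real^3"
      have "(\<integral>\<^sup>+z. f (S (u, fiber (A *v u) (B *v u) z)) \<partial>lborel)
        = (\<integral>\<^sup>+s. \<integral>\<^sup>+r. f (S (u, fiber (A *v u) (B *v u) (s, r))) \<partial>lborel \<partial>lborel)"
        by (rule nn_integral_lborel_pair) measurable
      also have "\<dots> = (\<integral>\<^sup>+s. \<integral>\<^sup>+t. \<integral>\<^sup>+m. f (S (u, ?v u s t m)) \<partial>lborel \<partial>lborel \<partial>lborel)"
        by (intro nn_integral_cong nn_integral_lborel_pair) measurable
      finally show "(\<integral>\<^sup>+s. \<integral>\<^sup>+t. \<integral>\<^sup>+m. f (S (u, ?v u s t m)) \<partial>lborel \<partial>lborel \<partial>lborel)
        = (\<integral>\<^sup>+z. f (S (u, fiber (A *v u) (B *v u) z)) \<partial>lborel)" ..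
    qed
    also have "\<dots> = (\<integral>\<^sup>+u. ennreal k1 * (\<integral>\<^sup>+v. f (S (u, v)) \<partial>lborel) \<partial>lborel)"
    proof (rule nn_integral_cong_AE, use w in eventually_elim)
      fix u assume "cross_map A B u \<noteq> 0"
      then show "(\<integral>\<^sup>+z. f (S (u, fiber (A *v u) (B *v u) z)) \<partial>lborel) = ennreal k1 * (\<integral>\<^sup>+v. f (S (u, v)) \<partial>lborel)"
        unfolding cross_map_def by (intro k1(2)[where f="\<lambda>v. f (S (u, v))"]) auto
    qed
    also have "\<dots> = ennreal k1 * (\<integral>\<^sup>+u. \<integral>\<^sup>+v. f (S (u, v)) \<partial>lborel \<partial>lborel)"
      by (rule nn_integral_cmult) measurable
    also have "(\<integral>\<^sup>+u. \<integral>\<^sup>+v. f (S (u, v)) \<partial>lborel \<partial>lborel) = (\<integral>\<^sup>+x. f (S x) \<partial>lborel)"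
      by (rule nn_integral_lborel_pair[symmetric]) measurable
    also have "\<dots> = ennreal k2 * (\<integral>\<^sup>+y. f y \<partial>lborel)"
      by (rule k2(2)) measurable
    finally show "(\<integral>\<^sup>+z. f (pair_coords A B z) \<partial>lborel) = ennreal (k1 * k2) * (\<integral>\<^sup>+x. f x \<partial>lborel)"
      using k1(1) k2(1) by (simp add: ennreal_mult mult.assoc)
  qed
qed

lemma surface_param_measurable [measurable (raw)]:
  assumes [measurable]: "f \<in> borel_measurable M"
  shows "(\<lambda>x. surface_param A B (f x)) \<in> borel_measurable M"
  unfolding surface_param_def quad_form_def by measurable

text \<open>Integrating g(\<xi>) cnj g(\<eta>) along the fibres gives a function \<open>h\<close> on
  the five-dimensional space whose Fourier transform is \<open>k\<close> times the squared modulus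
  of the extension. Squaring \<open>h\<close> brings in a second point on the same fibre; the two
  pairs (\<xi>, \<eta>) together are the four vertices in \<open>Lambda\<close>.\<close>

lemma L4_le_Lambda:
  assumes sym: "transpose A = A" "transpose B = B" and w: "AE u in lborel. cross_map A B u \<noteq> 0"
  obtains C :: real where "C > 0"
    and "\<And>g. integrable lborel g \<Longrightarrow>
      (\<integral>\<^sup>+x. ennreal (cmod (\<integral>\<xi>. exp (\<i> * complex_of_real (x \<bullet> surface_param A B \<xi>)) * g \<xi> \<partial>lborel) ^ 4) \<partial>lborel)
        \<le> ennreal C * Lambda (cross_map A B) (\<lambda>x. ennreal (cmod (g x)))"
proof -
  obtain k where k: "k > 0" "\<And>f. f \<in> borel_measurable borel \<Longrightarrow>
      (\<integral>\<^sup>+z. f (pair_coords A B z) \<partial>lborel) = ennreal k * (\<integral>\<^sup>+x. f x \<partial>lborel)"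
    by (rule nn_integral_pair_coords[OF w that])
  obtain C where C: "C > 0" "\<And>h::(real^3) \<times> real \<times> real \<Rightarrow> complex. integrable lborel h \<Longrightarrow>
      (\<integral>\<^sup>+x. ennreal ((cmod (\<integral>z. exp (\<i> * complex_of_real (x \<bullet> z)) * h z \<partial>lborel))\<^sup>2) \<partial>lborel)
        \<le> ennreal C * (\<integral>\<^sup>+z. ennreal ((cmod (h z))\<^sup>2) \<partial>lborel)"
    by (rule bessel_inequality[OF that])
  define \<Theta> where "\<Theta> = pair_coords A B"
  have \<Theta>m [measurable]: "\<Theta> \<in> borel_measurable borel"
    unfolding \<Theta>_def using pair_coords_measurable[of "\<lambda>x. x" borel] by simp
  \<comment> \<open>As an identity of measures the change of variables also serves Bochner
    integrals.\<close>
  have distr: "distr lborel borel \<Theta> = density lborel (\<lambda>_. ennreal k)"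
  proof (rule measure_eqI)
    fix X assume "X \<in> sets (distr lborel borel \<Theta>)"
    then have [measurable]: "X \<in> sets borel" by simp
    have "emeasure (distr lborel borel \<Theta>) X = (\<integral>\<^sup>+z. indicator X (\<Theta> z) \<partial>lborel)"
      using nn_integral_distr[of \<Theta> lborel borel "indicator X"] by simp
    also have "\<dots> = ennreal k * (\<integral>\<^sup>+x. indicator X x \<partial>lborel)"
      unfolding \<Theta>_def by (rule k(2)) measurable
    finally show "emeasure (distr lborel borel \<Theta>) X = emeasure (density lborel (\<lambda>_. ennreal k)) X"
      by (simp add: emeasure_density nn_integral_cmult)
  qed simp
  have int\<Theta>: "integrable lborel (\<lambda>z. f (\<Theta> z))" "(\<integral>z. f (\<Theta> z) \<partial>lborel) = k *\<^sub>R (\<integral>x. f x \<partial>lborel)"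
    if f: "integrable lborel f" for f :: "(real^3) \<times> (real^3) \<Rightarrow> complex"
  proof -
    have fm: "f \<in> borel_measurable borel" using borel_measurable_integrable[OF f] by simp
    have "integrable (distr lborel borel \<Theta>) f"
      unfolding distr using k(1) f fm by (subst integrable_density) auto
    then show "integrable lborel (\<lambda>z. f (\<Theta> z))"
      by (subst (asm) integrable_distr_eq) (use fm in auto)
    have "(\<integral>z. f (\<Theta> z) \<partial>lborel) = integral\<^sup>L (distr lborel borel \<Theta>) f"
      using fm by (subst integral_distr) auto
    also have "\<dots> = k *\<^sub>R (\<integral>x. f x \<partial>lborel)"
      unfolding distr using k(1) fm by (subst integral_density) auto
    finally show "(\<integral>z. f (\<Theta> z) \<partial>lborel) = k *\<^sub>R (\<integral>x. f x \<partial>lborel)" .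
  qed
  have good: "AE z in (lborel :: ((real^3) \<times> real \<times> real) measure). cross_map A B (fst z) \<noteq> 0"
  proof -
    have "AE z in (lborel :: (real^3) measure) \<Otimes>\<^sub>M (lborel :: (real \<times> real) measure). cross_map A B (fst z) \<noteq> 0"
    proof (rule lborel_pair.AE_pair_measure)
      show "{z \<in> space (lborel \<Otimes>\<^sub>M lborel). cross_map A B (fst z) \<noteq> 0} \<in> sets (lborel \<Otimes>\<^sub>M lborel)"
        by measurable
      show "AE x in lborel. AE y in lborel. cross_map A B (fst (x, y)) \<noteq> 0"
        using w by eventually_elim simp
    qed
    then show ?thesis unfolding lborel_prod .
  qed
  have main: "(\<integral>\<^sup>+x. ennreal (cmod (\<integral>\<xi>. exp (\<i> * complex_of_real (x \<bullet> surface_param A B \<xi>)) * g \<xi> \<partial>lborel) ^ 4) \<partial>lborel)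
        \<le> ennreal (2 * C / k) * Lambda (cross_map A B) (\<lambda>x. ennreal (cmod (g x)))"
    if g: "integrable lborel g" for g
  proof -
    have gm [measurable]: "g \<in> borel_measurable borel" using borel_measurable_integrable[OF g] by simp
    define G where "G x = g (fst x) * cnj (g (snd x))" for x
    have Gm [measurable]: "G \<in> borel_measurable borel" unfolding G_def by measurable
    have Gint: "integrable lborel G" unfolding G_def by (rule integrable_tensor_cnj[OF g])
    define h where "h y = (\<integral>m. G (\<Theta> (y, m)) \<partial>lborel)" for y
    have hint: "integrable lborel h"
      unfolding h_def by (rule integral_lborel_pair(4)[OF int\<Theta>(1)[OF Gint]])
    define E where "E x = (\<integral>\<xi>. exp (\<i> * complex_of_real (x \<bullet> surface_param A B \<xi>)) * g \<xi> \<partial>lborel)" for x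
    define H where "H x = (\<integral>y. exp (\<i> * complex_of_real (x \<bullet> y)) * h y \<partial>lborel)" for x
    have EH: "k * (cmod (E x))\<^sup>2 = cmod (H x)" for x
    proof -
      let ?e = "\<lambda>\<xi>. exp (\<i> * complex_of_real (x \<bullet> surface_param A B \<xi>))"
      let ?P = "\<lambda>z. (?e (fst z) * g (fst z)) * cnj (?e (snd z) * g (snd z))"
      have eg: "integrable lborel (\<lambda>\<xi>. ?e \<xi> * g \<xi>)"
        by (rule Bochner_Integration.integrable_bound[OF g]) (auto simp: norm_mult)
      have "complex_of_real (k * (cmod (E x))\<^sup>2) = k *\<^sub>R (\<integral>z. ?P z \<partial>lborel)"
        unfolding E_def norm_integral_square[OF eg, symmetric] by (simp add: scaleR_conv_of_real)
      also have "\<dots> = (\<integral>z. ?P (\<Theta> z) \<partial>lborel)"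
        by (rule int\<Theta>(2)[symmetric, OF integrable_tensor_cnj[OF eg]])
      also have "\<dots> = (\<integral>y. \<integral>m. ?P (\<Theta> (y, m)) \<partial>lborel \<partial>lborel)"
        by (rule integral_lborel_pair(1)[OF int\<Theta>(1)[OF integrable_tensor_cnj[OF eg]]])
      also have "\<dots> = H x"
        unfolding H_def
      proof (rule integral_cong_AE)
        show "AE y in lborel. (\<integral>m. ?P (\<Theta> (y, m)) \<partial>lborel) = exp (\<i> * complex_of_real (x \<bullet> y)) * h y"
          using good
        proof eventually_elim
          fix y :: "(real^3) \<times> real \<times> real" assume y: "cross_map A B (fst y) \<noteq> 0"
          have "?P (\<Theta> (y, m)) = exp (\<i> * complex_of_real (x \<bullet> y)) * G (\<Theta> (y, m))" for m
          proof -
            have "surface_param A B (fst (\<Theta> (y, m))) - surface_param A B (snd (\<Theta> (y, m))) = y"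
              using surface_param_pair_coords[OF sym, of "(y, m)"] y by (simp add: \<Theta>_def)
            then have "?e (fst (\<Theta> (y, m))) * cnj (?e (snd (\<Theta> (y, m)))) = exp (\<i> * complex_of_real (x \<bullet> y))"
              by (auto simp: exp_cnj mult_exp_exp right_diff_distrib[symmetric] of_real_diff[symmetric]
                  inner_diff_right[symmetric] simp del: of_real_diff)
            then show ?thesis by (simp add: G_def mult_ac)
          qed
          then show "(\<integral>m. ?P (\<Theta> (y, m)) \<partial>lborel) = exp (\<i> * complex_of_real (x \<bullet> y)) * h y"
            by (simp add: h_def)
        qed
        show "(\<lambda>y. \<integral>m. ?P (\<Theta> (y, m)) \<partial>lborel) \<in> borel_measurable lborel"
          by measurable
        show "(\<lambda>y. exp (\<i> * complex_of_real (x \<bullet> y)) * h y) \<in> borel_measurable lborel"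
          unfolding h_def by measurable
      qed
      finally have "cmod (complex_of_real (k * (cmod (E x))\<^sup>2)) = cmod (H x)" by simp
      then show ?thesis using k(1) by (simp add: norm_mult norm_power)
    qed
    let ?f = "\<lambda>x. ennreal (cmod (g x))"
    define \<psi> where "\<psi> x = (\<integral>\<^sup>+n. ?f (fst x) * ?f (snd x) * (?f (fst x + (n / 2) *\<^sub>R cross_map A B (fst x - snd x))
      * ?f (snd x + (n / 2) *\<^sub>R cross_map A B (fst x - snd x))) \<partial>lborel)" for x
    have \<psi>m [measurable]: "\<psi> \<in> borel_measurable borel" unfolding \<psi>_def by measurable
    have "ennreal (k\<^sup>2) * (\<integral>\<^sup>+x. ennreal (cmod (E x) ^ 4) \<partial>lborel) = (\<integral>\<^sup>+x. ennreal ((cmod (H x))\<^sup>2) \<partial>lborel)"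
    proof -
      have [measurable]: "E \<in> borel_measurable borel" unfolding E_def by measurable
      have "(cmod (H x))\<^sup>2 = k\<^sup>2 * cmod (E x) ^ 4" for x
        unfolding EH[symmetric] by (simp add: power_mult_distrib power_mult[symmetric])
      then show ?thesis
        by (simp add: nn_integral_cmult[symmetric] ennreal_mult)
    qed
    also have "\<dots> \<le> ennreal C * (\<integral>\<^sup>+y. ennreal ((cmod (h y))\<^sup>2) \<partial>lborel)"
      unfolding H_def by (rule C(2)[OF hint])
    also have "(\<integral>\<^sup>+y. ennreal ((cmod (h y))\<^sup>2) \<partial>lborel) \<le> (\<integral>\<^sup>+y. \<integral>\<^sup>+m. \<psi> (\<Theta> (y, m)) \<partial>lborel \<partial>lborel)"
    proof (rule nn_integral_mono_AE, use integral_lborel_pair(3)[OF int\<Theta>(1)[OF Gint]] in eventually_elim)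
      fix y :: "(real^3) \<times> real \<times> real"
      assume i: "integrable lborel (\<lambda>m. G (\<Theta> (y, m)))"
      let ?N = "\<lambda>m. ennreal (cmod (G (\<Theta> (y, m))))"
      have "ennreal (cmod (h y)) \<le> (\<integral>\<^sup>+m. ?N m \<partial>lborel)"
        unfolding h_def by (rule integral_norm_bound_ennreal[OF i])
      then have "ennreal ((cmod (h y))\<^sup>2) \<le> (\<integral>\<^sup>+m. ?N m \<partial>lborel) * (\<integral>\<^sup>+m. ?N m \<partial>lborel)"
        by (simp add: power2_eq_square ennreal_mult mult_mono)
      \<comment> \<open>The second copy of the fibre variable is translated by \<open>m\<close>, so
        that \<open>n\<close> becomes the displacement between the two points of the fibre.\<close>
      also have "\<dots> = (\<integral>\<^sup>+m. \<integral>\<^sup>+n. ?N m * ?N (m + n) \<partial>lborel \<partial>lborel)"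
      proof -
        have "(\<integral>\<^sup>+n. ?N m * ?N (m + n) \<partial>lborel) = ?N m * (\<integral>\<^sup>+n. ?N n \<partial>lborel)" for m
        proof -
          have "(\<integral>\<^sup>+n. ?N (m + n) \<partial>lborel) = (\<integral>\<^sup>+n. ?N n \<partial>lborel)"
            by (rule nn_integral_lborel_shift) measurable
          then show ?thesis by (simp add: nn_integral_cmult)
        qed
        then show ?thesis by (simp add: nn_integral_multc)
      qed
      also have "\<dots> = (\<integral>\<^sup>+m. \<psi> (\<Theta> (y, m)) \<partial>lborel)"
      proof -
        have "?N m * ?N (m + n) = ?f (fst (\<Theta> (y, m))) * ?f (snd (\<Theta> (y, m)))
          * (?f (fst (\<Theta> (y, m)) + (n / 2) *\<^sub>R cross_map A B (fst (\<Theta> (y, m)) - snd (\<Theta> (y, m))))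
           * ?f (snd (\<Theta> (y, m)) + (n / 2) *\<^sub>R cross_map A B (fst (\<Theta> (y, m)) - snd (\<Theta> (y, m)))))" for m n
        proof -
          have d: "fst (\<Theta> (y, m)) - snd (\<Theta> (y, m)) = fst y"
            using pair_coords_diff[of A B "(y, m)"] by (simp add: \<Theta>_def)
          \<comment> \<open>Displacement by \<open>n\<close> adds n w(u) to the sum of the pair and
            leaves the difference fixed, so each member moves by half of it.\<close>
          have "fst (\<Theta> (y, m + n)) = fst (\<Theta> (y, m)) + (n / 2) *\<^sub>R cross_map A B (fst y)"
            "snd (\<Theta> (y, m + n)) = snd (\<Theta> (y, m)) + (n / 2) *\<^sub>R cross_map A B (fst y)"
            by (simp_all add: \<Theta>_def pair_coords_def Let_def fiber_add cross_map_def algebra_simps)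
          then show ?thesis by (simp add: d G_def norm_mult ennreal_mult)
        qed
        then show ?thesis unfolding \<psi>_def by simp
      qed
      finally show "ennreal ((cmod (h y))\<^sup>2) \<le> (\<integral>\<^sup>+m. \<psi> (\<Theta> (y, m)) \<partial>lborel)" .
    qed
    also have "(\<integral>\<^sup>+y. \<integral>\<^sup>+m. \<psi> (\<Theta> (y, m)) \<partial>lborel \<partial>lborel) = (\<integral>\<^sup>+z. \<psi> (\<Theta> z) \<partial>lborel)"
      by (rule nn_integral_lborel_pair[symmetric]) measurable
    also have "\<dots> = ennreal k * (\<integral>\<^sup>+x. \<psi> x \<partial>lborel)"
      unfolding \<Theta>_def by (rule k(2)) measurable
    also have "(\<integral>\<^sup>+x. \<psi> x \<partial>lborel) = ennreal 2 * Lambda (cross_map A B) ?f"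
    proof -
      let ?T = "\<lambda>m u a. ?f a * ?f (a + u) * ?f (a + m *\<^sub>R cross_map A B u) * ?f (a + u + m *\<^sub>R cross_map A B u)"
      have "(\<integral>\<^sup>+x. \<psi> x \<partial>lborel) = (\<integral>\<^sup>+\<xi>. \<integral>\<^sup>+a. \<psi> (\<xi>, a) \<partial>lborel \<partial>lborel)"
        by (rule nn_integral_lborel_pair) measurable
      also have "\<dots> = (\<integral>\<^sup>+a. \<integral>\<^sup>+\<xi>. \<psi> (\<xi>, a) \<partial>lborel \<partial>lborel)"
        by (rule nn_integral_lborel_swap) measurable
      also have "\<dots> = (\<integral>\<^sup>+a. \<integral>\<^sup>+u. \<psi> (a + u, a) \<partial>lborel \<partial>lborel)"
        by (intro nn_integral_cong nn_integral_lborel_shift[symmetric]) measurable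
      also have "\<dots> = (\<integral>\<^sup>+a. \<integral>\<^sup>+u. \<integral>\<^sup>+n. ?T (n / 2) u a \<partial>lborel \<partial>lborel \<partial>lborel)"
        unfolding \<psi>_def by (simp add: mult_ac)
      also have "\<dots> = (\<integral>\<^sup>+u. \<integral>\<^sup>+a. \<integral>\<^sup>+n. ?T (n / 2) u a \<partial>lborel \<partial>lborel \<partial>lborel)"
        by (rule nn_integral_lborel_swap) measurable
      also have "\<dots> = (\<integral>\<^sup>+u. \<integral>\<^sup>+n. \<integral>\<^sup>+a. ?T (n / 2) u a \<partial>lborel \<partial>lborel \<partial>lborel)"
        by (intro nn_integral_cong nn_integral_lborel_swap) measurable
      also have "\<dots> = (\<integral>\<^sup>+n. \<integral>\<^sup>+u. \<integral>\<^sup>+a. ?T (n / 2) u a \<partial>lborel \<partial>lborel \<partial>lborel)"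
        by (rule nn_integral_lborel_swap) measurable
      \<comment> \<open>The halves are absorbed by n = 2 m, at the cost of the factor 2.\<close>
      also have "\<dots> = ennreal 2 * (\<integral>\<^sup>+m. \<integral>\<^sup>+u. \<integral>\<^sup>+a. ?T m u a \<partial>lborel \<partial>lborel \<partial>lborel)"
      proof -
        have "(\<lambda>m. \<integral>\<^sup>+u. \<integral>\<^sup>+a. ?T m u a \<partial>lborel \<partial>lborel) \<in> borel_measurable borel" by measurable
        then have "(\<lambda>n. \<integral>\<^sup>+u. \<integral>\<^sup>+a. ?T (n / 2) u a \<partial>lborel \<partial>lborel) \<in> borel_measurable borel"
          by measurable
        from nn_integral_lborel_scaleR[OF this, of 2] show ?thesis by simp
      qed
      finally show ?thesis unfolding Lambda_def .
    qed
    finally have *: "ennreal (k\<^sup>2) * (\<integral>\<^sup>+x. ennreal (cmod (E x) ^ 4) \<partial>lborel)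
      \<le> ennreal C * (ennreal k * (ennreal 2 * Lambda (cross_map A B) ?f))"
      by (simp add: mult_left_mono)
    have "(\<integral>\<^sup>+x. ennreal (cmod (E x) ^ 4) \<partial>lborel) = ennreal (1 / k\<^sup>2) * (ennreal (k\<^sup>2) * (\<integral>\<^sup>+x. ennreal (cmod (E x) ^ 4) \<partial>lborel))"
      using k(1) by (simp add: mult.assoc[symmetric] ennreal_mult[symmetric])
    also have "\<dots> \<le> ennreal (1 / k\<^sup>2) * (ennreal C * (ennreal k * (ennreal 2 * Lambda (cross_map A B) ?f)))"
      by (rule mult_left_mono[OF *]) simp
    also have "\<dots> = ennreal (1 / k\<^sup>2 * C * k * 2) * Lambda (cross_map A B) ?f"
    proof -
      have "ennreal (1 / k\<^sup>2) * ennreal C * ennreal k * ennreal 2 = ennreal (1 / k\<^sup>2 * C * k * 2)"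
        using k(1) C(1) by (simp only: ennreal_mult[symmetric] zero_le_divide_1_iff zero_le_power2 less_imp_le mult_nonneg_nonneg zero_le_numeral)
      then show ?thesis by (simp only: mult.assoc[symmetric])
    qed
    also have "1 / k\<^sup>2 * C * k * 2 = 2 * C / k"
      using k(1) by (simp add: power2_eq_square)
    finally show ?thesis unfolding E_def .
  qed
  show ?thesis
    using k(1) C(1) by (intro that[of "2 * C / k"] main) auto
qed

section \<open>Integration over the fibre parameter\<close>

lemma nn_integral_powr_near_zero:
  fixes \<theta> L :: real
  assumes "\<theta> < 1" "L \<ge> 0"
  shows "(\<integral>\<^sup>+l. ennreal (\<bar>l\<bar> powr (- \<theta>)) * indicator {-L..L} l \<partial>lborel) < \<infinity>"
proof -
  let ?g = "\<lambda>l::real. ennreal (l powr (- \<theta>)) * indicator {0..L} l"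
  have "((\<lambda>x. x powr (- \<theta>)) has_integral (L powr (- \<theta> + 1) / (- \<theta> + 1))) {0..L}"
    using assms by (intro has_integral_powr_from_0) auto
  then have g: "(\<integral>\<^sup>+l. ?g l \<partial>lborel) < \<infinity>"
    by (subst nn_integral_has_integral_lebesgue') auto
  have "(\<integral>\<^sup>+l. ennreal (\<bar>l\<bar> powr (- \<theta>)) * indicator {-L..L} l \<partial>lborel)
    \<le> (\<integral>\<^sup>+l. (?g l + ?g (- l)) \<partial>lborel)"
    by (intro nn_integral_mono) (auto simp: indicator_def)
  also have "\<dots> = (\<integral>\<^sup>+l. ?g l \<partial>lborel) + (\<integral>\<^sup>+l. ?g (- l) \<partial>lborel)"
    by (rule nn_integral_add) measurable
  also have "(\<integral>\<^sup>+l. ?g (- l) \<partial>lborel) = (\<integral>\<^sup>+l. ?g l \<partial>lborel)"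
  proof -
    have "?g \<in> borel_measurable borel" by measurable
    from nn_integral_lborel_scaleR[OF this, of "-1"] show ?thesis by simp
  qed
  finally show ?thesis using g by (auto intro: le_less_trans)
qed

text \<open>\<open>Z\<close> is any positive bound for the integral of the p-th power rather than
  the integral itself, which includes functions vanishing almost everywhere. The exponent 4 / p
  reflects homogeneity of degree four in \<open>f\<close>.\<close>

definition Lambda_bounded :: "(real^3) set \<Rightarrow> real \<Rightarrow> (real^3 \<Rightarrow> real^3) \<Rightarrow> bool" where
  "Lambda_bounded K p w \<longleftrightarrow>
    (\<exists>C\<ge>0. \<forall>Z>0. \<forall>f. f \<in> borel_measurable borel \<longrightarrow> (\<forall>x. x \<notin> K \<longrightarrow> f x = 0) \<longrightarrow>
    (\<integral>\<^sup>+x. epow (f x) p \<partial>lborel) \<le> ennreal Z \<longrightarrow> Lambda w f \<le> ennreal (C * Z powr (4 / p)))"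

text \<open>At fixed \<open>u\<close> the variable l = m N(u) turns dm into \<open>W u\<close> dl
  and leaves a parallelogram form bounded by |l|^(-\<theta>). The hypothesis on \<open>B\<close>
  confines \<open>l\<close>: where the integrand is nonzero, both sides of the parallelogram are
  differences of points of the bounded preimage of \<open>K\<close>, so |l| is at most
  \<open>L\<close>.\<close>

lemma Lambda_le_of_parallelogram_bounded:
  fixes P :: "'m::euclidean_space \<Rightarrow> real^3" and N :: "'m \<Rightarrow> real"
  assumes p: "p > 0" and \<theta>: "\<theta> < 1" and T: "parallelogram_bounded p \<theta> R W"
    and P: "linear P" "bij P" and [measurable]: "N \<in> borel_measurable borel" "w \<in> borel_measurable borel"
    and N: "AE u in lborel. N u \<noteq> 0"
    and w: "\<And>u. N u \<noteq> 0 \<Longrightarrow> w (P u) = N u *\<^sub>R P (R u)"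
    and W: "\<And>u. N u \<noteq> 0 \<Longrightarrow> W u = ennreal (1 / \<bar>N u\<bar>)"
    and B: "B \<ge> 0" "\<And>u l. N u \<noteq> 0 \<Longrightarrow> \<bar>l\<bar> \<le> B * (norm u * norm (l *\<^sub>R R u))"
    and K: "bounded K"
  shows "Lambda_bounded K p w"
proof -
  have [measurable]: "R \<in> borel_measurable borel" "W \<in> borel_measurable borel"
    using T by (auto simp: parallelogram_bounded_def)
  have [measurable]: "P \<in> borel_measurable borel"
    using P(1) by (intro borel_measurable_continuous_onI) (simp add: linear_continuous_on linear_conv_bounded_linear)
  obtain k where k: "k > 0"
    "\<And>f::real^3 \<Rightarrow> ennreal. f \<in> borel_measurable borel \<Longrightarrow> (\<integral>\<^sup>+x. f (P x) \<partial>lborel) = ennreal k * (\<integral>\<^sup>+y. f y \<partial>lborel)"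
    using linear_iso_nn_integral[OF P] by metis
  obtain b where b: "b > 0" "\<And>x. b * norm x \<le> norm (P x)"
    using linear_inj_bounded_below_pos[OF P(1)] P(2) by (metis bij_is_inj mult.commute)
  obtain r where r: "r > 0" "\<And>x. x \<in> K \<Longrightarrow> norm x \<le> r"
    using K unfolding bounded_pos by blast
  obtain C1 where C1: "C1 > 0" "\<And>l f1 f2 f3 f4. l \<noteq> 0 \<Longrightarrow>
      (\<forall>f\<in>{f1, f2, f3, f4}. f \<in> borel_measurable borel \<and> (\<forall>x. f x > 0)) \<Longrightarrow>
      parallelogram_form R W l f1 f2 f3 f4 \<le> ennreal (C1 * \<bar>l\<bar> powr (- \<theta>)) * (enorm p f1 * enorm p f2 * enorm p f3 * enorm p f4)"
    using T unfolding parallelogram_bounded_def by blast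
  \<comment> \<open>Bounds the difference of two points whose images under \<open>P\<close> lie in
    \<open>K\<close>.\<close>
  define D where "D = 2 * r / b"
  have D: "D > 0" using r b by (simp add: D_def)
  define L where "L = B * (D * D)"
  have L: "L \<ge> 0" using B D by (simp add: L_def)
  obtain I where I: "I \<ge> 0" "(\<integral>\<^sup>+l. ennreal (\<bar>l\<bar> powr (- \<theta>)) * indicator {-L..L} l \<partial>lborel) = ennreal I"
    using nn_integral_powr_near_zero[OF \<theta> L]
    by (cases "\<integral>\<^sup>+l. ennreal (\<bar>l\<bar> powr (- \<theta>)) * indicator {-L..L} l \<partial>lborel") auto
  define C where "C = 1 / k\<^sup>2 * (C1 * I * (k + 1) powr (4 / p))"
  show ?thesis
    unfolding Lambda_bounded_def
  proof (intro exI[of _ C] conjI allI impI)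
    show "0 \<le> C" using k C1 I by (simp add: C_def)
    fix Z :: real and f :: "real^3 \<Rightarrow> ennreal"
    assume Z: "Z > 0" and [measurable]: "f \<in> borel_measurable borel"
      and supp: "\<forall>x. x \<notin> K \<longrightarrow> f x = 0" and fZ: "(\<integral>\<^sup>+x. epow (f x) p \<partial>lborel) \<le> ennreal Z"
    define g where "g x = f (P x)" for x
    have [measurable]: "g \<in> borel_measurable borel" unfolding g_def by measurable
    let ?T = "\<lambda>m u a. f a * f (a + u) * f (a + m *\<^sub>R w u) * f (a + u + m *\<^sub>R w u)"
    let ?S = "\<lambda>l u a. g a * g (a + u) * g (a + l *\<^sub>R R u) * g (a + u + l *\<^sub>R R u)"
    have "ennreal (k\<^sup>2) * Lambda w f = (\<integral>\<^sup>+m. \<integral>\<^sup>+u. \<integral>\<^sup>+a. ?T m (P u) (P a) \<partial>lborel \<partial>lborel \<partial>lborel)"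
    proof -
      have 1: "(\<integral>\<^sup>+a. ?T m u (P a) \<partial>lborel) = ennreal k * (\<integral>\<^sup>+a. ?T m u a \<partial>lborel)" for m u
        by (rule k(2)) measurable
      have 2: "(\<integral>\<^sup>+u. (\<integral>\<^sup>+a. ?T m (P u) a \<partial>lborel) \<partial>lborel) = ennreal k * (\<integral>\<^sup>+u. \<integral>\<^sup>+a. ?T m u a \<partial>lborel \<partial>lborel)" for m
        by (rule k(2)) measurable
      have "(\<integral>\<^sup>+m. \<integral>\<^sup>+u. \<integral>\<^sup>+a. ?T m (P u) (P a) \<partial>lborel \<partial>lborel \<partial>lborel) = ennreal k * (ennreal k * Lambda w f)"
        unfolding 1 Lambda_def by (simp add: nn_integral_cmult 2)
      then show ?thesis using k(1) by (simp add: power2_eq_square ennreal_mult mult.assoc)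
    qed
    also have "\<dots> = (\<integral>\<^sup>+u. \<integral>\<^sup>+m. \<integral>\<^sup>+a. ?T m (P u) (P a) \<partial>lborel \<partial>lborel \<partial>lborel)"
      by (rule nn_integral_lborel_swap) measurable
    also have "\<dots> = (\<integral>\<^sup>+u. \<integral>\<^sup>+l. \<integral>\<^sup>+a. ?S l u a * W u \<partial>lborel \<partial>lborel \<partial>lborel)"
    proof (rule nn_integral_cong_AE, use N in eventually_elim)
      fix u assume u: "N u \<noteq> 0"
      define h where "h l = (\<integral>\<^sup>+a. ?S l u a \<partial>lborel)" for l
      have [measurable]: "h \<in> borel_measurable borel" unfolding h_def by measurable
      have hm: "(\<integral>\<^sup>+a. ?T m (P u) (P a) \<partial>lborel) = h (N u *\<^sub>R m)" for m
      proof -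
        have "m *\<^sub>R w (P u) = P ((N u *\<^sub>R m) *\<^sub>R R u)"
          using P(1) by (simp add: w[OF u] linear_cmul mult.commute)
        then show ?thesis
          unfolding h_def g_def using P(1) by (simp only: linear_add)
      qed
      have "(\<integral>\<^sup>+m. \<integral>\<^sup>+a. ?T m (P u) (P a) \<partial>lborel \<partial>lborel) = (\<integral>\<^sup>+m. h (N u *\<^sub>R m) \<partial>lborel)"
        by (simp only: hm)
      also have "\<dots> = (ennreal (1 / \<bar>N u\<bar>) * ennreal \<bar>N u\<bar>) * (\<integral>\<^sup>+m. h (N u *\<^sub>R m) \<partial>lborel)"
        using u by (simp add: ennreal_mult[symmetric])
      also have "\<dots> = ennreal (1 / \<bar>N u\<bar>) * (\<integral>\<^sup>+l. h l \<partial>lborel)"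
        using nn_integral_lborel_scaleR[of h "N u"] u by (simp add: mult.assoc)
      also have "\<dots> = (\<integral>\<^sup>+l. h l * W u \<partial>lborel)"
        using W[OF u] by (simp add: nn_integral_multc mult.commute)
      also have "\<dots> = (\<integral>\<^sup>+l. \<integral>\<^sup>+a. ?S l u a * W u \<partial>lborel \<partial>lborel)"
        unfolding h_def by (simp add: nn_integral_multc)
      finally show "(\<integral>\<^sup>+m. \<integral>\<^sup>+a. ?T m (P u) (P a) \<partial>lborel \<partial>lborel) = (\<integral>\<^sup>+l. \<integral>\<^sup>+a. ?S l u a * W u \<partial>lborel \<partial>lborel)" .
    qed
    also have "\<dots> = (\<integral>\<^sup>+l. \<integral>\<^sup>+u. \<integral>\<^sup>+a. ?S l u a * W u \<partial>lborel \<partial>lborel \<partial>lborel)"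
      by (rule nn_integral_lborel_swap) measurable
    also have "\<dots> = (\<integral>\<^sup>+l. parallelogram_form R W l g g g g \<partial>lborel)"
      by (simp add: parallelogram_form_def)
    also have "\<dots> \<le> (\<integral>\<^sup>+l. ennreal (C1 * ((k + 1) * Z) powr (4 / p)) * (ennreal (\<bar>l\<bar> powr (- \<theta>)) * indicator {-L..L} l) \<partial>lborel)"
    proof (rule nn_integral_mono_AE, use AE_lborel_nonzero in eventually_elim)
      fix l :: real assume l: "l \<noteq> 0"
      show "parallelogram_form R W l g g g g \<le> ennreal (C1 * ((k + 1) * Z) powr (4 / p)) * (ennreal (\<bar>l\<bar> powr (- \<theta>)) * indicator {-L..L} l)"
      proof (cases "\<bar>l\<bar> \<le> L")
        case False
        have "parallelogram_form R W l g g g g = (\<integral>\<^sup>+u. 0 \<partial>(lborel :: 'm measure))"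
          unfolding parallelogram_form_def
        proof (rule nn_integral_cong_AE, use N in eventually_elim)
          fix u assume u: "N u \<noteq> 0"
          have dist: "norm v \<le> D" if "g a \<noteq> 0" "g (a + v) \<noteq> 0" for a v
          proof -
            have "P a \<in> K" "P (a + v) \<in> K" using that supp by (auto simp: g_def)
            then have "norm (P (a + v) - P a) \<le> r + r"
              using r(2) norm_triangle_ineq4[of "P (a + v)" "P a"] by (meson add_mono order_trans)
            then have "norm (P v) \<le> 2 * r" using P(1) by (simp add: linear_add)
            with b(2)[of v] have "b * norm v \<le> 2 * r" by linarith
            then show ?thesis using b(1) by (simp add: D_def field_simps)
          qed
          have S0: "?S l u a = 0" for a
          proof (rule ccontr)
            assume "?S l u a \<noteq> 0"
            then have "norm u \<le> D" "norm (l *\<^sub>R R u) \<le> D"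
              using dist[of a u] dist[of a "l *\<^sub>R R u"] by auto
            then have "norm u * norm (l *\<^sub>R R u) \<le> D * D"
              using D by (intro mult_mono) auto
            then have "\<bar>l\<bar> \<le> L"
              using B(2)[OF u, of l] B(1) mult_left_mono[of _ "D * D" B] unfolding L_def by (meson order_trans)
            with False show False by simp
          qed
          show "(\<integral>\<^sup>+a. ?S l u a * W u \<partial>lborel) = 0" by (simp only: S0) simp
        qed
        then show ?thesis by simp
      next
        case True
        \<comment> \<open>The form bound is stated for positive functions, whereas \<open>g\<close>
          vanishes off the preimage of \<open>K\<close>. The maximum with the p-th root of a
          Gaussian of total mass \<open>Z\<close> is positive and raises the integral of the p-th
          power by at most \<open>Z\<close>, whence the factor (k + 1) Z.\<close>
        define e where "e x = epow (ennreal (Z * std_gauss x)) (1 / p)" for x :: 'm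
        define g' where "g' x = max (g x) (e x)" for x
        have em [measurable]: "e \<in> borel_measurable borel" unfolding e_def by measurable
        have g'm [measurable]: "g' \<in> borel_measurable borel" unfolding g'_def by measurable
        have epos: "e x > 0" for x
          unfolding e_def using Z std_gauss_pos[of x] by (intro epow_pos) (simp add: ennreal_less_zero_iff)
        then have g'pos: "g' x > 0" for x unfolding g'_def by (simp add: less_max_iff_disj)
        have "(\<integral>\<^sup>+x. epow (g' x) p \<partial>lborel) \<le> (\<integral>\<^sup>+x. (epow (g x) p + ennreal Z * ennreal (std_gauss x)) \<partial>lborel)"
        proof (rule nn_integral_mono)
          fix x :: 'm
          have "epow (e x) p = ennreal Z * ennreal (std_gauss x)"
            using p Z std_gauss_nonneg[of x] by (simp add: e_def epow_epow ennreal_mult)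
          then show "epow (g' x) p \<le> epow (g x) p + ennreal Z * ennreal (std_gauss x)"
            by (auto simp: g'_def max_def)
        qed
        also have "\<dots> = (\<integral>\<^sup>+x. epow (g x) p \<partial>lborel) + ennreal Z"
          by (simp add: nn_integral_add nn_integral_cmult nn_integral_std_gauss)
        also have "(\<integral>\<^sup>+x. epow (g x) p \<partial>lborel) = ennreal k * (\<integral>\<^sup>+x. epow (f x) p \<partial>lborel)"
          unfolding g_def by (rule k(2)) measurable
        also have "\<dots> \<le> ennreal k * ennreal Z" by (intro mult_left_mono fZ) simp
        also have "ennreal k * ennreal Z + ennreal Z = ennreal ((k + 1) * Z)"
          using k(1) Z by (simp add: ennreal_mult[symmetric] ennreal_plus[symmetric] algebra_simps del: ennreal_plus)
        finally have "(\<integral>\<^sup>+x. epow (g' x) p \<partial>lborel) \<le> ennreal ((k + 1) * Z)" by simp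
        then have "enorm p g' \<le> epow (ennreal ((k + 1) * Z)) (1 / p)"
          unfolding enorm_def using p by (intro epow_mono) auto
        then have en: "enorm p g' \<le> ennreal (((k + 1) * Z) powr (1 / p))"
          using k(1) Z by (simp add: epow_ennreal)
        have "parallelogram_form R W l g g g g \<le> parallelogram_form R W l g' g' g' g'"
          unfolding parallelogram_form_def g'_def by (intro nn_integral_mono mult_mono) auto
        also have "\<dots> \<le> ennreal (C1 * \<bar>l\<bar> powr (- \<theta>)) * (enorm p g' * enorm p g' * enorm p g' * enorm p g')"
          using g'pos by (intro C1(2) l) auto
        also have "\<dots> \<le> ennreal (C1 * \<bar>l\<bar> powr (- \<theta>)) * (ennreal (((k + 1) * Z) powr (1 / p)) * ennreal (((k + 1) * Z) powr (1 / p))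
            * ennreal (((k + 1) * Z) powr (1 / p)) * ennreal (((k + 1) * Z) powr (1 / p)))"
          by (intro mult_left_mono mult_mono en) auto
        also have "\<dots> = ennreal (C1 * \<bar>l\<bar> powr (- \<theta>)) * ennreal (((k + 1) * Z) powr (4 / p))"
          by (simp add: ennreal_mult[symmetric] powr_add[symmetric])
        also have "\<dots> = ennreal (C1 * ((k + 1) * Z) powr (4 / p)) * (ennreal (\<bar>l\<bar> powr (- \<theta>)) * indicator {-L..L} l)"
          using True C1(1) by (auto simp: ennreal_mult[symmetric] indicator_def mult_ac abs_le_iff)
        finally show ?thesis .
      qed
    qed
    also have "\<dots> = ennreal (C1 * ((k + 1) * Z) powr (4 / p)) * ennreal I"
      unfolding I(2)[symmetric] by (rule nn_integral_cmult) measurable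
    also have "\<dots> = ennreal (k\<^sup>2) * ennreal (C * Z powr (4 / p))"
      using k(1) C1(1) I(1) Z by (simp add: ennreal_mult[symmetric] C_def powr_mult)
    finally have *: "ennreal (k\<^sup>2) * Lambda w f \<le> ennreal (k\<^sup>2) * ennreal (C * Z powr (4 / p))" .
    have "ennreal (1 / k\<^sup>2) * ennreal (k\<^sup>2) = 1"
      using k(1) by (simp add: ennreal_mult[symmetric])
    then show "Lambda w f \<le> ennreal (C * Z powr (4 / p))"
      using mult_left_mono[OF *, of "ennreal (1 / k\<^sup>2)"] by (simp add: mult.assoc[symmetric])
  qed
qed

section \<open>Normal forms of pencils of quadratic forms\<close>

text \<open>The zero form is excluded as well, through vanishing coefficients. Real factors suffice:
  a repeated nonreal root of a nonzero real binary cubic would bring its repeated conjugate and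
  force degree four.\<close>

definition square_free_pencil :: "real^3^3 \<Rightarrow> real^3^3 \<Rightarrow> bool" where
  "square_free_pencil A B \<longleftrightarrow>
    (\<nexists>a b c d. \<forall>x y. det (x *\<^sub>R A + y *\<^sub>R B) = (a * x + b * y)\<^sup>2 * (c * x + d * y))"

text \<open>Real roots of the determinant of the pencil give a common diagonal basis, complex roots a basis
  in which both forms are real parts of multiples of the complex square.\<close>

lemma binary_pencil_basis:
  fixes a22 a23 a33 b22 b23 b33 :: real
  defines "q0 \<equiv> a22 * a33 - a23\<^sup>2" and "q1 \<equiv> a22 * b33 + a33 * b22 - 2 * a23 * b23"
    and "q2 \<equiv> b22 * b33 - b23\<^sup>2"
  defines "fa \<equiv> \<lambda>s t s' t'. a22 * s * s' + a23 * (s * t' + t * s') + a33 * t * t'"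
    and "fb \<equiv> \<lambda>s t s' t'. b22 * s * s' + b23 * (s * t' + t * s') + b33 * t * t'"
  assumes q2: "q2 \<noteq> 0" and disc: "q1\<^sup>2 - 4 * q0 * q2 \<noteq> 0"
  obtains s t s' t' where "s * t' - s' * t \<noteq> 0"
    and "fa s t s' t' = 0 \<and> fb s t s' t' = 0 \<or>
      fa s t s t + fa s' t' s' t' = 0 \<and> fb s t s t + fb s' t' s' t' = 0"
proof (cases "q1\<^sup>2 - 4 * q0 * q2 > 0")
  case True
  define r where "r = sqrt (q1\<^sup>2 - 4 * q0 * q2)"
  have r: "r > 0" "r\<^sup>2 = q1\<^sup>2 - 4 * q0 * q2" using True by (auto simp: r_def)
  \<comment> \<open>A singular symmetric 2 by 2 matrix annihilates the vector formed by its negated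
    off-diagonal entry and its upper left entry; if both vanish, it annihilates the first basis
    vector.\<close>
  have ker: "\<exists>s t. (s \<noteq> 0 \<or> t \<noteq> 0) \<and> (a22 + l * b22) * s + (a23 + l * b23) * t = 0
      \<and> (a23 + l * b23) * s + (a33 + l * b33) * t = 0"
    if "q0 + q1 * l + q2 * l\<^sup>2 = 0" for l
  proof -
    have d: "(a22 + l * b22) * (a33 + l * b33) = (a23 + l * b23)\<^sup>2"
      using that unfolding q0_def q1_def q2_def by (simp add: algebra_simps power2_eq_square)
    show ?thesis
    proof (cases "a22 + l * b22 = 0 \<and> a23 + l * b23 = 0")
      case True
      then show ?thesis by (intro exI[of _ 1] exI[of _ 0]) simp
    next
      case False
      then show ?thesis
        using d by (intro exI[of _ "- (a23 + l * b23)"] exI[of _ "a22 + l * b22"]) (auto simp: power2_eq_square algebra_simps)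
    qed
  qed
  define l where "l = (- q1 + r) / (2 * q2)"
  define l' where "l' = (- q1 - r) / (2 * q2)"
  have "l - l' = r / q2" using q2 by (simp add: l_def l'_def field_simps)
  then have ll: "l \<noteq> l'" using r q2 by auto
  have root: "q0 + q1 * ((- q1 + e) / (2 * q2)) + q2 * ((- q1 + e) / (2 * q2))\<^sup>2 = 0"
    if e: "e\<^sup>2 = q1\<^sup>2 - 4 * q0 * q2" for e
  proof -
    have "4 * q2 * (q0 + q1 * ((- q1 + e) / (2 * q2)) + q2 * ((- q1 + e) / (2 * q2))\<^sup>2)
      = 4 * q0 * q2 + 2 * q1 * (- q1 + e) + (- q1 + e)\<^sup>2"
      using q2 by (simp add: field_simps power2_eq_square)
    also have "\<dots> = 4 * q0 * q2 - q1\<^sup>2 + e\<^sup>2"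
      by (simp add: power2_eq_square algebra_simps)
    also have "\<dots> = 0" using e by simp
    finally show ?thesis using q2 by simp
  qed
  obtain s t where st: "s \<noteq> 0 \<or> t \<noteq> 0" "(a22 + l * b22) * s + (a23 + l * b23) * t = 0"
      "(a23 + l * b23) * s + (a33 + l * b33) * t = 0"
    using ker[of l] root[of r] r(2) unfolding l_def by auto
  obtain s' t' where st': "s' \<noteq> 0 \<or> t' \<noteq> 0" "(a22 + l' * b22) * s' + (a23 + l' * b23) * t' = 0"
      "(a23 + l' * b23) * s' + (a33 + l' * b33) * t' = 0"
    using ker[of l'] root[of "- r"] r(2) unfolding l'_def by auto
  \<comment> \<open>A kernel vector of a + l b is orthogonal to everything under that form. The two
    relations, for different roots \<open>l\<close> and \<open>l'\<close>, force both forms to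
    vanish on the pair.\<close>
  have e1: "fa s t s' t' + l * fb s t s' t' = 0"
  proof -
    have "fa s t s' t' + l * fb s t s' t' = s' * ((a22 + l * b22) * s + (a23 + l * b23) * t)
        + t' * ((a23 + l * b23) * s + (a33 + l * b33) * t)"
      by (simp add: fa_def fb_def algebra_simps)
    then show ?thesis using st by simp
  qed
  have e2: "fa s t s' t' + l' * fb s t s' t' = 0"
  proof -
    have "fa s t s' t' + l' * fb s t s' t' = s * ((a22 + l' * b22) * s' + (a23 + l' * b23) * t')
        + t * ((a23 + l' * b23) * s' + (a33 + l' * b33) * t')"
      by (simp add: fa_def fb_def algebra_simps)
    then show ?thesis using st' by simp
  qed
  have "(l - l') * fb s t s' t' = (fa s t s' t' + l * fb s t s' t') - (fa s t s' t' + l' * fb s t s' t')"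
    by (simp only: left_diff_distrib)
  then have "(l - l') * fb s t s' t' = 0" unfolding e1 e2 by simp
  then have fb0: "fb s t s' t' = 0" using ll by simp
  then have fa0: "fa s t s' t' = 0" using e1 by simp
  \<comment> \<open>Parallel kernel vectors would be annihilated by a + l b and by a + l' b, hence
    by b, whose determinant \<open>q2\<close> is nonzero.\<close>
  have "s * t' - s' * t \<noteq> 0"
  proof
    assume eq: "s * t' - s' * t = 0"
    have "s * ((a22 + l' * b22) * s' + (a23 + l' * b23) * t') - s' * ((a22 + l * b22) * s + (a23 + l * b23) * t)
      = (l' - l) * s' * (b22 * s + b23 * t) + (a23 + l' * b23) * (s * t' - s' * t)"
      by (simp add: algebra_simps)
    then have 1: "s' * (b22 * s + b23 * t) = 0" using st st' eq ll by auto
    have "s * ((a23 + l' * b23) * s' + (a33 + l' * b33) * t') - s' * ((a23 + l * b23) * s + (a33 + l * b33) * t)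
      = (l' - l) * s' * (b23 * s + b33 * t) + (a33 + l' * b33) * (s * t' - s' * t)"
      by (simp add: algebra_simps)
    then have 2: "s' * (b23 * s + b33 * t) = 0" using st st' eq ll by auto
    have "t * ((a22 + l' * b22) * s' + (a23 + l' * b23) * t') - t' * ((a22 + l * b22) * s + (a23 + l * b23) * t)
      = (l' - l) * t' * (b22 * s + b23 * t) - (a22 + l' * b22) * (s * t' - s' * t)"
      by (simp add: algebra_simps)
    then have 3: "t' * (b22 * s + b23 * t) = 0" using st st' eq ll by auto
    have "t * ((a23 + l' * b23) * s' + (a33 + l' * b33) * t') - t' * ((a23 + l * b23) * s + (a33 + l * b33) * t)
      = (l' - l) * t' * (b23 * s + b33 * t) - (a23 + l' * b23) * (s * t' - s' * t)"
      by (simp add: algebra_simps)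
    then have 4: "t' * (b23 * s + b33 * t) = 0" using st st' eq ll by auto
    have z: "b22 * s + b23 * t = 0" "b23 * s + b33 * t = 0"
      using 1 2 3 4 st'(1) by auto
    have "q2 * s = b33 * (b22 * s + b23 * t) - b23 * (b23 * s + b33 * t)"
      "q2 * t = b22 * (b23 * s + b33 * t) - b23 * (b22 * s + b23 * t)"
      by (simp_all add: q2_def power2_eq_square algebra_simps)
    then show False using z q2 st(1) by simp
  qed
  then show ?thesis using fa0 fb0 by (intro that) auto
next
  case False
  \<comment> \<open>The nonreal roots of q0 + q1 l + q2 l^2 are \<sigma> plus or minus i \<tau>, and
    m denotes the matrix a + \<sigma> b. \<open>F1\<close> says that adj(b) m has trace
    zero.\<close>
  define \<sigma> where "\<sigma> = - q1 / (2 * q2)"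
  define \<tau> where "\<tau> = sqrt (4 * q0 * q2 - q1\<^sup>2) / (2 * \<bar>q2\<bar>)"
  have pos: "4 * q0 * q2 - q1\<^sup>2 > 0" using False disc by simp
  then have \<tau>: "\<tau> > 0" "\<tau>\<^sup>2 = (4 * q0 * q2 - q1\<^sup>2) / (4 * q2\<^sup>2)"
    using q2 by (auto simp: \<tau>_def power_divide power_mult_distrib)
  define m11 m12 m22 where "m11 = a22 + \<sigma> * b22" and "m12 = a23 + \<sigma> * b23" and "m22 = a33 + \<sigma> * b33"
  have F1: "m11 * b33 + m22 * b22 - 2 * m12 * b23 = 0"
  proof -
    have "m11 * b33 + m22 * b22 - 2 * m12 * b23 = q1 + 2 * \<sigma> * q2"
      by (simp add: m11_def m12_def m22_def q1_def q2_def algebra_simps power2_eq_square)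
    then show ?thesis using q2 by (simp add: \<sigma>_def)
  qed
  have F2: "m11 * m22 - m12\<^sup>2 = q2 * \<tau>\<^sup>2"
  proof -
    have "m11 * m22 - m12\<^sup>2 = q0 + \<sigma> * q1 + \<sigma>\<^sup>2 * q2"
      by (simp add: m11_def m12_def m22_def q0_def q1_def q2_def algebra_simps power2_eq_square)
    also have "\<dots> = q2 * \<tau>\<^sup>2"
      unfolding \<tau>(2) using q2 by (simp add: \<sigma>_def field_simps power2_eq_square)
    finally show ?thesis .
  qed
  \<comment> \<open>(X, Y) is the first column of J = adj(b) m. Trace zero and determinant (q2
    \<tau>)^2 give J^2 = -(q2 \<tau>)^2, and J is self-adjoint for b and for m. Scaled by
    \<open>c\<close>, it sends the first basis vector to a vector on which both forms take the
    opposite values. J has no real eigenvector, which is the reason for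
    \<open>Y \<noteq> 0\<close>.\<close>
  define X Y where "X = b33 * m11 - b23 * m12" and "Y = b22 * m12 - b23 * m11"
  have Y0: "Y \<noteq> 0"
  proof
    assume "Y = 0"
    then have y: "b22 * m12 = b23 * m11" by (simp add: Y_def)
    have "q2 * \<tau>\<^sup>2 * b22\<^sup>2 = m11 * b22 * (m22 * b22) - (b22 * m12)\<^sup>2"
      unfolding F2[symmetric] by (simp add: algebra_simps power2_eq_square)
    also have "m22 * b22 = 2 * m12 * b23 - m11 * b33" using F1 by simp
    also have "m11 * b22 * (2 * m12 * b23 - m11 * b33) - (b22 * m12)\<^sup>2
        = 2 * m11 * b23 * (b22 * m12) - m11\<^sup>2 * b22 * b33 - (b22 * m12)\<^sup>2"
      by (simp add: algebra_simps power2_eq_square)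
    also have "\<dots> = - (m11\<^sup>2 * q2)"
      unfolding y by (simp add: q2_def algebra_simps power2_eq_square)
    finally have "q2 * ((\<tau> * b22)\<^sup>2 + m11\<^sup>2) = 0" by (simp add: algebra_simps power2_eq_square)
    then have z: "b22 = 0" "m11 = 0" using q2 \<tau>(1) by (auto simp: sum_power2_eq_zero_iff)
    then have "m12 * b23 = 0" using F1 by simp
    moreover have "m12\<^sup>2 = b23\<^sup>2 * \<tau>\<^sup>2" using F2 z by (simp add: q2_def)
    ultimately have "b23 = 0" using \<tau>(1) by auto
    then show False using q2 z by (simp add: q2_def)
  qed
  have B0: "b22 * (\<tau> * q2)\<^sup>2 + (b22 * X * X + b23 * (X * Y + Y * X) + b33 * Y * Y) = 0"
  proof -
    have "b22 * X * X + b23 * (X * Y + Y * X) + b33 * Y * Y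
        = q2 * (m11 * (b33 * m11 - 2 * m12 * b23) + b22 * m12\<^sup>2)"
      by (simp add: X_def Y_def q2_def algebra_simps power2_eq_square)
    also have "b33 * m11 - 2 * m12 * b23 = - (m22 * b22)" using F1 by (simp add: algebra_simps)
    also have "q2 * (m11 * (- (m22 * b22)) + b22 * m12\<^sup>2) = - (q2 * b22 * (m11 * m22 - m12\<^sup>2))"
      by (simp add: algebra_simps)
    finally show ?thesis unfolding F2 by (simp add: algebra_simps power2_eq_square)
  qed
  have M0: "m11 * (\<tau> * q2)\<^sup>2 + (m11 * X * X + m12 * (X * Y + Y * X) + m22 * Y * Y) = 0"
  proof -
    have "m11 * X + m12 * Y = m11 * (b33 * m11 - 2 * m12 * b23) + b22 * m12\<^sup>2"
      by (simp add: X_def Y_def algebra_simps power2_eq_square)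
    also have "b33 * m11 - 2 * m12 * b23 = - (m22 * b22)" using F1 by (simp add: algebra_simps)
    also have "m11 * (- (m22 * b22)) + b22 * m12\<^sup>2 = - (b22 * (m11 * m22 - m12\<^sup>2))"
      by (simp add: algebra_simps)
    finally have 1: "m11 * X + m12 * Y = - (b22 * (q2 * \<tau>\<^sup>2))" unfolding F2 .
    have "m12 * X + m22 * Y = m12 * (b33 * m11) - b23 * m12\<^sup>2 + m12 * (m22 * b22) - b23 * (m11 * m22)"
      by (simp add: X_def Y_def algebra_simps power2_eq_square)
    also have "b33 * m11 = 2 * m12 * b23 - m22 * b22" using F1 by (simp add: algebra_simps)
    also have "m12 * (2 * m12 * b23 - m22 * b22) - b23 * m12\<^sup>2 + m12 * (m22 * b22) - b23 * (m11 * m22)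
      = - (b23 * (m11 * m22 - m12\<^sup>2))"
      by (simp add: algebra_simps power2_eq_square)
    finally have 2: "m12 * X + m22 * Y = - (b23 * (q2 * \<tau>\<^sup>2))" unfolding F2 .
    have "m11 * X * X + m12 * (X * Y + Y * X) + m22 * Y * Y = X * (m11 * X + m12 * Y) + Y * (m12 * X + m22 * Y)"
      by (simp add: algebra_simps)
    also have "\<dots> = - (q2 * \<tau>\<^sup>2) * (b22 * X + b23 * Y)"
      unfolding 1 2 by (simp add: algebra_simps)
    also have "b22 * X + b23 * Y = q2 * m11"
      by (simp add: X_def Y_def q2_def algebra_simps power2_eq_square)
    finally show ?thesis by (simp add: algebra_simps power2_eq_square)
  qed
  define c where "c = 1 / (\<tau> * q2)"
  have c: "c * (\<tau> * q2) = 1" using \<tau>(1) q2 by (simp add: c_def)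
  have fbz: "fb 1 0 1 0 + fb (c * X) (c * Y) (c * X) (c * Y) = 0"
  proof -
    have "fb 1 0 1 0 + fb (c * X) (c * Y) (c * X) (c * Y)
      = b22 * (1 - (c * (\<tau> * q2))\<^sup>2) + c\<^sup>2 * (b22 * (\<tau> * q2)\<^sup>2 + (b22 * X * X + b23 * (X * Y + Y * X) + b33 * Y * Y))"
      by (simp add: fb_def algebra_simps power2_eq_square)
    then show ?thesis unfolding B0 c by simp
  qed
  have fmz: "(fa 1 0 1 0 + fa (c * X) (c * Y) (c * X) (c * Y)) + \<sigma> * (fb 1 0 1 0 + fb (c * X) (c * Y) (c * X) (c * Y)) = 0"
  proof -
    have "(fa 1 0 1 0 + fa (c * X) (c * Y) (c * X) (c * Y)) + \<sigma> * (fb 1 0 1 0 + fb (c * X) (c * Y) (c * X) (c * Y))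
      = m11 * (1 - (c * (\<tau> * q2))\<^sup>2) + c\<^sup>2 * (m11 * (\<tau> * q2)\<^sup>2 + (m11 * X * X + m12 * (X * Y + Y * X) + m22 * Y * Y))"
      by (simp add: fa_def fb_def m11_def m12_def m22_def algebra_simps power2_eq_square)
    then show ?thesis unfolding M0 c by simp
  qed
  have "1 * (c * Y) - (c * X) * 0 \<noteq> 0" using Y0 c by auto
  then show ?thesis using fbz fmz by (intro that[of 1 "c * Y" "c * X" 0]) auto
qed

section \<open>Congruence of pencils and reduction to a plane\<close>

definition columns3 :: "real^3 \<Rightarrow> real^3 \<Rightarrow> real^3 \<Rightarrow> real^3^3" where
  "columns3 v e f = transpose (vector [v, e, f])"

lemma columns3_mult: "columns3 v e f *v u = u$1 *\<^sub>R v + u$2 *\<^sub>R e + u$3 *\<^sub>R f"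
  by (simp add: columns3_def vec_eq_iff forall_3 matrix_vector_mult_def sum_3 transpose_def mult.commute)

lemma transpose_columns3_mult: "transpose (columns3 v e f) *v x = vector [v \<bullet> x, e \<bullet> x, f \<bullet> x]"
  by (simp add: columns3_def vec_eq_iff forall_3 matrix_vector_mult_def sum_3 inner_vec_def)

lemma det_columns3: "det (columns3 v e f) = v \<bullet> cross3 e f"
  by (simp add: columns3_def det_transpose dot_cross_det)

text \<open>The cofactor rule for cross products: a change of basis by \<open>P\<close> acts on both
  forms by congruence, and the transpose of \<open>P\<close> acts on cross products through det P
  times the inverse of \<open>P\<close>. A normal form of the pencil thus becomes one of the map
  w.\<close>

lemma cross_map_mult:
  "det P *\<^sub>R cross_map A B (P *v u)
    = P *v cross3 (transpose P *v (A *v (P *v u))) (transpose P *v (B *v (P *v u)))"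
  unfolding cross_map_def using cross_matrix_mult[of "transpose P"] by (simp add: det_transpose)

lemma symmetric_inner:
  fixes A :: "real^'n^'n"
  assumes "transpose A = A"
  shows "x \<bullet> (A *v y) = y \<bullet> (A *v x)"
  by (metis assms dot_lmul_matrix inner_commute transpose_matrix_vector)

text \<open>Both sides are the determinant of the Gram matrix of \<open>M\<close> in the vectors
  \<open>v\<close>, \<open>e\<close>, \<open>f\<close>.\<close>

lemma det_congruence:
  assumes "transpose M = M"
  shows "(det (columns3 v e f))\<^sup>2 * det M =
    (v \<bullet> (M *v v)) * (e \<bullet> (M *v e)) * (f \<bullet> (M *v f)) + 2 * (v \<bullet> (M *v e)) * (v \<bullet> (M *v f)) * (e \<bullet> (M *v f))
    - (v \<bullet> (M *v v)) * (e \<bullet> (M *v f))\<^sup>2 - (e \<bullet> (M *v e)) * (v \<bullet> (M *v f))\<^sup>2 - (f \<bullet> (M *v f)) * (v \<bullet> (M *v e))\<^sup>2"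
proof -
  let ?P = "columns3 v e f"
  let ?G = "transpose ?P ** M ** ?P"
  have col: "?P *v axis 1 1 = v" "?P *v axis 2 1 = e" "?P *v axis 3 1 = f"
    by (simp_all add: columns3_mult axis_def)
  have G: "?G $ i $ j = (transpose ?P *v (M *v (?P *v axis j 1))) $ i" for i j
  proof -
    have "?G $ i $ j = (?G *v axis j 1) $ i"
      by (simp only: matrix_vector_mult_basis column_def vec_lambda_beta)
    then show ?thesis by (simp only: matrix_vector_mul_assoc matrix_mul_assoc)
  qed
  have "(det ?P)\<^sup>2 * det M = det ?G"
    by (simp add: det_mul det_transpose power2_eq_square)
  also have "det ?G = (v \<bullet> (M *v v)) * (e \<bullet> (M *v e)) * (f \<bullet> (M *v f)) + 2 * (v \<bullet> (M *v e)) * (v \<bullet> (M *v f)) * (e \<bullet> (M *v f))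
    - (v \<bullet> (M *v v)) * (e \<bullet> (M *v f))\<^sup>2 - (e \<bullet> (M *v e)) * (v \<bullet> (M *v f))\<^sup>2 - (f \<bullet> (M *v f)) * (v \<bullet> (M *v e))\<^sup>2"
    using symmetric_inner[OF assms, of e v] symmetric_inner[OF assms, of f v] symmetric_inner[OF assms, of f e]
    unfolding det_3 G transpose_columns3_mult col by (simp add: power2_eq_square algebra_simps)
  finally show ?thesis .
qed

lemma transpose_pencil:
  fixes A B :: "real^3^3"
  assumes "transpose A = A" "transpose B = B"
  shows "transpose (x *\<^sub>R A + y *\<^sub>R B) = x *\<^sub>R A + y *\<^sub>R B"
  using assms by (simp add: transpose_def vec_eq_iff)

lemma pencil_mult:
  fixes A B :: "real^3^3"
  shows "(x *\<^sub>R A + y *\<^sub>R B) *v u = x *\<^sub>R (A *v u) + y *\<^sub>R (B *v u)"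
  by (simp add: matrix_vector_mult_add_rdistrib scaleR_matrix_vector_assoc)

lemma exists_cross3_nonzero:
  fixes v :: "real^3"
  assumes "v \<noteq> 0"
  obtains e where "cross3 v e \<noteq> 0"
proof -
  have "\<exists>e\<in>{axis 1 1, axis 2 1, axis 3 1}. cross3 v e \<noteq> 0"
  proof (rule ccontr)
    assume "\<not> (\<exists>e\<in>{axis 1 1, axis 2 1, axis 3 1}. cross3 v e \<noteq> 0)"
    then have "v = 0"
      by (simp add: cross3_def vec_eq_iff forall_3 axis_def)
    with assms show False by simp
  qed
  then show ?thesis using that by blast
qed

text \<open>Degeneration of the pencil in block form produces a repeated factor of the determinant.\<close>

lemma block_pencil:
  assumes sym: "transpose A = A" "transpose B = B" and sf: "square_free_pencil A B"
    and det: "det (columns3 v e f) \<noteq> 0"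
    and v: "B *v v = 0" "e \<bullet> (A *v v) = 0" "f \<bullet> (A *v v) = 0"
  defines "q0 \<equiv> (e \<bullet> (A *v e)) * (f \<bullet> (A *v f)) - (e \<bullet> (A *v f))\<^sup>2"
    and "q1 \<equiv> (e \<bullet> (A *v e)) * (f \<bullet> (B *v f)) + (f \<bullet> (A *v f)) * (e \<bullet> (B *v e)) - 2 * (e \<bullet> (A *v f)) * (e \<bullet> (B *v f))"
    and "q2 \<equiv> (e \<bullet> (B *v e)) * (f \<bullet> (B *v f)) - (e \<bullet> (B *v f))\<^sup>2"
  shows "v \<bullet> (A *v v) \<noteq> 0" "q2 \<noteq> 0" "q1\<^sup>2 - 4 * q0 * q2 \<noteq> 0"
proof -
  let ?d = "(det (columns3 v e f))\<^sup>2"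
  define \<alpha> where "\<alpha> = v \<bullet> (A *v v) / ?d"
  have d: "?d \<noteq> 0" using det by simp
  have vz: "v \<bullet> (A *v e) = 0" "v \<bullet> (A *v f) = 0" "v \<bullet> (B *v e) = 0" "v \<bullet> (B *v f) = 0"
    using v symmetric_inner[OF sym(1), of v] symmetric_inner[OF sym(2), of v] by auto
  \<comment> \<open>The Gram matrix is block diagonal: the entry of \<open>v\<close> is a multiple
    of \<open>x\<close>, since \<open>B\<close> annihilates \<open>v\<close>, and the block of
    \<open>e\<close> and \<open>f\<close> has a binary quadratic form as determinant.\<close>
  have D: "det (x *\<^sub>R A + y *\<^sub>R B) = \<alpha> * x * (q0 * x\<^sup>2 + q1 * x * y + q2 * y\<^sup>2)" for x y
  proof -
    have "?d * det (x *\<^sub>R A + y *\<^sub>R B) = (v \<bullet> (A *v v)) * x * (q0 * x\<^sup>2 + q1 * x * y + q2 * y\<^sup>2)"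
      unfolding det_congruence[OF transpose_pencil[OF sym]] pencil_mult q0_def q1_def q2_def
      by (simp add: inner_add_right v(1) vz algebra_simps power2_eq_square)
    then show ?thesis using d by (simp add: \<alpha>_def field_simps)
  qed
  have contra: False if "\<And>x y. det (x *\<^sub>R A + y *\<^sub>R B) = (a * x + b * y)\<^sup>2 * (c * x + d * y)" for a b c d
    using sf that unfolding square_free_pencil_def by blast
  show "v \<bullet> (A *v v) \<noteq> 0"
  proof
    assume "v \<bullet> (A *v v) = 0"
    then show False using D by (intro contra[of 0 0 0 0]) (simp add: \<alpha>_def)
  qed
  show q2: "q2 \<noteq> 0"
  proof
    assume "q2 = 0"
    then show False using D
      by (intro contra[of 1 0 "\<alpha> * q0" "\<alpha> * q1"]) (simp add: power2_eq_square algebra_simps)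
  qed
  show "q1\<^sup>2 - 4 * q0 * q2 \<noteq> 0"
  proof
    assume "q1\<^sup>2 - 4 * q0 * q2 = 0"
    then have q0: "q0 = q1\<^sup>2 / (4 * q2)" using q2 by (simp add: field_simps)
    have "q0 * x\<^sup>2 + q1 * x * y + q2 * y\<^sup>2 = q2 * (q1 / (2 * q2) * x + 1 * y)\<^sup>2" for x y
      unfolding q0 using q2 by (simp add: field_simps power2_eq_square)
    then show False using D
      by (intro contra[of "q1 / (2 * q2)" 1 "\<alpha> * q2" 0]) (simp add: algebra_simps)
  qed
qed

text \<open>If \<open>v\<close> were isotropic for \<open>A\<close>, the Gram matrix of x A + y B in
  a basis starting with \<open>v\<close> would have zero corner and only multiples of
  \<open>x\<close> in the rest of its first row and column. Every nonzero term of the determinant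
  takes one entry from each, so x^2 would divide it.\<close>

lemma kernel_not_isotropic:
  assumes sym: "transpose A = A" "transpose B = B" and sf: "square_free_pencil A B"
    and v: "v \<noteq> 0" "B *v v = 0"
  shows "v \<bullet> (A *v v) \<noteq> 0"
proof
  assume iso: "v \<bullet> (A *v v) = 0"
  obtain e where e: "cross3 v e \<noteq> 0" using exists_cross3_nonzero[OF v(1)] by blast
  define f where "f = cross3 v e"
  let ?d = "(det (columns3 v e f))\<^sup>2"
  have "det (columns3 v e f) = (norm (cross3 v e))\<^sup>2"
    unfolding det_columns3 f_def power2_norm_eq_inner by (simp add: cross3_simps)
  then have d: "?d \<noteq> 0" using e by simp
  have vz: "v \<bullet> (B *v e) = 0" "v \<bullet> (B *v f) = 0"
    using v symmetric_inner[OF sym(2), of v] by auto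
  define c where "c = (2 * (v \<bullet> (A *v e)) * (v \<bullet> (A *v f)) * (e \<bullet> (A *v f))
     - (e \<bullet> (A *v e)) * (v \<bullet> (A *v f))\<^sup>2 - (f \<bullet> (A *v f)) * (v \<bullet> (A *v e))\<^sup>2) / ?d"
  define c' where "c' = (2 * (v \<bullet> (A *v e)) * (v \<bullet> (A *v f)) * (e \<bullet> (B *v f))
     - (e \<bullet> (B *v e)) * (v \<bullet> (A *v f))\<^sup>2 - (f \<bullet> (B *v f)) * (v \<bullet> (A *v e))\<^sup>2) / ?d"
  have cd: "?d * c = 2 * (v \<bullet> (A *v e)) * (v \<bullet> (A *v f)) * (e \<bullet> (A *v f))
     - (e \<bullet> (A *v e)) * (v \<bullet> (A *v f))\<^sup>2 - (f \<bullet> (A *v f)) * (v \<bullet> (A *v e))\<^sup>2"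
    "?d * c' = 2 * (v \<bullet> (A *v e)) * (v \<bullet> (A *v f)) * (e \<bullet> (B *v f))
     - (e \<bullet> (B *v e)) * (v \<bullet> (A *v f))\<^sup>2 - (f \<bullet> (B *v f)) * (v \<bullet> (A *v e))\<^sup>2"
    using d by (simp_all add: c_def c'_def)
  have "det (x *\<^sub>R A + y *\<^sub>R B) = (1 * x + 0 * y)\<^sup>2 * (c * x + c' * y)" for x y
  proof -
    have "?d * det (x *\<^sub>R A + y *\<^sub>R B) = x\<^sup>2 * ((?d * c) * x + (?d * c') * y)"
      unfolding det_congruence[OF transpose_pencil[OF sym]] pencil_mult cd
      by (simp add: inner_add_right v(2) vz iso algebra_simps power2_eq_square)
    also have "\<dots> = ?d * (x\<^sup>2 * (c * x + c' * y))" by (simp add: algebra_simps)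
    finally show ?thesis using d by simp
  qed
  then show False using sf unfolding square_free_pencil_def by blast
qed

text \<open>The two alternatives describe \<open>w(u) = N(u) c / u\<close> in \<open>\<real> \<times> \<real> \<times> \<real>\<close> and in \<open>\<real> \<times> \<complex>\<close>.\<close>

definition normal_form :: "(real^3 \<Rightarrow> real^3) \<Rightarrow> real^3^3 \<Rightarrow> bool" where
  "normal_form w P \<longleftrightarrow>
    (\<exists>c1 c2 c3. c1 \<noteq> 0 \<and> c2 \<noteq> 0 \<and> c3 \<noteq> 0 \<and>
       (\<forall>u. w (P *v u) = P *v vector [c1 * (u$2 * u$3), c2 * (u$1 * u$3), c3 * (u$1 * u$2)])) \<or>
     (\<exists>c a b. c \<noteq> 0 \<and> (a \<noteq> 0 \<or> b \<noteq> 0) \<and>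
       (\<forall>u. w (P *v u) = P *v vector [c * ((u$2)\<^sup>2 + (u$3)\<^sup>2), u$1 * (a * u$2 + b * u$3), u$1 * (b * u$2 - a * u$3)]))"

text \<open>A kernel vector \<open>v\<close> of \<open>B\<close> is not isotropic for
  \<open>A\<close>, so the space is the sum of the line of \<open>v\<close> and the plane orthogonal
  to n = A v, and this sum is orthogonal for both forms. The basis adapted to the binary pencil on
  the plane completes \<open>v\<close> to the matrix \<open>P\<close>.\<close>

lemma pencil_normal_form_singular:
  assumes sym: "transpose A = A" "transpose B = B" and sf: "square_free_pencil A B" and det0: "det B = 0"
  shows "\<exists>P. det P \<noteq> 0 \<and> normal_form (cross_map A B) P"
proof -
  obtain v where v: "v \<noteq> 0" "B *v v = 0"
    using det0 by (metis invertible_det_nz invertible_left_inverse matrix_left_invertible_ker)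
  define n where "n = A *v v"
  have vn: "v \<bullet> n \<noteq> 0" unfolding n_def by (rule kernel_not_isotropic[OF sym sf v])
  then have "n \<noteq> 0" by auto
  then obtain g where g: "cross3 n g \<noteq> 0" using exists_cross3_nonzero by blast
  define e where "e = cross3 n g"
  define f where "f = cross3 n e"
  have en: "e \<bullet> n = 0" "f \<bullet> n = 0" by (simp_all add: e_def f_def dot_cross_self)
  have "det (columns3 v e f) = (v \<bullet> n) * (norm e)\<^sup>2"
  proof -
    have "cross3 e f = (e \<bullet> e) *\<^sub>R n - (e \<bullet> n) *\<^sub>R e"
      unfolding f_def by (simp add: cross3_simps forall_3)
    then show ?thesis by (simp add: det_columns3 en power2_norm_eq_inner)
  qed
  then have detP: "det (columns3 v e f) \<noteq> 0" using vn g by (simp add: e_def)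
  note bp = block_pencil[OF sym sf detP v(2) en(1)[unfolded n_def] en(2)[unfolded n_def]]
  obtain s t s' t' where st: "s * t' - s' * t \<noteq> 0"
    and alt: "e \<bullet> (A *v e) * s * s' + e \<bullet> (A *v f) * (s * t' + t * s') + f \<bullet> (A *v f) * t * t' = 0 \<and>
        e \<bullet> (B *v e) * s * s' + e \<bullet> (B *v f) * (s * t' + t * s') + f \<bullet> (B *v f) * t * t' = 0 \<or>
      e \<bullet> (A *v e) * s * s + e \<bullet> (A *v f) * (s * t + t * s) + f \<bullet> (A *v f) * t * t
        + (e \<bullet> (A *v e) * s' * s' + e \<bullet> (A *v f) * (s' * t' + t' * s') + f \<bullet> (A *v f) * t' * t') = 0 \<and>
      e \<bullet> (B *v e) * s * s + e \<bullet> (B *v f) * (s * t + t * s) + f \<bullet> (B *v f) * t * t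
        + (e \<bullet> (B *v e) * s' * s' + e \<bullet> (B *v f) * (s' * t' + t' * s') + f \<bullet> (B *v f) * t' * t') = 0"
    by (rule binary_pencil_basis[OF bp(2,3)]) blast
  define y z where "y = s *\<^sub>R e + t *\<^sub>R f" and "z = s' *\<^sub>R e + t' *\<^sub>R f"
  have yn: "y \<bullet> n = 0" "z \<bullet> n = 0" by (simp_all add: y_def z_def inner_add_left en)
  have "det (columns3 v y z) = (s * t' - s' * t) * det (columns3 v e f)"
    unfolding det_columns3 y_def z_def by (simp add: cross3_simps)
  then have detP': "det (columns3 v y z) \<noteq> 0" using st detP by simp
  have form: "(s1 *\<^sub>R e + t1 *\<^sub>R f) \<bullet> (M *v (s2 *\<^sub>R e + t2 *\<^sub>R f))
      = e \<bullet> (M *v e) * s1 * s2 + e \<bullet> (M *v f) * (s1 * t2 + t1 * s2) + f \<bullet> (M *v f) * t1 * t2"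
    if "transpose M = M" for M :: "real^3^3" and s1 t1 s2 t2
    using symmetric_inner[OF that, of f e]
    by (simp add: matrix_vector_right_distrib matrix_vector_mult_scaleR inner_add_left inner_add_right algebra_simps)
  have alt': "y \<bullet> (A *v z) = 0 \<and> y \<bullet> (B *v z) = 0 \<or>
      y \<bullet> (A *v y) + z \<bullet> (A *v z) = 0 \<and> y \<bullet> (B *v y) + z \<bullet> (B *v z) = 0"
    using alt unfolding y_def z_def form[OF sym(1)] form[OF sym(2)] .
  \<comment> \<open>Square-freeness, read off again in the adapted basis, supplies the nonvanishing
    of the coefficients below.\<close>
  note bp' = block_pencil[OF sym sf detP' v(2) yn(1)[unfolded n_def] yn(2)[unfolded n_def]]
  define P where "P = columns3 v y z"
  define \<delta> where "\<delta> = 1 / det P"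
  have \<delta>: "\<delta> \<noteq> 0" "\<delta> * det P = 1" using detP' by (simp_all add: \<delta>_def P_def)
  define \<alpha> where "\<alpha> = v \<bullet> (A *v v)"
  have \<alpha>: "\<alpha> \<noteq> 0" unfolding \<alpha>_def by (rule bp'(1))
  have zv: "v \<bullet> (A *v y) = 0" "v \<bullet> (A *v z) = 0" "y \<bullet> (A *v v) = 0" "z \<bullet> (A *v v) = 0"
    "v \<bullet> (B *v y) = 0" "v \<bullet> (B *v z) = 0"
    using yn v symmetric_inner[OF sym(1), of v] symmetric_inner[OF sym(2), of v] by (auto simp: n_def)
  have sy: "z \<bullet> (A *v y) = y \<bullet> (A *v z)" "z \<bullet> (B *v y) = y \<bullet> (B *v z)"
    by (rule symmetric_inner[OF sym(1)], rule symmetric_inner[OF sym(2)])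
  let ?g = "y \<bullet> (A *v y)" and ?h = "y \<bullet> (A *v z)" and ?k = "z \<bullet> (A *v z)"
  let ?b = "y \<bullet> (B *v y)" and ?\<beta> = "y \<bullet> (B *v z)" and ?c = "z \<bullet> (B *v z)"
  have w: "cross_map A B (P *v u) = P *v (\<delta> *\<^sub>R cross3
      (vector [\<alpha> * u$1, ?g * u$2 + ?h * u$3, ?h * u$2 + ?k * u$3])
      (vector [0, ?b * u$2 + ?\<beta> * u$3, ?\<beta> * u$2 + ?c * u$3]))" for u
  proof -
    have 1: "transpose P *v (A *v (P *v u)) = vector [\<alpha> * u$1, ?g * u$2 + ?h * u$3, ?h * u$2 + ?k * u$3]"
      unfolding P_def transpose_columns3_mult columns3_mult
      by (simp add: matrix_vector_right_distrib matrix_vector_mult_scaleR inner_add_right zv sy \<alpha>_def mult.commute)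
    have 2: "transpose P *v (B *v (P *v u)) = vector [0, ?b * u$2 + ?\<beta> * u$3, ?\<beta> * u$2 + ?c * u$3]"
      unfolding P_def transpose_columns3_mult columns3_mult
      by (simp add: matrix_vector_right_distrib matrix_vector_mult_scaleR inner_add_right zv sy v(2) mult.commute)
    have "cross_map A B (P *v u) = \<delta> *\<^sub>R (det P *\<^sub>R cross_map A B (P *v u))"
      using \<delta> by simp
    then show ?thesis
      unfolding cross_map_mult 1 2 by (simp add: matrix_vector_mult_scaleR)
  qed
  have "det P \<noteq> 0" using detP' by (simp add: P_def)
  moreover from alt' have "normal_form (cross_map A B) P"
  proof (elim disjE)
    assume "?h = 0 \<and> ?\<beta> = 0"
    then have hb: "?h = 0" "?\<beta> = 0" by auto
    have q: "?b * ?c \<noteq> 0" using bp'(2) hb by simp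
    have "(?g * ?c + ?k * ?b)\<^sup>2 - 4 * (?g * ?k) * (?b * ?c) \<noteq> 0" using bp'(3) hb by simp
    \<comment> \<open>For diagonal forms the discriminant is the square of the first coefficient, up
      to \<delta>.\<close>
    moreover have "(?g * ?c + ?k * ?b)\<^sup>2 - 4 * (?g * ?k) * (?b * ?c) = (?g * ?c - ?k * ?b)\<^sup>2"
      by (simp add: power2_eq_square algebra_simps)
    ultimately have c1: "?g * ?c - ?k * ?b \<noteq> 0" by auto
    show "normal_form (cross_map A B) P"
      unfolding normal_form_def
    proof (intro disjI1 exI conjI allI)
      show "\<delta> * (?g * ?c - ?k * ?b) \<noteq> 0" "- (\<delta> * (\<alpha> * ?c)) \<noteq> 0" "\<delta> * (\<alpha> * ?b) \<noteq> 0"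
        using c1 q \<delta> \<alpha> by auto
      fix u :: "real^3"
      show "cross_map A B (P *v u) = P *v vector [\<delta> * (?g * ?c - ?k * ?b) * (u$2 * u$3),
          - (\<delta> * (\<alpha> * ?c)) * (u$1 * u$3), \<delta> * (\<alpha> * ?b) * (u$1 * u$2)]"
        unfolding w hb by (rule arg_cong[where f="(*v) P"]) (simp add: cross3_simps forall_3)
    qed
  next
    assume "?g + ?k = 0 \<and> ?b + ?c = 0"
    then have kc: "?k = - ?g" "?c = - ?b" by auto
    have "?b * ?c - ?\<beta>\<^sup>2 \<noteq> 0" by (rule bp'(2))
    then have ab: "?b \<noteq> 0 \<or> ?\<beta> \<noteq> 0" by auto
    have "(?g * ?c + ?k * ?b - 2 * ?h * ?\<beta>)\<^sup>2 - 4 * (?g * ?k - ?h\<^sup>2) * (?b * ?c - ?\<beta>\<^sup>2) \<noteq> 0"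
      by (rule bp'(3))
    \<comment> \<open>Here the diagonal entries of each form are opposite, and the discriminant is
      -4 times the square of the first coefficient, up to \<delta>.\<close>
    moreover have "(?g * ?c + ?k * ?b - 2 * ?h * ?\<beta>)\<^sup>2 - 4 * (?g * ?k - ?h\<^sup>2) * (?b * ?c - ?\<beta>\<^sup>2)
        = - 4 * (?g * ?\<beta> - ?h * ?b)\<^sup>2"
      unfolding kc by (simp add: power2_eq_square algebra_simps)
    ultimately have c: "?g * ?\<beta> - ?h * ?b \<noteq> 0" by auto
    show "normal_form (cross_map A B) P"
      unfolding normal_form_def
    proof (rule disjI2, intro exI conjI allI)
      show "\<delta> * (?g * ?\<beta> - ?h * ?b) \<noteq> 0" using c \<delta> by simp
      show "- (\<delta> * \<alpha> * ?\<beta>) \<noteq> 0 \<or> \<delta> * \<alpha> * ?b \<noteq> 0" using ab \<delta> \<alpha> by auto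
      fix u :: "real^3"
      show "cross_map A B (P *v u) = P *v vector [\<delta> * (?g * ?\<beta> - ?h * ?b) * ((u$2)\<^sup>2 + (u$3)\<^sup>2),
          u$1 * (- (\<delta> * \<alpha> * ?\<beta>) * u$2 + \<delta> * \<alpha> * ?b * u$3), u$1 * (\<delta> * \<alpha> * ?b * u$2 - - (\<delta> * \<alpha> * ?\<beta>) * u$3)]"
        unfolding w kc by (rule arg_cong[where f="(*v) P"]) (simp add: cross3_simps forall_3 power2_eq_square)
    qed
  qed
  ultimately show ?thesis by blast
qed

text \<open>The integral of \<open>1 / t\<close> near zero is invariant under dilations, so it equals itself plus a
  positive number.\<close>

lemma nn_integral_inverse_infinite:
  fixes \<eta> :: real
  assumes \<eta>: "\<eta> > 0"
  shows "(\<integral>\<^sup>+t. ennreal (1 / t) * indicator {0<..<\<eta>} t \<partial>lborel) = \<top>"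
proof -
  define J where "J \<eta> = (\<integral>\<^sup>+t. ennreal (1 / t) * indicator {0<..<\<eta>} t \<partial>lborel)" for \<eta> :: real
  let ?c = "\<integral>\<^sup>+t. ennreal (1 / t) * indicator {\<eta>/2..<\<eta>} t \<partial>lborel"
  have "J \<eta> = (\<integral>\<^sup>+t. (ennreal (1 / t) * indicator {0<..<\<eta>/2} t + ennreal (1 / t) * indicator {\<eta>/2..<\<eta>} t) \<partial>lborel)"
    unfolding J_def using \<eta> by (intro nn_integral_cong) (auto simp: indicator_def)
  also have "\<dots> = J (\<eta> / 2) + ?c"
    unfolding J_def by (rule nn_integral_add) measurable
  also have "J (\<eta> / 2) = J \<eta>"
  proof -
    have "J \<eta> = ennreal 2 * (\<integral>\<^sup>+t. ennreal (1 / (2 * t)) * indicator {0<..<\<eta>} (2 * t) \<partial>lborel)"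
      using nn_integral_lborel_scaleR[of "\<lambda>t. ennreal (1 / t) * indicator {0<..<\<eta>} t" 2] by (simp add: J_def)
    also have "\<dots> = (\<integral>\<^sup>+t. ennreal 2 * (ennreal (1 / (2 * t)) * indicator {0<..<\<eta>} (2 * t)) \<partial>lborel)"
      by (rule nn_integral_cmult[symmetric]) measurable
    also have "\<dots> = J (\<eta> / 2)"
      unfolding J_def
    proof (rule nn_integral_cong)
      fix t :: real
      have "ennreal 2 * ennreal (1 / (2 * t)) = ennreal (1 / t)" if "t > 0"
        using that by (subst ennreal_mult[symmetric]) auto
      then show "ennreal 2 * (ennreal (1 / (2 * t)) * indicator {0<..<\<eta>} (2 * t)) = ennreal (1 / t) * indicator {0<..<\<eta>/2} t"
        by (auto simp: indicator_def)
    qed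
    finally show ?thesis ..
  qed
  finally have "J \<eta> + 0 = J \<eta> + ?c" by simp
  moreover have "?c \<noteq> 0"
  proof -
    have "(\<integral>\<^sup>+t. ennreal (1 / \<eta>) * indicator {\<eta>/2..<\<eta>} t \<partial>lborel) \<le> ?c"
      using \<eta> by (intro nn_integral_mono) (auto simp: indicator_def field_simps intro!: ennreal_leI)
    moreover have "(\<integral>\<^sup>+t. ennreal (1 / \<eta>) * indicator {\<eta>/2..<\<eta>} t \<partial>lborel) > 0"
    proof -
      have "ennreal (1 / \<eta>) * ennreal (\<eta> / 2) = ennreal (1 / 2)"
        using \<eta> by (subst ennreal_mult[symmetric]) auto
      also have "\<dots> > 0" by (subst ennreal_less_zero_iff) simp
      finally show ?thesis using \<eta> by (subst nn_integral_cmult_indicator) auto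
    qed
    ultimately show ?thesis by auto
  qed
  ultimately have "J \<eta> = \<top>"
    unfolding ennreal_add_left_cancel by auto
  then show ?thesis by (simp add: J_def)
qed

lemma abs_cos_diff_le: "\<bar>cos x - cos y\<bar> \<le> \<bar>x - (y::real)\<bar>"
proof -
  have "\<bar>cos x - cos y\<bar> = 2 * (\<bar>sin ((x + y) / 2)\<bar> * \<bar>sin ((y - x) / 2)\<bar>)"
    unfolding cos_diff_cos by (simp add: abs_mult)
  also have "\<dots> \<le> 2 * (1 * \<bar>(y - x) / 2\<bar>)"
    by (intro mult_left_mono mult_mono abs_sin_x_le_abs_x) auto
  finally show ?thesis by simp
qed

lemma abs_sin_diff_le: "\<bar>sin x - sin y\<bar> \<le> \<bar>x - (y::real)\<bar>"
proof -
  have "\<bar>sin x - sin y\<bar> = 2 * (\<bar>sin ((x - y) / 2)\<bar> * \<bar>cos ((x + y) / 2)\<bar>)"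
    unfolding sin_diff_sin by (simp add: abs_mult)
  also have "\<dots> \<le> 2 * (\<bar>(x - y) / 2\<bar> * 1)"
    by (intro mult_left_mono mult_mono abs_sin_x_le_abs_x) auto
  finally show ?thesis by simp
qed

text \<open>Near a repeated factor the determinant is quadratically small, which makes the integral in the
  (CM) condition diverge already for \<open>\<gamma> = 1/2\<close>.\<close>

lemma CM_square_free:
  assumes "CM_condition A B"
  shows "square_free_pencil A B"
proof (rule ccontr)
  assume "\<not> square_free_pencil A B"
  then obtain a b c d where D: "\<And>x y. det (x *\<^sub>R A + y *\<^sub>R B) = (a * x + b * y)\<^sup>2 * (c * x + d * y)"
    unfolding square_free_pencil_def by blast
  \<comment> \<open>The direction (b, -a) annihilates the repeated linear factor; if that factor is
    zero, the angle 0 serves.\<close>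
  obtain t0 where t0: "0 \<le> t0" "t0 < 2 * pi" "a * cos t0 + b * sin t0 = 0"
  proof (cases "a = 0 \<and> b = 0")
    case True
    then show ?thesis by (intro that[of 0]) auto
  next
    case False
    define r where "r = sqrt (a\<^sup>2 + b\<^sup>2)"
    have r: "r > 0" "r\<^sup>2 = a\<^sup>2 + b\<^sup>2"
      using False by (auto simp: r_def sum_power2_gt_zero_iff)
    have "(b / r)\<^sup>2 + (- a / r)\<^sup>2 = 1"
      using r False by (simp add: power_divide add_divide_distrib[symmetric] add.commute)
    from sincos_total_2pi[OF this] obtain t where "0 \<le> t" "t < 2 * pi" "b / r = cos t" "- a / r = sin t"
      by blast
    then show ?thesis by (intro that[of t]) (auto simp flip: \<open>b / r = cos t\<close> \<open>- a / r = sin t\<close>)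
  qed
  \<comment> \<open>The added ones keep \<open>C\<close> positive even when a linear factor is
    zero.\<close>
  define C where "C = (\<bar>a\<bar> + \<bar>b\<bar> + 1)\<^sup>2 * (\<bar>c\<bar> + \<bar>d\<bar> + 1)"
  have C: "C > 0" by (auto simp: C_def intro!: mult_pos_pos add_nonneg_pos)
  have small: "\<bar>det (cos t *\<^sub>R A + sin t *\<^sub>R B)\<bar> \<le> C * (t - t0)\<^sup>2" for t
  proof -
    have "\<bar>a * cos t + b * sin t\<bar> = \<bar>a * (cos t - cos t0) + b * (sin t - sin t0)\<bar>"
      using t0(3) by (simp add: algebra_simps)
    also have "\<dots> \<le> \<bar>a\<bar> * \<bar>cos t - cos t0\<bar> + \<bar>b\<bar> * \<bar>sin t - sin t0\<bar>"
      by (metis abs_mult abs_triangle_ineq)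
    also have "\<dots> \<le> \<bar>a\<bar> * \<bar>t - t0\<bar> + \<bar>b\<bar> * \<bar>t - t0\<bar>"
      by (intro add_mono mult_left_mono abs_cos_diff_le abs_sin_diff_le) auto
    also have "\<dots> \<le> (\<bar>a\<bar> + \<bar>b\<bar> + 1) * \<bar>t - t0\<bar>" by (simp add: algebra_simps)
    finally have 1: "\<bar>a * cos t + b * sin t\<bar> \<le> (\<bar>a\<bar> + \<bar>b\<bar> + 1) * \<bar>t - t0\<bar>" .
    have "\<bar>c * cos t + d * sin t\<bar> \<le> \<bar>c\<bar> * \<bar>cos t\<bar> + \<bar>d\<bar> * \<bar>sin t\<bar>"
      by (metis abs_mult abs_triangle_ineq)
    also have "\<dots> \<le> \<bar>c\<bar> * 1 + \<bar>d\<bar> * 1" by (intro add_mono mult_left_mono) auto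
    finally have 2: "\<bar>c * cos t + d * sin t\<bar> \<le> \<bar>c\<bar> + \<bar>d\<bar> + 1" by simp
    have "\<bar>det (cos t *\<^sub>R A + sin t *\<^sub>R B)\<bar> = \<bar>a * cos t + b * sin t\<bar>\<^sup>2 * \<bar>c * cos t + d * sin t\<bar>"
      unfolding D by (simp add: abs_mult)
    also have "\<dots> \<le> ((\<bar>a\<bar> + \<bar>b\<bar> + 1) * \<bar>t - t0\<bar>)\<^sup>2 * (\<bar>c\<bar> + \<bar>d\<bar> + 1)"
      using 1 2 by (intro mult_mono power_mono) auto
    also have "\<dots> = C * (t - t0)\<^sup>2" by (simp add: C_def power_mult_distrib)
    finally show ?thesis .
  qed
  let ?F = "\<lambda>(x1, x2). inverse (ennreal (\<bar>det (x1 *\<^sub>R A + x2 *\<^sub>R B)\<bar> powr (1 / 2)))"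
  have F: "?F \<in> borel_measurable borel"
    unfolding case_prod_beta' det_3 by simp measurable
  have fin: "(\<integral>\<^sup>+t\<in>{0..<2 * pi}. ?F (cos t, sin t) \<partial>lborel) < \<infinity>"
    using assms unfolding CM_condition_def nn_integral_circle_arc_length[OF F, symmetric]
    by (elim allE[of _ "1 / 2"]) simp
  have "\<top> = ennreal (1 / sqrt C) * \<top>"
    using C by (simp add: ennreal_mult_top)
  also have "\<dots> = ennreal (1 / sqrt C) * (\<integral>\<^sup>+t. ennreal (1 / t) * indicator {0<..<2 * pi - t0} t \<partial>lborel)"
    using t0 by (simp add: nn_integral_inverse_infinite)
  also have "(\<integral>\<^sup>+t. ennreal (1 / t) * indicator {0<..<2 * pi - t0} t \<partial>lborel)
      = (\<integral>\<^sup>+t. ennreal (1 / (t - t0)) * indicator {0<..<2 * pi - t0} (t - t0) \<partial>lborel)"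
    by (rule nn_integral_lborel_shift'(2)[symmetric]) measurable
  also have "ennreal (1 / sqrt C) * \<dots> = (\<integral>\<^sup>+t. ennreal (1 / sqrt C) * (ennreal (1 / (t - t0)) * indicator {0<..<2 * pi - t0} (t - t0)) \<partial>lborel)"
    by (rule nn_integral_cmult[symmetric]) measurable
  also have "\<dots> \<le> (\<integral>\<^sup>+t\<in>{0..<2 * pi}. ?F (cos t, sin t) \<partial>lborel)"
  proof (rule nn_integral_mono)
    fix t :: real
    show "ennreal (1 / sqrt C) * (ennreal (1 / (t - t0)) * indicator {0<..<2 * pi - t0} (t - t0))
      \<le> ?F (cos t, sin t) * indicator {0..<2 * pi} t"
    \<comment> \<open>One side of t0 suffices for divergence: the comparison function is a multiple
      of 1 / (t - t0) on an interval that is nonempty because t0 < 2 pi.\<close>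
    proof (cases "t0 < t \<and> t < 2 * pi")
      case True
      let ?D = "\<bar>det (cos t *\<^sub>R A + sin t *\<^sub>R B)\<bar>"
      have "?D powr (1 / 2) = sqrt ?D" by (simp add: powr_half_sqrt)
      also have "\<dots> \<le> sqrt (C * (t - t0)\<^sup>2)" by (rule real_sqrt_le_mono[OF small])
      also have "\<dots> = sqrt C * (t - t0)" using True by (simp add: real_sqrt_mult)
      finally have le: "?D powr (1 / 2) \<le> sqrt C * (t - t0)" .
      have pos: "sqrt C * (t - t0) > 0" using True C by simp
      have "ennreal (1 / sqrt C) * ennreal (1 / (t - t0)) = inverse (ennreal (sqrt C * (t - t0)))"
        using True C pos by (simp add: ennreal_mult[symmetric] inverse_ennreal inverse_eq_divide)
      also have "\<dots> \<le> inverse (ennreal (?D powr (1 / 2)))"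
      proof (cases "?D powr (1 / 2) = 0")
        case False
        then have "?D powr (1 / 2) > 0" by (metis powr_ge_zero order_le_less)
        then show ?thesis
          using le pos by (simp only: inverse_ennreal) (intro ennreal_leI le_imp_inverse_le)
      qed simp
      finally show ?thesis using True t0 by (simp add: indicator_def)
    qed (auto simp: indicator_def)
  qed
  also have "\<dots> < \<infinity>" by (rule fin)
  finally show False by simp
qed

lemma det_uminus_3: "det (- M) = - det (M::real^3^3)"
  by (simp add: det_3)

lemma normal_form_uminus:
  assumes "normal_form w P"
  shows "normal_form (\<lambda>u. - w u) P"
proof -
  have neg: "- (P *v vector [x, y, z]) = P *v (vector [- x, - y, - z] :: real^3)" for x y z
    by (simp add: vec_eq_iff matrix_vector_mult_def sum_3)
  from assms consider c1 c2 c3 where "c1 \<noteq> 0" "c2 \<noteq> 0" "c3 \<noteq> 0"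
      "\<And>u. w (P *v u) = P *v vector [c1 * (u$2 * u$3), c2 * (u$1 * u$3), c3 * (u$1 * u$2)]"
    | c a b where "c \<noteq> 0" "a \<noteq> 0 \<or> b \<noteq> 0"
      "\<And>u. w (P *v u) = P *v vector [c * ((u$2)\<^sup>2 + (u$3)\<^sup>2), u$1 * (a * u$2 + b * u$3), u$1 * (b * u$2 - a * u$3)]"
    unfolding normal_form_def by blast
  then show ?thesis
  proof cases
    case (1 c1 c2 c3)
    then show ?thesis
      unfolding normal_form_def
      by (intro disjI1 exI[of _ "- c1"] exI[of _ "- c2"] exI[of _ "- c3"]) (simp add: neg)
  next
    case (2 c a b)
    then show ?thesis
      unfolding normal_form_def
      by (intro disjI2 exI[of _ "- c"] exI[of _ "- a"] exI[of _ "- b"]) (auto simp add: neg algebra_simps)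
  qed
qed

text \<open>The determinant has odd degree in the pencil parameters, so it changes sign along a half
  circle and some member B' is singular. The orthogonal change to (A', B') keeps square-freeness and
  multiplies the cross product by -1.\<close>

lemma pencil_normal_form:
  assumes sym: "transpose A = A" "transpose B = B" and sf: "square_free_pencil A B"
  shows "\<exists>P. det P \<noteq> 0 \<and> normal_form (cross_map A B) P"
proof -
  define h where "h t = det (cos t *\<^sub>R A + sin t *\<^sub>R B)" for t
  have cont: "continuous_on S h" for S
    unfolding h_def det_3 by (intro continuous_intros)
  have "h pi = - h 0"
    unfolding h_def by (simp add: det_uminus_3)
  then have "\<exists>t. h t = 0"
    using IVT'[of h 0 0 pi] IVT2'[of h pi 0 0] cont pi_ge_zero
    by (metis linear neg_0_le_iff_le neg_le_0_iff_le)
  then obtain t where t: "h t = 0" by blast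
  define s c where "s = sin t" and "c = cos t"
  have sc: "s * s + c * c = 1" using sin_cos_squared_add[of t] by (simp add: s_def c_def power2_eq_square)
  define A' where "A' = (- s) *\<^sub>R A + c *\<^sub>R B"
  define B' where "B' = c *\<^sub>R A + s *\<^sub>R B"
  have det0: "det B' = 0" using t by (simp add: h_def B'_def s_def c_def)
  have sym': "transpose A' = A'" "transpose B' = B'"
    unfolding A'_def B'_def by (intro transpose_pencil sym)+
  \<comment> \<open>The change of pair is a reflection, hence its own inverse; a factorization for
    (A', B') pulls back to one for (A, B).\<close>
  have rotate_rotate: "(- s * X + c * Y) *\<^sub>R A' + (c * X + s * Y) *\<^sub>R B' = X *\<^sub>R A + Y *\<^sub>R B" for X Y
  proof -
    have "(- s * X + c * Y) *\<^sub>R A' + (c * X + s * Y) *\<^sub>R B' = ((s * s + c * c) * X) *\<^sub>R A + ((s * s + c * c) * Y) *\<^sub>R B"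
      by (simp add: A'_def B'_def algebra_simps)
    then show ?thesis by (simp add: sc)
  qed
  have sf': "square_free_pencil A' B'"
    unfolding square_free_pencil_def
  proof (intro notI, elim exE)
    fix \<alpha> \<beta> \<gamma> \<delta> assume "\<forall>x y. det (x *\<^sub>R A' + y *\<^sub>R B') = (\<alpha> * x + \<beta> * y)\<^sup>2 * (\<gamma> * x + \<delta> * y)"
    then have "det (X *\<^sub>R A + Y *\<^sub>R B) = (\<alpha> * (- s * X + c * Y) + \<beta> * (c * X + s * Y))\<^sup>2 * (\<gamma> * (- s * X + c * Y) + \<delta> * (c * X + s * Y))" for X Y
      unfolding rotate_rotate[symmetric, of X Y] by blast
    then have "\<forall>X Y. det (X *\<^sub>R A + Y *\<^sub>R B) = ((c * \<beta> - s * \<alpha>) * X + (c * \<alpha> + s * \<beta>) * Y)\<^sup>2 * ((c * \<delta> - s * \<gamma>) * X + (c * \<gamma> + s * \<delta>) * Y)"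
      by (simp add: algebra_simps)
    then show False using sf unfolding square_free_pencil_def by blast
  qed
  have cm: "cross_map A B u = - cross_map A' B' u" for u
  proof -
    have "cross3 ((- s) *\<^sub>R p + c *\<^sub>R q) (c *\<^sub>R p + s *\<^sub>R q) = - ((s * s + c * c) *\<^sub>R cross3 p q)" for p q
      by (simp add: cross3_simps forall_3)
    then have "cross_map A' B' u = - ((s * s + c * c) *\<^sub>R cross_map A B u)"
      unfolding cross_map_def A'_def B'_def pencil_mult .
    then show ?thesis by (simp add: sc)
  qed
  obtain P where "det P \<noteq> 0" and nf: "normal_form (cross_map A' B') P"
    using pencil_normal_form_singular[OF sym' sf' det0] by blast
  moreover have "normal_form (cross_map A B) P"
  proof -
    have "cross_map A B = (\<lambda>u. - cross_map A' B' u)"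
      by (rule ext) (rule cm)
    then show ?thesis
      using normal_form_uminus[OF nf] by (simp only:)
  qed
  ultimately show ?thesis by blast
qed

section \<open>The parallelogram integral under the (CM) condition\<close>

lemma AE_lborel_fst_snd:
  fixes Q1 :: "'a::euclidean_space \<Rightarrow> bool" and Q2 :: "'b::euclidean_space \<Rightarrow> bool"
  assumes "AE x in lborel. Q1 x" "AE y in lborel. Q2 y"
    and [measurable]: "{x. Q1 x} \<in> sets borel" "{y. Q2 y} \<in> sets borel"
  shows "AE z in lborel. Q1 (fst z) \<and> Q2 (snd z)"
proof -
  have "AE z in (lborel :: 'a measure) \<Otimes>\<^sub>M (lborel :: 'b measure). Q1 (fst z) \<and> Q2 (snd z)"
  proof (rule lborel_pair.AE_pair_measure)
    have "{z \<in> space ((lborel :: 'a measure) \<Otimes>\<^sub>M (lborel :: 'b measure)). Q1 (fst z) \<and> Q2 (snd z)} = {x. Q1 x} \<times> {y. Q2 y}"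
      by (auto simp: space_pair_measure)
    also have "\<dots> \<in> sets (lborel \<Otimes>\<^sub>M lborel)"
      by (intro pair_measureI) auto
    finally show "{z \<in> space ((lborel :: 'a measure) \<Otimes>\<^sub>M (lborel :: 'b measure)). Q1 (fst z) \<and> Q2 (snd z)} \<in> sets (lborel \<Otimes>\<^sub>M lborel)" .
    show "AE x in lborel. AE y in lborel. Q1 (fst (x, y)) \<and> Q2 (snd (x, y))"
      using assms(1)
    proof eventually_elim
      case (elim x)
      then show ?case using assms(2) by simp
    qed
  qed
  then show ?thesis unfolding lborel_prod .
qed

lemma AE_linear_iso_nonzero:
  fixes P :: "'m::euclidean_space \<Rightarrow> 'n::euclidean_space" and w :: "'n \<Rightarrow> 'n"
  assumes P: "linear P" "bij P" and [measurable]: "w \<in> borel_measurable borel"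
    and N: "AE u in lborel. w (P u) \<noteq> 0"
  shows "AE x in lborel. w x \<noteq> 0"
proof -
  obtain k where k: "k > 0"
    "\<And>f::'n \<Rightarrow> ennreal. f \<in> borel_measurable borel \<Longrightarrow> (\<integral>\<^sup>+x. f (P x) \<partial>lborel) = ennreal k * (\<integral>\<^sup>+y. f y \<partial>lborel)"
    using linear_iso_nn_integral[OF P] by metis
  define f where "f x = (indicator {0} (w x) :: ennreal)" for x
  have [measurable]: "f \<in> borel_measurable borel" unfolding f_def by measurable
  have "(\<integral>\<^sup>+x. f (P x) \<partial>lborel) = (\<integral>\<^sup>+x. 0 \<partial>(lborel :: 'm measure))"
    by (rule nn_integral_cong_AE, use N in eventually_elim) (simp add: f_def)
  then have "(\<integral>\<^sup>+x. f x \<partial>lborel) = 0"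
    using k(1) k(2)[of f] by simp
  then have "AE x in lborel. f x = 0"
    by (subst (asm) nn_integral_0_iff_AE) auto
  then show ?thesis by eventually_elim (auto simp: f_def indicator_def)
qed

lemma Lambda_bound_of_normal_form:
  fixes P :: "'m::euclidean_space \<Rightarrow> real^3" and N :: "'m \<Rightarrow> real"
  assumes p: "p > 0" and \<theta>: "\<theta> < 1" and T: "parallelogram_bounded p \<theta> R W"
    and P: "linear P" "bij P" and N: "N \<in> borel_measurable borel" "AE u in lborel. N u \<noteq> 0"
    and w: "w \<in> borel_measurable borel" "\<And>u. N u \<noteq> 0 \<Longrightarrow> w (P u) = N u *\<^sub>R P (R u)"
    and W: "\<And>u. N u \<noteq> 0 \<Longrightarrow> W u = ennreal (1 / \<bar>N u\<bar>)"
    and B: "B \<ge> 0" "\<And>u l. N u \<noteq> 0 \<Longrightarrow> \<bar>l\<bar> \<le> B * (norm u * norm (l *\<^sub>R R u))"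
    and K: "bounded K"
  shows "(AE u in lborel. w u \<noteq> 0) \<and> Lambda_bounded K p w"
proof
  show "AE u in lborel. w u \<noteq> 0"
  proof (rule AE_linear_iso_nonzero[OF P w(1)], use N(2) in eventually_elim)
    fix u assume u: "N u \<noteq> 0"
    \<comment> \<open>The case l = 1 of the bound by \<open>B\<close> would read 1 <= 0 if
      \<open>R u\<close> were zero.\<close>
    have "R u \<noteq> 0" using B(2)[OF u, of 1] by auto
    then have "P (R u) \<noteq> 0"
      using P by (metis bij_is_inj linear_0 injD)
    then show "w (P u) \<noteq> 0" using w(2)[OF u] u by simp
  qed
qed (rule Lambda_le_of_parallelogram_bounded[OF p \<theta> T P N(1) w(1) N(2) w(2) W B K]; assumption)

lemma Lambda_bound:
  assumes sym: "transpose A = A" "transpose B = B" and cm: "CM_condition A B"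
    and K: "bounded K" and p: "12 / 5 < p" "p < 4"
  shows "(AE u in lborel. cross_map A B u \<noteq> 0) \<and> Lambda_bounded K p (cross_map A B)"
proof -
  \<comment> \<open>The exponent per real dimension; for p > 12/5 three of them sum to less than
    1.\<close>
  define \<beta> where "\<beta> = (4 / p - 1) / 2"
  have \<beta>: "\<beta> + (\<beta> + \<beta>) < 1" using p by (simp add: \<beta>_def field_simps)
  have p2: "2 < p" using p by simp
  have wm: "cross_map A B \<in> borel_measurable borel"
    using cross_map_measurable[of "\<lambda>x. x" borel] by simp
  have T1: "parallelogram_bounded p \<beta> (\<lambda>u. c / u) (\<lambda>u. ennreal (1 / \<bar>u\<bar>))" if "c \<noteq> 0" for c :: real
    using parallelogram_bounded_field[OF p2 p(2) that] by (simp add: \<beta>_def)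
  have T2: "parallelogram_bounded p (\<beta> + \<beta>) (\<lambda>u. c / u) (\<lambda>u. ennreal (1 / (cmod u)\<^sup>2))" if "c \<noteq> 0" for c :: complex
    using parallelogram_bounded_field[OF p2 p(2) that] by (simp add: \<beta>_def)
  have nz: "{x::'a::euclidean_space. x \<noteq> 0} \<in> sets borel" by simp
  \<comment> \<open>The first coordinate alone gives the cutoff in both normal forms: u1 times l c /
    u1 is l c, and each factor is at most the norm of its whole vector.\<close>
  have size: "\<bar>l\<bar> \<le> 1 / \<bar>c\<bar> * (norm u * norm (l *\<^sub>R v))"
    if c: "c \<noteq> 0" and u: "fst u \<noteq> 0" and v: "fst v = c / fst u" for l c :: real and u v :: "real \<times> 'b::euclidean_space"
  proof -
    have "\<bar>fst z\<bar> \<le> norm z" for z :: "real \<times> 'b"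
      using norm_fst_le[of "fst z" "snd z"] by simp
    then have "\<bar>fst u\<bar> * \<bar>fst (l *\<^sub>R v)\<bar> \<le> norm u * norm (l *\<^sub>R v)"
      by (intro mult_mono) (simp_all only: norm_ge_zero abs_ge_zero)
    moreover have "\<bar>fst u\<bar> * \<bar>fst (l *\<^sub>R v)\<bar> = \<bar>l\<bar> * \<bar>c\<bar>"
    proof -
      have "fst u * fst (l *\<^sub>R v) = l * c" using u v by simp
      then show ?thesis by (simp only: abs_mult[symmetric])
    qed
    ultimately show ?thesis using c by (simp add: field_simps)
  qed
  obtain P where P: "det P \<noteq> 0" and alt: "normal_form (cross_map A B) P"
    using pencil_normal_form[OF sym CM_square_free[OF cm]] by blast
  have bijP: "bij ((*v) P)"
    using P by (simp add: invertible_det_nz invertible_eq_bij[symmetric])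
  from alt consider c1 c2 c3 where "c1 \<noteq> 0" "c2 \<noteq> 0" "c3 \<noteq> 0"
      "\<forall>u. cross_map A B (P *v u) = P *v vector [c1 * (u$2 * u$3), c2 * (u$1 * u$3), c3 * (u$1 * u$2)]"
    | c a b where "c \<noteq> 0" "a \<noteq> 0 \<or> b \<noteq> 0"
      "\<forall>u. cross_map A B (P *v u) = P *v vector [c * ((u$2)\<^sup>2 + (u$3)\<^sup>2), u$1 * (a * u$2 + b * u$3), u$1 * (b * u$2 - a * u$3)]"
    unfolding normal_form_def by blast
  then show ?thesis
  proof cases
    fix c1 c2 c3 assume c: "c1 \<noteq> 0" "c2 \<noteq> 0" "c3 \<noteq> 0"
      and nf: "\<forall>u. cross_map A B (P *v u) = P *v vector [c1 * (u$2 * u$3), c2 * (u$1 * u$3), c3 * (u$1 * u$2)]"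
    define V :: "real \<times> real \<times> real \<Rightarrow> real^3" where "V z = vector [fst z, fst (snd z), snd (snd z)]" for z
    have linV: "linear V" by (rule linearI) (simp_all add: V_def vec_eq_iff forall_3)
    have bijV: "bij V"
      by (rule bij_betw_byWitness[where f'="\<lambda>x. (x $ 1, x $ 2, x $ 3)"]) (auto simp: V_def vec_eq_iff forall_3)
    define N where "N u = fst u * (fst (snd u) * snd (snd u))" for u :: "real \<times> real \<times> real"
    define R where "R u = (c1 / fst u, c2 / fst (snd u), c3 / snd (snd u))" for u :: "real \<times> real \<times> real"
    have T: "parallelogram_bounded p (\<beta> + (\<beta> + \<beta>)) R (\<lambda>u. ennreal (1 / \<bar>fst u\<bar>) * (ennreal (1 / \<bar>fst (snd u)\<bar>) * ennreal (1 / \<bar>snd (snd u)\<bar>)))"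
      using parallelogram_bounded_prod[OF _ T1[OF c(1)] parallelogram_bounded_prod[OF _ T1[OF c(2)] T1[OF c(3)]]] p2
      by (simp add: R_def[abs_def])
    show ?thesis
    proof (rule Lambda_bound_of_normal_form[OF _ \<beta> T _ _ _ _ wm])
      show "p > 0" using p by simp
      show "linear (\<lambda>z. P *v V z)"
        using linear_compose[OF linV matrix_vector_mul_linear[of P]] by (simp add: o_def)
      show "bij (\<lambda>z. P *v V z)"
        using bij_comp[OF bijV bijP] by (simp add: o_def)
      show "N \<in> borel_measurable borel" unfolding N_def by measurable
      have "AE u in (lborel :: (real \<times> real \<times> real) measure). fst u \<noteq> 0 \<and> (fst (snd u) \<noteq> 0 \<and> snd (snd u) \<noteq> 0)"
      proof (rule AE_lborel_fst_snd[where ?Q1.0="\<lambda>x::real. x \<noteq> 0" and ?Q2.0="\<lambda>y::real \<times> real. fst y \<noteq> 0 \<and> snd y \<noteq> 0",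
          OF AE_lborel_nonzero _ nz])
        show "AE y::real \<times> real in lborel. fst y \<noteq> 0 \<and> snd y \<noteq> 0"
          by (rule AE_lborel_fst_snd[OF AE_lborel_nonzero AE_lborel_nonzero nz nz])
        have "{y::real \<times> real. fst y \<noteq> 0 \<and> snd y \<noteq> 0} = {y. fst y * snd y \<in> - {0}}" by auto
        also have "\<dots> \<in> sets borel" by measurable
        finally show "{y::real \<times> real. fst y \<noteq> 0 \<and> snd y \<noteq> 0} \<in> sets borel" .
      qed
      then show "AE u in lborel. N u \<noteq> 0" by eventually_elim (simp add: N_def)
      fix u :: "real \<times> real \<times> real" assume u: "N u \<noteq> 0"
      then have u': "fst u \<noteq> 0" "fst (snd u) \<noteq> 0" "snd (snd u) \<noteq> 0" by (auto simp: N_def)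
      have "vector [c1 * (V u $ 2 * V u $ 3), c2 * (V u $ 1 * V u $ 3), c3 * (V u $ 1 * V u $ 2)] = N u *\<^sub>R V (R u)"
        using u' by (simp add: V_def N_def R_def vec_eq_iff forall_3)
      then show "cross_map A B (P *v V u) = N u *\<^sub>R (P *v V (R u))"
        using nf by (simp add: matrix_vector_mult_scaleR)
      show "ennreal (1 / \<bar>fst u\<bar>) * (ennreal (1 / \<bar>fst (snd u)\<bar>) * ennreal (1 / \<bar>snd (snd u)\<bar>)) = ennreal (1 / \<bar>N u\<bar>)"
        by (simp add: ennreal_mult[symmetric] N_def abs_mult)
      show "\<bar>l\<bar> \<le> 1 / \<bar>c1\<bar> * (norm u * norm (l *\<^sub>R R u))" for l
        using c u' by (intro size) (auto simp: R_def)
    qed (use K in auto)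
  next
    fix c a b assume c: "c \<noteq> 0" and ab: "a \<noteq> 0 \<or> b \<noteq> 0"
      and nf: "\<forall>u. cross_map A B (P *v u) = P *v vector [c * ((u$2)\<^sup>2 + (u$3)\<^sup>2), u$1 * (a * u$2 + b * u$3), u$1 * (b * u$2 - a * u$3)]"
    define V :: "real \<times> complex \<Rightarrow> real^3" where "V z = vector [fst z, Re (snd z), Im (snd z)]" for z
    have linV: "linear V" by (rule linearI) (simp_all add: V_def vec_eq_iff forall_3)
    have bijV: "bij V"
      by (rule bij_betw_byWitness[where f'="\<lambda>x. (x $ 1, Complex (x $ 2) (x $ 3))"]) (auto simp: V_def vec_eq_iff forall_3 complex_eq_iff)
    define N where "N u = fst u * (cmod (snd u))\<^sup>2" for u :: "real \<times> complex"
    define R where "R u = (c / fst u, Complex a b / snd u)" for u :: "real \<times> complex"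
    have ab': "Complex a b \<noteq> 0" using ab by (simp add: complex_eq_iff)
    have T: "parallelogram_bounded p (\<beta> + (\<beta> + \<beta>)) R (\<lambda>u. ennreal (1 / \<bar>fst u\<bar>) * ennreal (1 / (cmod (snd u))\<^sup>2))"
      using parallelogram_bounded_prod[OF _ T1[OF c] T2[OF ab']] p2
      by (simp add: R_def[abs_def])
    show ?thesis
    proof (rule Lambda_bound_of_normal_form[OF _ \<beta> T _ _ _ _ wm])
      show "p > 0" using p by simp
      show "linear (\<lambda>z. P *v V z)"
        using linear_compose[OF linV matrix_vector_mul_linear[of P]] by (simp add: o_def)
      show "bij (\<lambda>z. P *v V z)"
        using bij_comp[OF bijV bijP] by (simp add: o_def)
      show "N \<in> borel_measurable borel" unfolding N_def by measurable
      have "AE u in lborel. (fst u \<noteq> (0::real) \<and> snd u \<noteq> (0::complex))"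
        by (rule AE_lborel_fst_snd[OF AE_lborel_nonzero AE_lborel_nonzero nz nz])
      then show "AE u in lborel. N u \<noteq> 0" by eventually_elim (simp add: N_def)
      fix u :: "real \<times> complex" assume u: "N u \<noteq> 0"
      then have u': "fst u \<noteq> 0" "snd u \<noteq> 0" by (auto simp: N_def)
      have n: "(cmod (snd u))\<^sup>2 = (Re (snd u))\<^sup>2 + (Im (snd u))\<^sup>2" by (rule cmod_power2)
      have n0: "(Re (snd u))\<^sup>2 + (Im (snd u))\<^sup>2 \<noteq> 0" using u' n by (metis power2_eq_iff_nonneg norm_eq_zero zero_eq_power2)
      \<comment> \<open>Division by u2 + i u3 is multiplication by its conjugate over its squared
        modulus; the factor N(u) leaves u1 (a + i b) (u2 - i u3), whose real and imaginary parts are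
        the last two entries.\<close>
      have "vector [c * ((V u $ 2)\<^sup>2 + (V u $ 3)\<^sup>2), V u $ 1 * (a * V u $ 2 + b * V u $ 3), V u $ 1 * (b * V u $ 2 - a * V u $ 3)] = N u *\<^sub>R V (R u)"
        using u' n0 by (simp add: V_def N_def R_def vec_eq_iff forall_3 n Re_divide Im_divide)
      then show "cross_map A B (P *v V u) = N u *\<^sub>R (P *v V (R u))"
        using nf by (simp add: matrix_vector_mult_scaleR)
      show "ennreal (1 / \<bar>fst u\<bar>) * ennreal (1 / (cmod (snd u))\<^sup>2) = ennreal (1 / \<bar>N u\<bar>)"
        by (simp add: ennreal_mult[symmetric] N_def abs_mult)
      show "\<bar>l\<bar> \<le> 1 / \<bar>c\<bar> * (norm u * norm (l *\<^sub>R R u))" for l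
        using c u' by (intro size) (auto simp: R_def)
    qed (use K in auto)
  qed
qed

section \<open>The extension estimate\<close>

text \<open>\<open>Lp_space (lebesgue_on K) p\<close> admits functions that are only Lebesgue
  measurable, while the estimates concern Borel functions on \<open>lborel\<close>. Extension by
  zero and a change on a null set connect the two.\<close>

lemma borel_representative:
  fixes f :: "real^3 \<Rightarrow> complex"
  assumes K: "compact K" and f: "f \<in> borel_measurable (lebesgue_on K)"
  obtains g where "g \<in> borel_measurable borel" "\<And>x. x \<notin> K \<Longrightarrow> g x = 0"
    "AE x in lebesgue. indicator K x *\<^sub>R f x = g x"
proof -
  have Ks [measurable]: "K \<in> sets borel" using K by (simp add: borel_compact)
  then have "K \<inter> space lebesgue \<in> sets lebesgue" by simp
  then have m: "(\<lambda>x. indicator K x *\<^sub>R f x) \<in> borel_measurable lebesgue"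
    using f by (subst (asm) borel_measurable_restrict_space_iff) simp_all
  have "(\<lambda>x. Re (indicator K x *\<^sub>R f x)) \<in> borel_measurable (completion lborel)"
    "(\<lambda>x. Im (indicator K x *\<^sub>R f x)) \<in> borel_measurable (completion lborel)"
    using m by measurable
  from this[THEN completion_ex_borel_measurable_real]
  obtain r i where ri [measurable]: "r \<in> borel_measurable borel" "i \<in> borel_measurable borel"
    and ae: "AE x in lborel. Re (indicator K x *\<^sub>R f x) = r x" "AE x in lborel. Im (indicator K x *\<^sub>R f x) = i x"
    by auto
  define g where "g x = indicator K x *\<^sub>R (complex_of_real (r x) + \<i> * complex_of_real (i x))" for x
  show ?thesis
  proof (rule that)
    show "g \<in> borel_measurable borel" unfolding g_def by measurable
    show "g x = 0" if "x \<notin> K" for x using that by (simp add: g_def)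
    have "AE x in lborel. indicator K x *\<^sub>R f x = g x"
      using ae by eventually_elim (auto simp: g_def complex_eq_iff indicator_def)
    then show "AE x in lebesgue. indicator K x *\<^sub>R f x = g x" by (rule AE_completion)
  qed
qed

text \<open>\<open>\<kappa>\<close> ranges over the positive numbers that are at least the \<open>L\<^sup>p\<close> norm, which covers functions of
  norm zero as well.\<close>

lemma Lp_norm_dominates:
  fixes f :: "real^3 \<Rightarrow> complex" and g :: "real^3 \<Rightarrow> complex" and p :: ennreal and q :: real
  assumes K: "compact K" and f: "f \<in> Lp_space (lebesgue_on K) p"
    and q: "q > 0" "p = \<infinity> \<or> q \<le> enn2real p"
    and g: "g \<in> borel_measurable borel" "\<And>x. x \<notin> K \<Longrightarrow> g x = 0" "AE x in lebesgue. indicator K x *\<^sub>R f x = g x"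
    and \<kappa>: "\<kappa> > 0" "\<kappa> \<ge> Lp_norm (lebesgue_on K) p f"
  shows "(\<integral>\<^sup>+x. epow (ennreal (cmod (g x))) q \<partial>lborel) \<le> ennreal (\<kappa> powr q * (measure lborel K + 1))"
proof -
  have Ks [measurable]: "K \<in> sets borel" using K by (simp add: borel_compact)
  have Ks': "K \<inter> space lebesgue \<in> sets lebesgue" by simp
  note g(1)[measurable]
  have fm: "f \<in> borel_measurable (lebesgue_on K)" using f by (simp add: Lp_space_def)
  have eK: "emeasure lborel K = ennreal (measure lborel K)"
    using emeasure_bounded_finite[OF compact_imp_bounded[OF K]] by (simp add: emeasure_eq_ennreal_measure)
  show ?thesis
  proof (cases "p = \<infinity>")
    case True
    let ?s = "esssup (lebesgue_on K) (\<lambda>x. ennreal (cmod (f x)))"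
    have s: "?s < \<infinity>" "enn2real ?s \<le> \<kappa>"
      using f \<kappa> True by (auto simp: Lp_space_def Lp_norm_def)
    then have "?s \<le> ennreal \<kappa>"
      by (metis ennreal_enn2real ennreal_leI infinity_ennreal_def)
    then have "AE x in lebesgue_on K. ennreal (cmod (f x)) \<le> ennreal \<kappa>"
      using esssup_AE[of "\<lambda>x. ennreal (cmod (f x))" "lebesgue_on K"] by (auto elim!: eventually_mono)
    then have "AE x in lebesgue. x \<in> K \<longrightarrow> cmod (f x) \<le> \<kappa>"
      using \<kappa>(1) by (subst (asm) AE_restrict_space_iff) auto
    then have "AE x in lebesgue. cmod (g x) \<le> \<kappa>"
      using g(3)
    proof eventually_elim
      case (elim x)
      then show ?case using \<kappa>(1) g(2)[of x] by (cases "x \<in> K") auto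
    qed
    then have "AE x in lborel. cmod (g x) \<le> \<kappa>" by (simp add: AE_completion_iff)
    then have "(\<integral>\<^sup>+x. epow (ennreal (cmod (g x))) q \<partial>lborel) \<le> (\<integral>\<^sup>+x. ennreal (\<kappa> powr q) * indicator K x \<partial>lborel)"
    proof (intro nn_integral_mono_AE, eventually_elim)
      fix x assume "cmod (g x) \<le> \<kappa>"
      then show "epow (ennreal (cmod (g x))) q \<le> ennreal (\<kappa> powr q) * indicator K x"
        using g(2)[of x] q(1) by (auto simp: epow_ennreal indicator_def intro!: ennreal_leI powr_mono2)
    qed
    also have "\<dots> = ennreal (\<kappa> powr q * measure lborel K)"
      by (subst nn_integral_cmult_indicator) (auto simp: eK ennreal_mult)
    also have "\<dots> \<le> ennreal (\<kappa> powr q * (measure lborel K + 1))"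
      by (intro ennreal_leI mult_left_mono) auto
    finally show ?thesis .
  next
    case False
    define P where "P = enn2real p"
    have P: "q \<le> P" "P > 0" using q False by (auto simp: P_def)
    define I where "I = (\<integral>x. cmod (f x) powr P \<partial>lebesgue_on K)"
    have int: "integrable (lebesgue_on K) (\<lambda>x. cmod (f x) powr P)"
      using f False by (simp add: Lp_space_def P_def)
    have I0: "I \<ge> 0" unfolding I_def by (rule integral_nonneg_AE) simp
    have N: "I powr (1 / P) \<le> \<kappa>"
      using \<kappa> False by (simp add: Lp_norm_def I_def P_def)
    have "I = (I powr (1 / P)) powr P" using I0 P by (simp add: powr_powr)
    also have "\<dots> \<le> \<kappa> powr P" using N P by (intro powr_mono2) auto
    finally have I: "I \<le> \<kappa> powr P" .
    have "(\<integral>\<^sup>+x. ennreal (cmod (g x) powr P) \<partial>lborel) = (\<integral>\<^sup>+x. ennreal (cmod (g x) powr P) \<partial>lebesgue)"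
      by (simp add: nn_integral_completion)
    also have "\<dots> = (\<integral>\<^sup>+x. ennreal (cmod (f x) powr P) * indicator K x \<partial>lebesgue)"
      by (rule nn_integral_cong_AE, use g(3) in eventually_elim)
        (use P g(2) in \<open>auto simp: indicator_def split: if_splits\<close>)
    also have "\<dots> = (\<integral>\<^sup>+x. ennreal (cmod (f x) powr P) \<partial>lebesgue_on K)"
      by (rule nn_integral_restrict_space[OF Ks', symmetric])
    also have "\<dots> = ennreal I"
      unfolding I_def by (rule nn_integral_eq_integral[OF int]) simp
    finally have gI: "(\<integral>\<^sup>+x. ennreal (cmod (g x) powr P) \<partial>lborel) = ennreal I" .
    have "(\<integral>\<^sup>+x. epow (ennreal (cmod (g x))) q \<partial>lborel)
      \<le> (\<integral>\<^sup>+x. (ennreal (\<kappa> powr q) * indicator K x + ennreal (\<kappa> powr (q - P)) * ennreal (cmod (g x) powr P)) \<partial>lborel)"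
    proof (rule nn_integral_mono)
      fix x
      show "epow (ennreal (cmod (g x))) q \<le> ennreal (\<kappa> powr q) * indicator K x + ennreal (\<kappa> powr (q - P)) * ennreal (cmod (g x) powr P)"
      \<comment> \<open>Cutting at height \<kappa> takes the place of Hoelder: below it |g|^q is at
        most \<kappa>^q on \<open>K\<close>, above it at most \<kappa>^(q - P) |g|^P because q <=
        P.\<close>
      proof (cases "cmod (g x) \<le> \<kappa>")
        case True
        then have "epow (ennreal (cmod (g x))) q \<le> ennreal (\<kappa> powr q) * indicator K x"
          using g(2)[of x] q(1) by (auto simp: epow_ennreal indicator_def intro!: ennreal_leI powr_mono2)
        then show ?thesis by (rule order_trans) simp
      next
        case False
        then have pos: "cmod (g x) > 0" using \<kappa>(1) by linarith
        have "cmod (g x) powr q = cmod (g x) powr (q - P) * cmod (g x) powr P"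
          by (simp add: powr_add[symmetric])
        also have "\<dots> \<le> \<kappa> powr (q - P) * cmod (g x) powr P"
          using False \<kappa> P by (intro mult_right_mono powr_mono2') auto
        finally have "epow (ennreal (cmod (g x))) q \<le> ennreal (\<kappa> powr (q - P)) * ennreal (cmod (g x) powr P)"
          by (simp add: epow_ennreal ennreal_mult[symmetric] ennreal_leI)
        then show ?thesis by (rule order_trans) simp
      qed
    qed
    also have "\<dots> = ennreal (\<kappa> powr q) * emeasure lborel K + ennreal (\<kappa> powr (q - P)) * ennreal I"
      by (subst nn_integral_add) (auto simp: nn_integral_cmult nn_integral_cmult_indicator gI)
    also have "\<dots> = ennreal (\<kappa> powr q * measure lborel K + \<kappa> powr (q - P) * I)"
      using I0 by (simp add: eK ennreal_mult ennreal_plus)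
    also have "\<dots> \<le> ennreal (\<kappa> powr q * (measure lborel K + 1))"
    proof (intro ennreal_leI)
      have "\<kappa> powr (q - P) * I \<le> \<kappa> powr (q - P) * \<kappa> powr P" by (intro mult_left_mono I) simp
      also have "\<dots> = \<kappa> powr q" using \<kappa> by (simp add: powr_add[symmetric])
      finally show "\<kappa> powr q * measure lborel K + \<kappa> powr (q - P) * I \<le> \<kappa> powr q * (measure lborel K + 1)"
        by (simp add: algebra_simps)
    qed
    finally show ?thesis .
  qed
qed

theorem theorem1p2:
  fixes A B :: "real^3^3" and K :: "(real^3) set"
  assumes "transpose A = A" and "transpose B = B"
    and "CM_condition A B"
    and "compact K"
  shows "\<forall>p::ennreal. p > ennreal (12/5) \<longrightarrow> extension_estimate A B K p 4"
proof (intro allI impI)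
  fix p :: ennreal assume p: "p > ennreal (12 / 5)"
  \<comment> \<open>The form bounds need an exponent in (12/5, 4). For p above 3 the value 3 serves,
    since the L^p norm controls the L^q norm on the bounded set \<open>K\<close>.\<close>
  define q where "q = (if p = \<infinity> then 3 else min (enn2real p) 3)"
  have q: "12 / 5 < q" "q < 4" "p = \<infinity> \<or> q \<le> enn2real p"
    using p by (cases p; auto simp: q_def ennreal_less_iff)+
  have Ks [measurable]: "K \<in> sets borel" using assms(4) by (simp add: borel_compact)
  have Ks': "K \<inter> space lebesgue \<in> sets lebesgue" by simp
  define M where "M = measure lborel K + 1"
  have M: "M > 0" by (simp add: M_def add_nonneg_pos)
  have LB: "(AE u in lborel. cross_map A B u \<noteq> 0) \<and> Lambda_bounded K q (cross_map A B)"
    by (rule Lambda_bound[OF assms(1-3) compact_imp_bounded[OF assms(4)] q(1,2)])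
  then obtain C2 where C2: "C2 \<ge> 0" "\<And>Z f. Z > 0 \<Longrightarrow> f \<in> borel_measurable borel \<Longrightarrow> (\<forall>x. x \<notin> K \<longrightarrow> f x = 0) \<Longrightarrow>
    (\<integral>\<^sup>+x. epow (f x) q \<partial>lborel) \<le> ennreal Z \<Longrightarrow> Lambda (cross_map A B) f \<le> ennreal (C2 * Z powr (4 / q))"
    unfolding Lambda_bounded_def by blast
  obtain C1 where C1: "C1 > 0" "\<And>g. integrable lborel g \<Longrightarrow>
      (\<integral>\<^sup>+x. ennreal (cmod (\<integral>\<xi>. exp (\<i> * complex_of_real (x \<bullet> surface_param A B \<xi>)) * g \<xi> \<partial>lborel) ^ 4) \<partial>lborel)
        \<le> ennreal C1 * Lambda (cross_map A B) (\<lambda>x. ennreal (cmod (g x)))"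
    by (rule L4_le_Lambda[OF assms(1,2) conjunct1[OF LB] that])
  \<comment> \<open>From (\<kappa>^q M)^(4/q) = \<kappa>^4 M^(4/q), where \<open>M\<close> accounts
    for the volume of \<open>K\<close>.\<close>
  define C0 where "C0 = C1 * C2 * M powr (4 / q)"
  have C0: "C0 \<ge> 0" using C1 C2 by (simp add: C0_def)
  have est: "extension_op A B K f \<in> Lp_space lebesgue 4 \<and>
      Lp_norm lebesgue 4 (extension_op A B K f) \<le> (C0 powr (1 / 4) + 1) * Lp_norm (lebesgue_on K) p f"
    if f: "f \<in> Lp_space (lebesgue_on K) p" for f
  proof -
    let ?N = "Lp_norm (lebesgue_on K) p f"
    have N0: "?N \<ge> 0" by (simp add: Lp_norm_def)
    have fm: "f \<in> borel_measurable (lebesgue_on K)" using f by (simp add: Lp_space_def)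
    obtain g where g: "g \<in> borel_measurable borel" "\<And>x. x \<notin> K \<Longrightarrow> g x = 0"
      "AE x in lebesgue. indicator K x *\<^sub>R f x = g x"
      by (rule borel_representative[OF assms(4) fm that])
    note g(1)[measurable]
    have dom: "(\<integral>\<^sup>+x. epow (ennreal (cmod (g x))) q \<partial>lborel) \<le> ennreal (\<kappa> powr q * M)"
      if "\<kappa> > 0" "\<kappa> \<ge> ?N" for \<kappa>
      unfolding M_def using q by (intro Lp_norm_dominates[OF assms(4) f _ q(3) g that]) auto
    define E where "E x = (\<integral>\<xi>. exp (\<i> * complex_of_real (x \<bullet> surface_param A B \<xi>)) * g \<xi> \<partial>lborel)" for x
    have Em [measurable]: "E \<in> borel_measurable borel" unfolding E_def by measurable
    \<comment> \<open>A change on a null set leaves the integral unchanged, so equality holds at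
      every point \<open>x\<close>.\<close>
    have EE: "extension_op A B K f = E"
    proof
      fix x
      let ?e = "\<lambda>\<xi>. exp (\<i> * complex_of_real (x \<bullet> surface_param A B \<xi>))"
      have em [measurable]: "?e \<in> borel_measurable borel" by measurable
      have "extension_op A B K f x = (\<integral>\<xi>. indicator K \<xi> *\<^sub>R (?e \<xi> * f \<xi>) \<partial>lebesgue)"
        unfolding extension_op_def by (rule integral_restrict_space[OF Ks'])
      also have "\<dots> = (\<integral>\<xi>. ?e \<xi> * g \<xi> \<partial>lebesgue)"
      proof (rule integral_cong_AE)
        have "(\<lambda>\<xi>. indicator K \<xi> *\<^sub>R f \<xi>) \<in> borel_measurable lebesgue"
          using fm Ks' by (subst (asm) borel_measurable_restrict_space_iff) simp_all
        moreover have "?e \<in> borel_measurable lebesgue" by (rule measurable_completion) simp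
        ultimately have "(\<lambda>\<xi>. ?e \<xi> * (indicator K \<xi> *\<^sub>R f \<xi>)) \<in> borel_measurable lebesgue"
          by (intro borel_measurable_times)
        then show "(\<lambda>\<xi>. indicator K \<xi> *\<^sub>R (?e \<xi> * f \<xi>)) \<in> borel_measurable lebesgue" by simp
        show "(\<lambda>\<xi>. ?e \<xi> * g \<xi>) \<in> borel_measurable lebesgue"
          by (rule measurable_completion) simp
        show "AE \<xi> in lebesgue. indicator K \<xi> *\<^sub>R (?e \<xi> * f \<xi>) = ?e \<xi> * g \<xi>"
          using g(3)
        proof eventually_elim
          case (elim \<xi>)
          show ?case unfolding elim[symmetric] by simp
        qed
      qed
      also have "\<dots> = E x"
        unfolding E_def by (rule integral_completion) simp
      finally show "extension_op A B K f x = E x" .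
    qed
    \<comment> \<open>Where |g| exceeds 1 it is at most |g|^q, and elsewhere it is at most the
      indicator of \<open>K\<close>.\<close>
    have gint: "integrable lborel g"
    proof (rule integrableI_bounded)
      have "(\<integral>\<^sup>+x. ennreal (norm (g x)) \<partial>lborel) \<le> (\<integral>\<^sup>+x. (indicator K x + epow (ennreal (cmod (g x))) q) \<partial>lborel)"
      proof (rule nn_integral_mono)
        fix x
        show "ennreal (norm (g x)) \<le> indicator K x + epow (ennreal (cmod (g x))) q"
        proof (cases "cmod (g x) \<le> 1")
          case True
          then have "ennreal (norm (g x)) \<le> indicator K x"
            using g(2)[of x] by (cases "x \<in> K") auto
          then show ?thesis by (rule order_trans) simp
        next
          case False
          then have "cmod (g x) powr 1 \<le> cmod (g x) powr q"
            using q by (intro powr_mono) auto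
          then have "ennreal (norm (g x)) \<le> epow (ennreal (cmod (g x))) q"
            by (simp add: epow_ennreal ennreal_leI)
          then show ?thesis by (rule order_trans) simp
        qed
      qed
      also have "\<dots> = emeasure lborel K + (\<integral>\<^sup>+x. epow (ennreal (cmod (g x))) q \<partial>lborel)"
        by (subst nn_integral_add) auto
      also have "\<dots> < \<infinity>"
        using emeasure_bounded_finite[OF compact_imp_bounded[OF assms(4)]] dom[of "?N + 1"] N0
        by (auto simp: less_top[symmetric] top_unique)
      finally show "(\<integral>\<^sup>+x. ennreal (norm (g x)) \<partial>lborel) < \<infinity>" .
    qed simp
    have L4: "(\<integral>\<^sup>+x. ennreal (cmod (E x) ^ 4) \<partial>lborel) \<le> ennreal (C0 * \<kappa> ^ 4)"
      if \<kappa>: "\<kappa> > 0" "\<kappa> \<ge> ?N" for \<kappa>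
    proof -
      have "(\<integral>\<^sup>+x. ennreal (cmod (E x) ^ 4) \<partial>lborel) \<le> ennreal C1 * Lambda (cross_map A B) (\<lambda>x. ennreal (cmod (g x)))"
        unfolding E_def by (rule C1(2)[OF gint])
      also have "\<dots> \<le> ennreal C1 * ennreal (C2 * (\<kappa> powr q * M) powr (4 / q))"
        using \<kappa> M g(2) dom[OF \<kappa>] by (intro mult_left_mono C2(2)) auto
      also have "\<dots> = ennreal (C0 * \<kappa> ^ 4)"
      proof -
        have "(\<kappa> powr q * M) powr (4 / q) = \<kappa> ^ 4 * M powr (4 / q)"
          using \<kappa> M q by (simp add: powr_mult powr_powr)
        then show ?thesis using C1 C2 by (simp add: C0_def ennreal_mult[symmetric] mult_ac)
      qed
      finally show ?thesis .
    qed
    have fin: "(\<integral>\<^sup>+x. ennreal (cmod (E x) ^ 4) \<partial>lborel) < \<infinity>"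
      using L4[of "?N + 1"] N0 by (auto intro: le_less_trans)
    have int: "integrable lborel (\<lambda>x. cmod (E x) ^ 4)"
      using fin by (intro integrableI_nonneg) auto
    have int': "integrable lebesgue (\<lambda>x. cmod (E x) ^ 4)"
      by (subst integrable_completion) (auto intro: int)
    define X where "X = (\<integral>x. cmod (E x) ^ 4 \<partial>lebesgue)"
    have X0: "X \<ge> 0" unfolding X_def by (rule integral_nonneg_AE) simp
    have X: "ennreal X = (\<integral>\<^sup>+x. ennreal (cmod (E x) ^ 4) \<partial>lborel)"
      unfolding X_def by (subst integral_completion) (auto intro!: nn_integral_eq_integral[symmetric] int)
    have root: "X powr (1 / 4) \<le> C0 powr (1 / 4) * \<kappa>" if \<kappa>: "\<kappa> > 0" "\<kappa> \<ge> ?N" for \<kappa>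
    proof -
      have "X \<le> C0 * \<kappa> ^ 4"
        using L4[OF \<kappa>] C0 \<kappa>(1) unfolding X[symmetric] by (subst (asm) ennreal_le_iff) auto
      then have "X powr (1 / 4) \<le> (C0 * \<kappa> ^ 4) powr (1 / 4)"
        using X0 by (intro powr_mono2) auto
      also have "\<dots> = C0 powr (1 / 4) * (\<kappa> powr 4) powr (1 / 4)"
        using C0 \<kappa>(1) by (simp add: powr_mult)
      also have "(\<kappa> powr 4) powr (1 / 4) = \<kappa>"
        using \<kappa>(1) by (simp only: powr_powr) simp
      finally show ?thesis .
    qed
    have "X powr (1 / 4) \<le> C0 powr (1 / 4) * ?N"
    \<comment> \<open>\<open>root\<close> requires a positive \<kappa> that is at least the norm;
      letting \<open>?N + e / c\<close> decrease to the norm also covers norm zero.\<close>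
    proof (rule field_le_epsilon)
      fix e :: real assume e: "e > 0"
      define c where "c = C0 powr (1 / 4) + 1"
      have c: "c > 0" by (simp add: c_def add_nonneg_pos)
      have "X powr (1 / 4) \<le> C0 powr (1 / 4) * (?N + e / c)"
        using e c N0 by (intro root) (auto intro: add_nonneg_pos)
      also have "\<dots> = C0 powr (1 / 4) * ?N + C0 powr (1 / 4) * (e / c)" by (simp add: distrib_left)
      also have "C0 powr (1 / 4) * (e / c) \<le> c * (e / c)"
        using e c by (intro mult_right_mono) (auto simp: c_def)
      finally show "X powr (1 / 4) \<le> C0 powr (1 / 4) * ?N + e" using c by simp
    qed
    also have "\<dots> \<le> (C0 powr (1 / 4) + 1) * ?N" using N0 by (simp add: algebra_simps)
    finally have le: "X powr (1 / 4) \<le> (C0 powr (1 / 4) + 1) * ?N" .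
    have "E \<in> borel_measurable lebesgue" by (rule measurable_completion) simp
    then have "E \<in> Lp_space lebesgue 4"
      using int' by (simp add: Lp_space_def)
    moreover have "Lp_norm lebesgue 4 E = X powr (1 / 4)"
      by (simp add: Lp_norm_def X_def)
    ultimately show ?thesis using le unfolding EE by simp
  qed
  show "extension_estimate A B K p 4"
    unfolding extension_estimate_def
    using est by (intro exI[of _ "C0 powr (1 / 4) + 1"]) (auto intro: add_nonneg_pos)
qed

end
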